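(* For each even $n$, let $z \in \{\pm 1\}^n$ be a fixed vector with $\langle z, \mathbf{1}\rangle = 0$, let $p = p_n$ and $q = q_n$ satisfy $1 \ge p \ge q \ge 0$, and let $A$ be the adjacency matrix of a random (simple, undirected) graph on $n$ vertices in which edges are present independently with probabilities, for $i < j$, $$ \mathbf{P}(A_{ij} = 1) = \begin{cases} p & \text{if } z_i = z_j, \\ q & \text{if } z_i \ne z_j . \end{cases} $$ Suppose that, for some $\epsilon \in (0, 1/2)$ independent of $n$, for all sufficiently large (even) $n$, $$ \frac{n}{\log n} \left( \sqrt{(1-\epsilon) p + \epsilon q} - \sqrt{(1-\epsilon) q + \epsilon p} \right)^2 \ge 2 . $$ Let $C = A - c\, \mathbf{1}\mathbf{1}^T$, where either $c = \frac{p+q}{2}$ or $c = \frac{1}{n^2} \langle A, \mathbf{1}\mathbf{1}^T\rangle$. Then, with probability $\to 1$ as $n \to \infty$, for all integers $r \ge 2$, every second-order critical point $Y$ of $$ \max_{Y \in \mathbf{R}^{n \times r}} \ \langle C, Y Y^T \rangle \quad \text{subject to} \quad \operatorname{diag}(Y Y^T) = \mathbf{1} $$ satisfies $Y Y^T = z z^T$.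
   Context: Notation: $\langle \cdot, \cdot\rangle$ is the standard Euclidean inner product of vectors, or of matrices, $\langle A, B\rangle = \operatorname{tr}(A^T B)$; $\mathbf{1}$ is the all-ones vector in $\mathbf{R}^n$; for a square matrix $A$, $\operatorname{diag}(A)$ is the vector of its diagonal entries and $\operatorname{ddiag}(A)$ is the diagonal matrix with the same diagonal as $A$. The parameters $p,q$ may depend on $n$. Second-order critical point: a feasible point $Y \in \mathbf{R}^{n\times r}$ (i.e. $\operatorname{diag}(YY^T) = \mathbf{1}$) at which the Riemannian gradient of the objective on the product of unit spheres is zero and the Riemannian Hessian is negative semidefinite. Equivalently, with $S(Y) := \operatorname{ddiag}(C Y Y^T) - C$, one has $S(Y) Y = 0$ and $\langle S(Y), \dot Y \dot Y^T\rangle \ge 0$ for all $\dot Y \in \mathbf{R}^{n \times r}$ with $\operatorname{diag}(Y \dot Y^T) = 0$. *)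

theory Defs
  imports
    "HOL-Probability.Probability"
    "Jordan_Normal_Form.Matrix"
begin

hide_const (open) Finite_Cartesian_Product.vec Finite_Cartesian_Product.mat
  Finite_Cartesian_Product.row Finite_Cartesian_Product.column
  Finite_Cartesian_Product.transpose

no_notation vec_nth (infixl \<open>$\<close> 90)

section \<open>Vectors and matrices\<close>

definition ones_vec :: "nat \<Rightarrow> real vec" where
  "ones_vec n = vec n (\<lambda>_. 1)"

definition outer :: "real vec \<Rightarrow> real vec \<Rightarrow> real mat" where
  "outer u v = mat (dim_vec u) (dim_vec v) (\<lambda>(i,j). u $ i * v $ j)"

definition mat_trace :: "real mat \<Rightarrow> real" where
  "mat_trace A = (\<Sum>i<dim_row A. A $$ (i,i))"

definition mat_inner :: "real mat \<Rightarrow> real mat \<Rightarrow> real" where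
  "mat_inner A B = mat_trace (A\<^sup>T * B)"

definition diag_vec :: "real mat \<Rightarrow> real vec" where
  "diag_vec A = vec (dim_row A) (\<lambda>i. A $$ (i,i))"

definition ddiag :: "real mat \<Rightarrow> real mat" where
  "ddiag A = mat (dim_row A) (dim_row A) (\<lambda>(i,j). if i = j then A $$ (i,i) else 0)"

definition unit_mat :: "nat \<Rightarrow> nat \<Rightarrow> nat \<times> nat \<Rightarrow> real mat" where
  "unit_mat n r k = mat n r (\<lambda>l. if l = k then 1 else 0)"


section \<open>Second-order critical points on a product of spheres\<close>

definition sphere_product :: "nat \<Rightarrow> nat \<Rightarrow> real mat set" where
  "sphere_product n r = {Y \<in> carrier_mat n r. diag_vec (Y * Y\<^sup>T) = ones_vec n}"

definition tangent_space :: "real mat \<Rightarrow> real mat set" where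
  "tangent_space Y =
     {V \<in> carrier_mat (dim_row Y) (dim_col Y). diag_vec (Y * V\<^sup>T) = 0\<^sub>v (dim_row Y)}"

text \<open>For \<open>Y\<close> with unit rows this is the orthogonal projection onto the tangent space at \<open>Y\<close>:
  row \<open>i\<close> of \<open>Z\<close> loses its component along row \<open>i\<close> of \<open>Y\<close>.\<close>

definition tangent_proj :: "real mat \<Rightarrow> real mat \<Rightarrow> real mat" where
  "tangent_proj Y Z = Z - ddiag (Z * Y\<^sup>T) * Y"

definition euclidean_grad :: "(real mat \<Rightarrow> real) \<Rightarrow> real mat \<Rightarrow> real mat" where
  "euclidean_grad f Y = mat (dim_row Y) (dim_col Y)
     (\<lambda>k. deriv (\<lambda>t. f (Y + t \<cdot>\<^sub>m unit_mat (dim_row Y) (dim_col Y) k)) 0)"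

definition riemannian_grad :: "(real mat \<Rightarrow> real) \<Rightarrow> real mat \<Rightarrow> real mat" where
  "riemannian_grad f Y = tangent_proj Y (euclidean_grad f Y)"

text \<open>The Riemannian Hessian of a submanifold of a Euclidean space (with the induced metric):
  differentiate a smooth extension of the gradient field in the ambient space along a tangent
  direction, and project. The extension used here is the formula for \<^term>\<open>riemannian_grad\<close>,
  which makes sense for all matrices; the result does not depend on this choice.\<close>

definition riemannian_hess ::
    "(real mat \<Rightarrow> real) \<Rightarrow> real mat \<Rightarrow> real mat \<Rightarrow> real mat" where
  "riemannian_hess f Y V = tangent_proj Y (mat (dim_row Y) (dim_col Y)
     (\<lambda>k. deriv (\<lambda>t. riemannian_grad f (Y + t \<cdot>\<^sub>m V) $$ k) 0))"

text \<open>Second-order critical points for the \<^emph>\<open>maximization\<close> of \<open>f\<close>.\<close>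

definition second_order_critical ::
    "nat \<Rightarrow> nat \<Rightarrow> (real mat \<Rightarrow> real) \<Rightarrow> real mat \<Rightarrow> bool" where
  "second_order_critical n r f Y \<longleftrightarrow>
     Y \<in> sphere_product n r \<and>
     riemannian_grad f Y = 0\<^sub>m n r \<and>
     (\<forall>V \<in> tangent_space Y. mat_inner V (riemannian_hess f Y V) \<le> 0)"

definition objective :: "real mat \<Rightarrow> real mat \<Rightarrow> real" where
  "objective C Y = mat_inner C (Y * Y\<^sup>T)"


section \<open>The two-community stochastic block model\<close>

text \<open>An outcome assigns to each pair \<open>(i, j)\<close> with \<open>i < j < n\<close> whether \<open>{i, j}\<close> is an edge.\<close>

definition adjacency_mat :: "nat \<Rightarrow> (nat \<times> nat \<Rightarrow> bool) \<Rightarrow> real mat" where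
  "adjacency_mat n E = mat n n
     (\<lambda>(i,j). if i \<noteq> j \<and> E (min i j, max i j) then 1 else 0)"

definition sbm_edges :: "nat \<Rightarrow> real vec \<Rightarrow> real \<Rightarrow> real \<Rightarrow> (nat \<times> nat \<Rightarrow> bool) pmf" where
  "sbm_edges n z p q = Pi_pmf {(i,j). i < j \<and> j < n} False
     (\<lambda>(i,j). bernoulli_pmf (if z $ i = z $ j then p else q))"

definition sbm_adjacency :: "nat \<Rightarrow> real vec \<Rightarrow> real \<Rightarrow> real \<Rightarrow> real mat pmf" where
  "sbm_adjacency n z p q = map_pmf (adjacency_mat n) (sbm_edges n z p q)"


section \<open>The explicit form of the criticality conditions\<close>

definition S_mat :: "real mat \<Rightarrow> real mat \<Rightarrow> real mat" where
  "S_mat C Y = ddiag (C * Y * Y\<^sup>T) - C"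

lemma mat_inner_sum:
  assumes "A \<in> carrier_mat n m" "B \<in> carrier_mat n m"
  shows "mat_inner A B = (\<Sum>j<m. \<Sum>i<n. A $$ (i,j) * B $$ (i,j))"
  using assms
  by (auto simp: mat_inner_def mat_trace_def scalar_prod_def atLeast0LessThan intro!: sum.cong)

lemma index_mult_sum:
  assumes "A \<in> carrier_mat n m" "B \<in> carrier_mat m l" "i < n" "j < l"
  shows "(A * B) $$ (i,j) = (\<Sum>k<m. A $$ (i,k) * B $$ (k,j))"
  using assms by (auto simp: scalar_prod_def atLeast0LessThan intro!: sum.cong)

lemma mat_inner_gram:
  assumes "C \<in> carrier_mat n n" "Y \<in> carrier_mat n r" "V \<in> carrier_mat n r"
  shows "mat_inner C (Y * V\<^sup>T) = mat_inner (C * V) Y"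
proof -
  have "mat_inner C (Y * V\<^sup>T) = (\<Sum>j<n. \<Sum>i<n. C $$ (i,j) * (\<Sum>k<r. Y $$ (i,k) * V $$ (j,k)))"
    using assms by (subst mat_inner_sum[of _ n n])
      (auto simp del: index_mult_mat(1) simp add: index_mult_sum[of _ n r _ n] intro!: sum.cong)
  also have "\<dots> = (\<Sum>j<n. \<Sum>i<n. \<Sum>k<r. C $$ (i,j) * V $$ (j,k) * Y $$ (i,k))"
    by (simp add: sum_distrib_left mult_ac)
  also have "\<dots> = (\<Sum>i<n. \<Sum>j<n. \<Sum>k<r. C $$ (i,j) * V $$ (j,k) * Y $$ (i,k))"
    by (rule sum.swap)
  also have "\<dots> = (\<Sum>i<n. \<Sum>k<r. \<Sum>j<n. C $$ (i,j) * V $$ (j,k) * Y $$ (i,k))"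
    by (intro sum.cong refl sum.swap)
  also have "\<dots> = (\<Sum>k<r. \<Sum>i<n. \<Sum>j<n. C $$ (i,j) * V $$ (j,k) * Y $$ (i,k))"
    by (rule sum.swap)
  also have "\<dots> = mat_inner (C * V) Y"
    using assms by (subst mat_inner_sum[of _ n r])
      (auto simp del: index_mult_mat(1) simp add: index_mult_sum[of _ n n _ r] sum_distrib_right
        intro!: sum.cong)
  finally show ?thesis .
qed

lemma mat_inner_commute:
  assumes "A \<in> carrier_mat n m" "B \<in> carrier_mat n m"
  shows "mat_inner A B = mat_inner B A"
  using assms by (simp add: mat_inner_sum[of _ n m] mult.commute)

lemma mat_inner_sym_swap:
  assumes C: "C \<in> carrier_mat n n" and sym: "C\<^sup>T = C"
    and Y: "Y \<in> carrier_mat n r" and V: "V \<in> carrier_mat n r"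
  shows "mat_inner (C * Y) V = mat_inner (C * V) Y"
proof -
  have tr: "mat_inner A\<^sup>T B\<^sup>T = mat_inner A B"
    if "A \<in> carrier_mat n n" "B \<in> carrier_mat n n" for A B
  proof -
    have "mat_inner A\<^sup>T B\<^sup>T = (\<Sum>j<n. \<Sum>i<n. A $$ (j,i) * B $$ (j,i))"
      using that by (subst mat_inner_sum[of _ n n]) auto
    also have "\<dots> = mat_inner A B"
      using that by (subst sum.swap) (simp add: mat_inner_sum[of _ n n])
    finally show ?thesis .
  qed
  have "mat_inner (C * Y) V = mat_inner C (V * Y\<^sup>T)"
    using mat_inner_gram[OF C V Y] by simp
  also have "\<dots> = mat_inner C\<^sup>T (V * Y\<^sup>T)\<^sup>T"
    using tr[of C "V * Y\<^sup>T"] C Y V by simp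
  also have "\<dots> = mat_inner C (Y * V\<^sup>T)"
    using sym transpose_mult[of V n r "Y\<^sup>T" n] Y V by simp
  also have "\<dots> = mat_inner (C * V) Y"
    by (rule mat_inner_gram[OF C Y V])
  finally show ?thesis .
qed

lemma index_mult_line:
  fixes C :: "real mat"
  assumes C: "C \<in> carrier_mat n n" and Y: "Y \<in> carrier_mat n r" and V: "V \<in> carrier_mat n r"
    and i: "i < n" and k: "k < r"
  shows "(C * (Y + t \<cdot>\<^sub>m V)) $$ (i,k) = (C * Y) $$ (i,k) + t * (C * V) $$ (i,k)"
proof -
  have "C * (Y + t \<cdot>\<^sub>m V) = C * Y + t \<cdot>\<^sub>m (C * V)"
    using C Y V mult_smult_distrib[OF C V, of t] by (simp add: mult_add_distrib_mat[of _ n n])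
  then show ?thesis using C Y V i k by simp
qed

lemma objective_line:
  assumes C: "C \<in> carrier_mat n n" and sym: "C\<^sup>T = C"
    and Y: "Y \<in> carrier_mat n r" and V: "V \<in> carrier_mat n r"
  shows "objective C (Y + t \<cdot>\<^sub>m V) =
    objective C Y + t * (2 * mat_inner (C * Y) V) + t\<^sup>2 * mat_inner (C * V) V"
proof -
  have YV: "Y + t \<cdot>\<^sub>m V \<in> carrier_mat n r" using Y V by simp
  have o: "objective C M = mat_inner (C * M) M" if "M \<in> carrier_mat n r" for M
    unfolding objective_def using mat_inner_gram[OF C that that] .
  have "objective C (Y + t \<cdot>\<^sub>m V) = (\<Sum>k<r. \<Sum>i<n. (C * (Y + t \<cdot>\<^sub>m V)) $$ (i,k) * (Y + t \<cdot>\<^sub>m V) $$ (i,k))"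
    unfolding o[OF YV] using C Y V by (subst mat_inner_sum[of _ n r]) auto
  also have "\<dots> = (\<Sum>k<r. \<Sum>i<n. (C * Y) $$ (i,k) * Y $$ (i,k)
      + t * ((C * Y) $$ (i,k) * V $$ (i,k)) + t * ((C * V) $$ (i,k) * Y $$ (i,k))
      + t\<^sup>2 * ((C * V) $$ (i,k) * V $$ (i,k)))"
  proof (intro sum.cong refl)
    fix k i assume "k \<in> {..<r}" "i \<in> {..<n}"
    then have ik: "i < n" "k < r" by auto
    have e: "(Y + t \<cdot>\<^sub>m V) $$ (i,k) = Y $$ (i,k) + t * V $$ (i,k)" using ik Y V by simp
    show "(C * (Y + t \<cdot>\<^sub>m V)) $$ (i,k) * (Y + t \<cdot>\<^sub>m V) $$ (i,k) =
      (C * Y) $$ (i,k) * Y $$ (i,k)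
      + t * ((C * Y) $$ (i,k) * V $$ (i,k)) + t * ((C * V) $$ (i,k) * Y $$ (i,k))
      + t\<^sup>2 * ((C * V) $$ (i,k) * V $$ (i,k))"
      unfolding index_mult_line[OF C Y V ik] e by (simp add: algebra_simps power2_eq_square)
  qed
  also have "\<dots> = mat_inner (C * Y) Y + t * mat_inner (C * Y) V + t * mat_inner (C * V) Y
      + t\<^sup>2 * mat_inner (C * V) V"
    using C Y V by (simp add: mat_inner_sum[of _ n r] sum.distrib sum_distrib_left del: index_mult_mat(1))
  finally show ?thesis
    using mat_inner_sym_swap[OF C sym Y V] o[OF Y] by simp
qed

lemma euclidean_grad_objective:
  assumes C: "C \<in> carrier_mat n n" and sym: "C\<^sup>T = C" and Y: "Y \<in> carrier_mat n r"
  shows "euclidean_grad (objective C) Y = 2 \<cdot>\<^sub>m (C * Y)"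
proof (rule eq_matI)
  fix i k assume "i < dim_row (2 \<cdot>\<^sub>m (C * Y))" "k < dim_col (2 \<cdot>\<^sub>m (C * Y))"
  then have ik: "i < n" "k < r" using C Y by auto
  let ?E = "unit_mat n r (i,k)"
  have E: "?E \<in> carrier_mat n r" by (simp add: unit_mat_def)
  have "((\<lambda>t. objective C (Y + t \<cdot>\<^sub>m ?E)) has_field_derivative 2 * mat_inner (C * Y) ?E) (at 0)"
    unfolding objective_line[OF C sym Y E] by (auto intro!: derivative_eq_intros)
  then have "deriv (\<lambda>t. objective C (Y + t \<cdot>\<^sub>m ?E)) 0 = 2 * mat_inner (C * Y) ?E"
    by (rule DERIV_imp_deriv)
  moreover have "mat_inner (C * Y) ?E = (C * Y) $$ (i,k)"
  proof -
    have "mat_inner (C * Y) ?E = (\<Sum>l<r. \<Sum>j<n. (C * Y) $$ (j,l) * ?E $$ (j,l))"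
      using C Y E by (subst mat_inner_sum[of _ n r]) auto
    also have "\<dots> = (\<Sum>l<r. \<Sum>j<n. if l = k then (if j = i then (C * Y) $$ (j,l) else 0) else 0)"
      by (intro sum.cong refl) (auto simp: unit_mat_def)
    also have "\<dots> = (\<Sum>l<r. if l = k then (\<Sum>j<n. if j = i then (C * Y) $$ (j,l) else 0) else 0)"
      by (intro sum.cong refl) simp
    also have "\<dots> = (C * Y) $$ (i,k)"
      using ik by (simp del: index_mult_mat(1))
    finally show ?thesis .
  qed
  ultimately show "euclidean_grad (objective C) Y $$ (i,k) = (2 \<cdot>\<^sub>m (C * Y)) $$ (i,k)"
    using C Y ik by (simp add: euclidean_grad_def)
qed (use C Y in \<open>auto simp: euclidean_grad_def\<close>)

lemma ddiag_mult_index: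
  assumes "D \<in> carrier_mat n n" "Y \<in> carrier_mat n r" "i < n" "k < r"
  shows "(ddiag D * Y) $$ (i,k) = D $$ (i,i) * Y $$ (i,k)"
proof -
  have "(ddiag D * Y) $$ (i,k) = (\<Sum>j<n. ddiag D $$ (i,j) * Y $$ (j,k))"
    using assms by (intro index_mult_sum) (auto simp: ddiag_def)
  also have "\<dots> = (\<Sum>j<n. if j = i then D $$ (i,i) * Y $$ (i,k) else 0)"
    using assms by (intro sum.cong refl) (auto simp: ddiag_def)
  finally show ?thesis using assms by simp
qed

lemma S_mat_mult_index:
  assumes "C \<in> carrier_mat n n" "Y \<in> carrier_mat n r" "V \<in> carrier_mat n r" "i < n" "k < r"
  shows "(S_mat C Y * V) $$ (i,k) = (C * Y * Y\<^sup>T) $$ (i,i) * V $$ (i,k) - (C * V) $$ (i,k)"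
proof -
  have "ddiag (C * Y * Y\<^sup>T) \<in> carrier_mat n n" using assms by (simp add: ddiag_def)
  then have "S_mat C Y * V = ddiag (C * Y * Y\<^sup>T) * V - C * V"
    unfolding S_mat_def using assms by (intro minus_mult_distrib_mat) auto
  then show ?thesis
    using assms ddiag_mult_index[of "C * Y * Y\<^sup>T" n V r i k] by (simp del: index_mult_mat(1))
qed

lemma riemannian_grad_objective:
  assumes C: "C \<in> carrier_mat n n" and sym: "C\<^sup>T = C" and Y: "Y \<in> carrier_mat n r"
  shows "riemannian_grad (objective C) Y = (- 2) \<cdot>\<^sub>m (S_mat C Y * Y)"
proof (rule eq_matI)
  fix i k assume "i < dim_row ((- 2) \<cdot>\<^sub>m (S_mat C Y * Y))" "k < dim_col ((- 2) \<cdot>\<^sub>m (S_mat C Y * Y))"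
  then have ik: "i < n" "k < r" using C Y by (auto simp: S_mat_def)
  have e: "2 \<cdot>\<^sub>m (C * Y) * Y\<^sup>T = 2 \<cdot>\<^sub>m (C * Y * Y\<^sup>T)" 
    using C Y by (intro mult_smult_assoc_mat[of _ n r]) auto
  have "riemannian_grad (objective C) Y $$ (i,k)
      = 2 * (C * Y) $$ (i,k) - (2 \<cdot>\<^sub>m (C * Y * Y\<^sup>T)) $$ (i,i) * Y $$ (i,k)"
    unfolding riemannian_grad_def euclidean_grad_objective[OF C sym Y] tangent_proj_def e
    using C Y ik ddiag_mult_index[of "2 \<cdot>\<^sub>m (C * Y * Y\<^sup>T)" n Y r i k]
    by (simp del: index_mult_mat(1) add: ddiag_def)
  then show "riemannian_grad (objective C) Y $$ (i,k) = ((- 2) \<cdot>\<^sub>m (S_mat C Y * Y)) $$ (i,k)"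
    using C Y ik S_mat_mult_index[OF C Y Y ik]
    by (simp del: index_mult_mat(1) add: S_mat_def algebra_simps)
qed (use C Y in \<open>auto simp: riemannian_grad_def tangent_proj_def S_mat_def ddiag_def euclidean_grad_def\<close>)

lemma tangent_space_row:
  assumes Y: "Y \<in> carrier_mat n r" and V: "V \<in> tangent_space Y" and i: "i < n"
  shows "(\<Sum>k<r. V $$ (i,k) * (a * Y $$ (i,k))) = 0"
proof -
  have Vc: "V \<in> carrier_mat n r" using V Y by (auto simp: tangent_space_def)
  have "diag_vec (Y * V\<^sup>T) $ i = 0"
    using V Y i by (auto simp: tangent_space_def)
  then have "(Y * V\<^sup>T) $$ (i,i) = 0" using Y i by (simp add: diag_vec_def)
  then have "(\<Sum>k<r. Y $$ (i,k) * V $$ (i,k)) = 0"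
    using index_mult_sum[of Y n r "V\<^sup>T" n i i] Y Vc i by simp
  then have "a * (\<Sum>k<r. Y $$ (i,k) * V $$ (i,k)) = 0" by simp
  then show ?thesis by (simp add: sum_distrib_left mult_ac)
qed

lemma mat_inner_tangent_proj:
  assumes Y: "Y \<in> carrier_mat n r" and V: "V \<in> tangent_space Y" and W: "W \<in> carrier_mat n r"
  shows "mat_inner V (tangent_proj Y W) = mat_inner V W"
proof -
  have Vc: "V \<in> carrier_mat n r" using V Y by (auto simp: tangent_space_def)
  note t = tangent_space_row[OF Y V]
  define d where "d = (\<lambda>i. (W * Y\<^sup>T) $$ (i,i))"
  have P: "tangent_proj Y W \<in> carrier_mat n r"
    using Y W by (auto simp: tangent_proj_def ddiag_def)
  have e: "tangent_proj Y W $$ (i,k) = W $$ (i,k) - d i * Y $$ (i,k)" if "i < n" "k < r" for i k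
    using that Y W ddiag_mult_index[of "W * Y\<^sup>T" n Y r i k]
    by (simp add: tangent_proj_def d_def ddiag_def del: index_mult_mat(1))
  have "mat_inner V (tangent_proj Y W)
      = (\<Sum>k<r. \<Sum>i<n. V $$ (i,k) * W $$ (i,k) - V $$ (i,k) * (d i * Y $$ (i,k)))"
    using Vc P by (auto simp: mat_inner_sum[of _ n r] e right_diff_distrib intro!: sum.cong)
  also have "\<dots> = mat_inner V W - (\<Sum>k<r. \<Sum>i<n. V $$ (i,k) * (d i * Y $$ (i,k)))"
    using Vc W by (simp add: mat_inner_sum[of _ n r] sum_subtractf)
  also have "(\<Sum>k<r. \<Sum>i<n. V $$ (i,k) * (d i * Y $$ (i,k))) = 0"
    by (subst sum.swap) (simp add: t)
  finally show ?thesis by simp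
qed

lemma riemannian_hess_objective:
  assumes C: "C \<in> carrier_mat n n" and sym: "C\<^sup>T = C" and Y: "Y \<in> carrier_mat n r"
    and V: "V \<in> tangent_space Y"
  shows "mat_inner V (riemannian_hess (objective C) Y V) = - 2 * mat_inner (S_mat C Y) (V * V\<^sup>T)"
proof -
  have Vc: "V \<in> carrier_mat n r" using V Y by (auto simp: tangent_space_def)
  define e where "e = (\<lambda>i. \<Sum>l<r. (C * Y) $$ (i,l) * V $$ (i,l) + (C * V) $$ (i,l) * Y $$ (i,l))"
  define W where "W = mat n r
     (\<lambda>k. deriv (\<lambda>t. riemannian_grad (objective C) (Y + t \<cdot>\<^sub>m V) $$ k) 0)"
  have W: "W \<in> carrier_mat n r" by (simp add: W_def)
  have Wi: "W $$ (i,k) = - 2 * ((S_mat C Y * V) $$ (i,k) + e i * Y $$ (i,k))"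
    if ik: "i < n" "k < r" for i k
  proof -
    have M: "Y + t \<cdot>\<^sub>m V \<in> carrier_mat n r" for t using Y Vc by simp
    have Mi: "(Y + t \<cdot>\<^sub>m V) $$ (i,l) = Y $$ (i,l) + t * V $$ (i,l)" if "l < r" for t l
      using that ik Y Vc by simp
    have d: "(C * A * A\<^sup>T) $$ (i,i) = (\<Sum>l<r. (C * A) $$ (i,l) * A $$ (i,l))"
      if "A \<in> carrier_mat n r" for A
      using index_mult_sum[of "C * A" n r "A\<^sup>T" n i i] that C ik
      by (simp del: index_mult_mat(1))
    have g: "riemannian_grad (objective C) (Y + t \<cdot>\<^sub>m V) $$ (i,k) =
        - 2 * ((\<Sum>l<r. ((C * Y) $$ (i,l) + t * (C * V) $$ (i,l)) * (Y $$ (i,l) + t * V $$ (i,l)))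
                 * (Y $$ (i,k) + t * V $$ (i,k))
               - ((C * Y) $$ (i,k) + t * (C * V) $$ (i,k)))" for t
    proof -
      have "riemannian_grad (objective C) (Y + t \<cdot>\<^sub>m V) $$ (i,k)
          = - 2 * (S_mat C (Y + t \<cdot>\<^sub>m V) * (Y + t \<cdot>\<^sub>m V)) $$ (i,k)"
        unfolding riemannian_grad_objective[OF C sym M] using C M[of t] ik Y Vc
        by (subst index_smult_mat) (auto simp: S_mat_def)
      also have "\<dots> = - 2 * ((\<Sum>l<r. (C * (Y + t \<cdot>\<^sub>m V)) $$ (i,l) * (Y + t \<cdot>\<^sub>m V) $$ (i,l))
                 * (Y + t \<cdot>\<^sub>m V) $$ (i,k) - (C * (Y + t \<cdot>\<^sub>m V)) $$ (i,k))"
        unfolding S_mat_mult_index[OF C M M ik] d[OF M] ..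
      also have "(\<Sum>l<r. (C * (Y + t \<cdot>\<^sub>m V)) $$ (i,l) * (Y + t \<cdot>\<^sub>m V) $$ (i,l)) =
          (\<Sum>l<r. ((C * Y) $$ (i,l) + t * (C * V) $$ (i,l)) * (Y $$ (i,l) + t * V $$ (i,l)))"
        by (intro sum.cong refl arg_cong2[of _ _ _ _ "(*)"] index_mult_line[OF C Y Vc ik(1)] Mi) auto
      finally show ?thesis unfolding index_mult_line[OF C Y Vc ik] Mi[OF ik(2)] .
    qed
    have "((\<lambda>t. riemannian_grad (objective C) (Y + t \<cdot>\<^sub>m V) $$ (i,k)) has_field_derivative
        - 2 * (e i * Y $$ (i,k) + (\<Sum>l<r. (C * Y) $$ (i,l) * Y $$ (i,l)) * V $$ (i,k)
               - (C * V) $$ (i,k))) (at 0)"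
      unfolding g e_def
      by (rule derivative_eq_intros refl DERIV_sum)+ (simp add: algebra_simps)
    then show ?thesis
      using ik by (simp add: W_def DERIV_imp_deriv S_mat_mult_index[OF C Y Vc ik] d[OF Y]
          algebra_simps del: index_mult_mat(1))
  qed
  have SV: "S_mat C Y * V \<in> carrier_mat n r" using C Y Vc by (auto simp: S_mat_def ddiag_def)
  have "mat_inner V (riemannian_hess (objective C) Y V) = mat_inner V W"
    using mat_inner_tangent_proj[OF Y V W] Y by (simp add: riemannian_hess_def W_def)
  also have "\<dots> = (\<Sum>k<r. \<Sum>i<n. - 2 * (V $$ (i,k) * (S_mat C Y * V) $$ (i,k))
      - 2 * (V $$ (i,k) * (e i * Y $$ (i,k))))"
    using Vc W by (auto simp: mat_inner_sum[of _ n r] Wi algebra_simps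
        simp del: index_mult_mat(1) intro!: sum.cong)
  also have "\<dots> = - 2 * mat_inner V (S_mat C Y * V)
      - 2 * (\<Sum>k<r. \<Sum>i<n. V $$ (i,k) * (e i * Y $$ (i,k)))"
    using Vc SV by (simp add: mat_inner_sum[of _ n r] sum_subtractf sum_distrib_left sum_negf
        del: index_mult_mat(1))
  also have "(\<Sum>k<r. \<Sum>i<n. V $$ (i,k) * (e i * Y $$ (i,k))) = 0"
    by (subst sum.swap) (simp add: tangent_space_row[OF Y V])
  also have "mat_inner V (S_mat C Y * V) = mat_inner (S_mat C Y) (V * V\<^sup>T)"
  proof -
    have "S_mat C Y \<in> carrier_mat n n" using C Y by (auto simp: S_mat_def ddiag_def)
    from mat_inner_gram[OF this Vc Vc] show ?thesis
      using mat_inner_commute[OF Vc SV] by simp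
  qed
  finally show ?thesis by simp
qed

theorem second_order_critical_objective_iff:
  assumes C: "C \<in> carrier_mat n n" and sym: "C\<^sup>T = C"
  shows "second_order_critical n r (objective C) Y \<longleftrightarrow>
    Y \<in> sphere_product n r \<and> S_mat C Y * Y = 0\<^sub>m n r \<and>
    (\<forall>V \<in> tangent_space Y. mat_inner (S_mat C Y) (V * V\<^sup>T) \<ge> 0)"
proof (cases "Y \<in> sphere_product n r")
  case True
  then have Y: "Y \<in> carrier_mat n r" by (simp add: sphere_product_def)
  have SY: "S_mat C Y * Y \<in> carrier_mat n r" using C Y by (auto simp: S_mat_def ddiag_def)
  have "(- 2) \<cdot>\<^sub>m M = 0\<^sub>m n r \<longleftrightarrow> M = 0\<^sub>m n r" if "M \<in> carrier_mat n r" for M :: "real mat"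
    using that by (auto simp: mat_eq_iff)
  from this[OF SY] show ?thesis
    using True riemannian_hess_objective[OF C sym Y]
    by (auto simp: second_order_critical_def riemannian_grad_objective[OF C sym Y])
qed (simp add: second_order_critical_def)

end

theory Submission
  imports Defs
begin

text \<open>
  Conjugating by the signs \<open>z\<close> and rescaling, the cost becomes \<open>C = 1 1\<^sup>T / n + D\<close> with unit
  vectors \<open>y\<^sub>i\<close> (the rows of \<open>Y\<close>) satisfying \<open>\<lambda>\<^sub>i y\<^sub>i = \<Sum>\<^sub>j C\<^sub>i\<^sub>j y\<^sub>j\<close>. Two facts hold with high probability: the
  operator norm \<open>\<delta>\<close> of \<open>D\<close> tends to 0, and all row sums of \<open>C\<close> are at least \<open>\<epsilon>\<close>.

  Averaging the second-order condition over the projections of the coordinate vectors to the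
  tangent spaces gives \<open>|ybar|\<^sup>2 \<ge> 1/2 - 2 \<delta>\<close> for the mean \<open>ybar\<close> of the \<open>y\<^sub>i\<close>, and at a single vertex it
  gives \<open>\<lambda>\<^sub>i \<ge> - \<delta>\<close>. Hence \<open>\<lambda>\<^sub>i y\<^sub>i = ybar + noise\<close> forces most \<open>y\<^sub>i\<close> to be close to \<open>u = ybar / |ybar|\<close>. Now
  \<open>\<lambda>\<^sub>i y\<^sub>i\<close> differs from (row sum \<open>i\<close> of \<open>C\<close>) times \<open>u\<close> by an error linear in \<open>W = (y\<^sub>i - u)\<^sub>i\<close>, so
  the lower bound on the row sums yields \<open>\<epsilon>\<^sup>2 |W|\<^sup>2 \<le> const \<delta>\<^sup>2 |W|\<^sup>2\<close>, that is \<open>W = 0\<close>.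

  The norm bound must beat \<open>sqrt (n p log n)\<close>. It comes from symmetrisation and the trace method:
  even closed walks are counted by giving each of them a lower bound for its probability under an
  explicit walk process, which reinforces visited vertices and closes open edges uniformly.

  The row sums are controlled by a Chernoff bound: since \<open>2 t \<le> exp t - exp (- t)\<close>, asking for a
  margin \<open>\<theta> n (p - q)\<close> replaces \<open>p, q\<close> by \<open>(1 - \<theta>) p + \<theta> q\<close> and \<open>(1 - \<theta>) q + \<theta> p\<close>
  in the exponent. With \<open>\<theta> = \<epsilon> / 2 < \<epsilon>\<close> the threshold leaves room for a union bound.
\<close>

section \<open>Landscape of a noisy rank-one cost\<close>

text \<open>For unit vectors \<open>y\<close> and \<open>u\<close> with inner product
  \<open>s\<close>, the two sides are \<open>a^2 |y - u|^2\<close> and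
  \<open>16 |lam y - a u|^2\<close>. If \<open>s\<close> is nonnegative, \<open>a u\<close> has
  distance \<open>a sqrt (1 - s^2)\<close> from the line through \<open>y\<close>. If
  \<open>s\<close> is negative, the distance is at least \<open>a\<close> for nonnegative
  \<open>lam\<close> and at least \<open>a + lam\<close>, hence \<open>a / 2\<close>, otherwise.
  Since \<open>|y - u|^2 \<le> 4\<close>, the last case costs the factor 16.\<close>

lemma near_alignment:
  fixes a s lam \<delta> :: real
  assumes "\<bar>s\<bar> \<le> 1" "- \<delta> \<le> lam" "2 * \<delta> < a" "0 < a"
  shows "a\<^sup>2 * (2 - 2 * s) \<le> 16 * (lam\<^sup>2 + a\<^sup>2 - 2 * lam * a * s)"
proof -
  have s: "-1 \<le> s" "s \<le> 1" using assms(1) by auto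
  have a2: "0 \<le> a\<^sup>2" by simp
  consider "0 \<le> s" | "s < 0" "0 \<le> lam" | "s < 0" "lam < 0" by linarith
  then show ?thesis
  proof cases
    case 1
    have "s * s \<le> s" using s 1 by (simp add: mult_left_le_one_le)
    then have "a\<^sup>2 * (1 - s) \<le> a\<^sup>2 * (1 - s * s)" using a2 by (intro mult_left_mono) auto
    moreover have "lam\<^sup>2 + a\<^sup>2 - 2 * lam * a * s = (lam - a * s)\<^sup>2 + a\<^sup>2 * (1 - s * s)"
      by (simp add: power2_eq_square algebra_simps)
    moreover have "0 \<le> (lam - a * s)\<^sup>2" by simp
    moreover have "0 \<le> a\<^sup>2 * (1 - s)" using s by simp
    moreover have "a\<^sup>2 * (2 - 2 * s) = 2 * (a\<^sup>2 * (1 - s))" by (simp add: algebra_simps)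
    moreover have "P \<le> 16 * Q" if "X \<le> Y" "Q = Z + Y" "0 \<le> Z" "0 \<le> X" "P = 2 * X" for P Q X Y Z :: real
      using that by linarith
    ultimately show ?thesis by blast
  next
    case 2
    have "0 \<le> lam * a * (- s)" using 2 assms by (intro mult_nonneg_nonneg) auto
    moreover have "0 \<le> lam\<^sup>2" by simp
    ultimately have "a\<^sup>2 \<le> lam\<^sup>2 + a\<^sup>2 - 2 * lam * a * s" by linarith
    moreover have "a\<^sup>2 * (2 - 2 * s) \<le> a\<^sup>2 * 4" using s by (intro mult_left_mono) auto
    moreover have "P \<le> 16 * Q" if "X \<le> Q" "P \<le> X * 4" "0 \<le> X" for P Q X :: real
      using that by linarith
    ultimately show ?thesis using a2 by blast
  next
    case 3
    have "0 \<le> (- lam) * a * (1 + s)" using 3 assms s by (intro mult_nonneg_nonneg) auto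
    then have "(a + lam)\<^sup>2 \<le> lam\<^sup>2 + a\<^sup>2 - 2 * lam * a * s" by (simp add: power2_eq_square algebra_simps)
    moreover have "(a / 2)\<^sup>2 \<le> (a + lam)\<^sup>2" using assms by (intro power_mono) auto
    moreover have "(a / 2)\<^sup>2 = a\<^sup>2 / 4" by (simp add: power_divide)
    moreover have "P \<le> 16 * Q" if "Z \<le> Q" "Y \<le> Z" "Y = X / 4" "P \<le> X * 4" for P Q X Y Z :: real
      using that by linarith
    moreover have "a\<^sup>2 * (2 - 2 * s) \<le> a\<^sup>2 * 4" using s by (intro mult_left_mono) auto
    ultimately show ?thesis by blast
  qed
qed

lemma abs_quadratic_form_le:
  fixes D :: "nat \<Rightarrow> nat \<Rightarrow> real"
  assumes op: "\<And>x. (\<Sum>i<n. (\<Sum>j<n. D i j * x j)\<^sup>2) \<le> \<delta>\<^sup>2 * (\<Sum>i<n. (x i)\<^sup>2)" and \<delta>: "0 \<le> \<delta>"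
  shows "\<bar>\<Sum>i<n. \<Sum>j<n. D i j * (x i * x j)\<bar> \<le> \<delta> * (\<Sum>i<n. (x i)\<^sup>2)"
proof -
  have "(\<Sum>i<n. \<Sum>j<n. D i j * (x i * x j)) = (\<Sum>i<n. x i * (\<Sum>j<n. D i j * x j))"
    by (simp add: sum_distrib_left mult_ac)
  moreover have "(\<Sum>i<n. x i * (\<Sum>j<n. D i j * x j))\<^sup>2 \<le> (\<Sum>i<n. (x i)\<^sup>2) * (\<Sum>i<n. (\<Sum>j<n. D i j * x j)\<^sup>2)"
    by (rule Cauchy_Schwarz_ineq_sum)
  moreover have "\<dots> \<le> (\<Sum>i<n. (x i)\<^sup>2) * (\<delta>\<^sup>2 * (\<Sum>i<n. (x i)\<^sup>2))"
    by (intro mult_left_mono op sum_nonneg) auto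
  moreover have "\<dots> = (\<delta> * (\<Sum>i<n. (x i)\<^sup>2))\<^sup>2" by (simp add: power2_eq_square mult_ac)
  ultimately have "(\<Sum>i<n. \<Sum>j<n. D i j * (x i * x j))\<^sup>2 \<le> (\<delta> * (\<Sum>i<n. (x i)\<^sup>2))\<^sup>2" by simp
  then have "\<bar>\<Sum>i<n. \<Sum>j<n. D i j * (x i * x j)\<bar> \<le> \<bar>\<delta> * (\<Sum>i<n. (x i)\<^sup>2)\<bar>"
    by (simp only: abs_le_square_iff)
  moreover have "0 \<le> \<delta> * (\<Sum>i<n. (x i)\<^sup>2)" using \<delta> by (intro mult_nonneg_nonneg sum_nonneg) auto
  ultimately show ?thesis by (simp only: abs_of_nonneg)
qed

text \<open>The normal form after conjugation by the signs: the planted vector is all ones and the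
  \<open>y i\<close> are the sign-flipped rows. The assumption \<open>op\<close> bounds the operator
  norm of \<open>D\<close> by \<open>\<delta>\<close>. In \<open>small\<close>, the bound
  \<open>1 / 8\<close> keeps the squared length of the mean row at least 1/4, and
  \<open>24^2 = 576\<close> exceeds the factor 544 that arises in \<open>gram_eq_1\<close>.\<close>

locale noisy_rank_one =
  fixes n r :: nat and D C y :: "nat \<Rightarrow> nat \<Rightarrow> real" and lam :: "nat \<Rightarrow> real" and \<delta> \<eta> :: real
  assumes n: "0 < n" and r: "2 \<le> r"
    and C: "\<And>i j. i < n \<Longrightarrow> j < n \<Longrightarrow> C i j = 1 / n + D i j"
    and unit: "\<And>i. i < n \<Longrightarrow> (\<Sum>k<r. (y i k)\<^sup>2) = 1"
    and op: "\<And>x. (\<Sum>i<n. (\<Sum>j<n. D i j * x j)\<^sup>2) \<le> \<delta>\<^sup>2 * (\<Sum>i<n. (x i)\<^sup>2)" and \<delta>: "0 \<le> \<delta>"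
    and first_order: "\<And>i k. i < n \<Longrightarrow> k < r \<Longrightarrow> (\<Sum>j<n. C i j * y j k) = lam i * y i k"
    and second_order: "\<And>v. (\<And>i. i < n \<Longrightarrow> (\<Sum>k<r. y i k * v i k) = 0) \<Longrightarrow>
        (\<Sum>i<n. \<Sum>j<n. C i j * (\<Sum>k<r. v i k * v j k)) \<le> (\<Sum>i<n. lam i * (\<Sum>k<r. (v i k)\<^sup>2))"
    and margin: "\<And>i. i < n \<Longrightarrow> \<eta> \<le> (\<Sum>j<n. C i j)"
    and small: "\<delta> \<le> 1 / 8" "24 * \<delta> < \<eta>"
begin

section \<open>Averaging the second-order condition over a tangent frame\<close>

definition gram where "gram i j = (\<Sum>k<r. y i k * y j k)"

lemma gram_self: "i < n \<Longrightarrow> gram i i = 1"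
  using unit[of i] by (simp add: gram_def power2_eq_square)

text \<open>The projection of the \<open>l\<close>-th coordinate vector to the tangent space at \<open>y\<close>.\<close>

definition frame where "frame l i k = (if k = l then 1 else 0) - y i l * y i k"

lemma frame_tangent: 
  assumes "i < n" "l < r" shows "(\<Sum>k<r. y i k * frame l i k) = 0"
proof -
  have "(\<Sum>k<r. y i k * frame l i k) = (\<Sum>k<r. (if k = l then y i k else 0)) - y i l * (\<Sum>k<r. (y i k)\<^sup>2)"
    by (simp add: frame_def right_diff_distrib sum_subtractf sum_distrib_left power2_eq_square
        mult_ac if_distrib[of "\<lambda>x. _ * x"] cong: if_cong)
  then show ?thesis using assms unit[of i] by simp
qed

text \<open>The vectors \<open>frame l i\<close> are the columns of the projection
  \<open>I - y_i y_i^T\<close>, so the left side is the trace of a product of two such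
  projections.\<close>

lemma sum_frame:
  assumes "i < n" "j < n"
  shows "(\<Sum>l<r. \<Sum>k<r. frame l i k * frame l j k) = real r - 2 + (gram i j)\<^sup>2"
proof -
  have e: "(\<Sum>k<r. frame l i k * frame l j k) =
     1 - (y i l)\<^sup>2 - (y j l)\<^sup>2 + y i l * y j l * gram i j" if "l < r" for l
  proof -
    have "(\<Sum>k<r. frame l i k * frame l j k) =
      (\<Sum>k<r. (if k = l then 1 else 0) - (if k = l then y j l * y j k else 0)
         - (if k = l then y i l * y i k else 0) + y i l * y j l * (y i k * y j k))"
      by (intro sum.cong refl) (simp add: frame_def algebra_simps)
    also have "\<dots> = 1 - (y i l)\<^sup>2 - (y j l)\<^sup>2 + y i l * y j l * gram i j"
      using that by (simp add: sum.distrib sum_subtractf gram_def sum_distrib_left power2_eq_square)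
    finally show ?thesis .
  qed
  have "(\<Sum>l<r. \<Sum>k<r. frame l i k * frame l j k) = (\<Sum>l<r. 1 - (y i l)\<^sup>2 - (y j l)\<^sup>2 + y i l * y j l * gram i j)"
    by (intro sum.cong refl e) simp
  also have "\<dots> = r - (\<Sum>l<r. (y i l)\<^sup>2) - (\<Sum>l<r. (y j l)\<^sup>2) + (\<Sum>l<r. y i l * y j l) * gram i j"
    by (simp add: sum.distrib sum_subtractf sum_distrib_right)
  also have "\<dots> = real r - 2 + (gram i j)\<^sup>2"
    using unit assms by (simp add: gram_def power2_eq_square)
  finally show ?thesis .
qed

text \<open>Each \<open>frame l\<close> is an admissible variation; summing over \<open>l\<close>
  leaves an inequality in Gram entries only. The factor \<open>r - 1\<close> is the dimension of the
  tangent space at a single row.\<close>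

lemma averaged_second_order:
  "(\<Sum>i<n. \<Sum>j<n. C i j * (real r - 2 + (gram i j)\<^sup>2)) \<le> (real r - 1) * (\<Sum>i<n. lam i)"
proof -
  have "(\<Sum>i<n. \<Sum>j<n. C i j * (real r - 2 + (gram i j)\<^sup>2)) =
     (\<Sum>i<n. \<Sum>j<n. \<Sum>l<r. C i j * (\<Sum>k<r. frame l i k * frame l j k))"
    by (intro sum.cong refl) (simp add: sum_frame flip: sum_distrib_left)
  also have "\<dots> = (\<Sum>i<n. \<Sum>l<r. \<Sum>j<n. C i j * (\<Sum>k<r. frame l i k * frame l j k))"
    by (intro sum.cong refl sum.swap)
  also have "\<dots> = (\<Sum>l<r. \<Sum>i<n. \<Sum>j<n. C i j * (\<Sum>k<r. frame l i k * frame l j k))"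
    by (rule sum.swap)
  also have "\<dots> \<le> (\<Sum>l<r. \<Sum>i<n. lam i * (\<Sum>k<r. (frame l i k)\<^sup>2))"
    by (intro sum_mono second_order) (simp add: frame_tangent)
  also have "\<dots> = (\<Sum>i<n. \<Sum>l<r. lam i * (\<Sum>k<r. (frame l i k)\<^sup>2))"
    by (rule sum.swap)
  also have "\<dots> = (\<Sum>i<n. lam i * (real r - 1))"
  proof (intro sum.cong refl)
    fix i assume "i \<in> {..<n}"
    then show "(\<Sum>l<r. lam i * (\<Sum>k<r. (frame l i k)\<^sup>2)) = lam i * (real r - 1)"
      using sum_frame[of i i] gram_self[of i] r
      by (simp add: power2_eq_square of_nat_diff flip: sum_distrib_left)
  qed
  finally show ?thesis unfolding sum_distrib_right[symmetric] by (simp only: mult.commute)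
qed

text \<open>Variations supported on the single row \<open>i\<close> see no off-diagonal entry of
  \<open>C\<close>.\<close>

lemma multiplier_ge_diagonal:
  assumes i: "i < n"
  shows "C i i \<le> lam i"
proof -
  have "C i i * (real r - 1) = (\<Sum>l<r. C i i * (\<Sum>k<r. frame l i k * frame l i k))"
    using sum_frame[OF i i] gram_self[OF i] r by (simp add: of_nat_diff flip: sum_distrib_left)
  also have "\<dots> \<le> (\<Sum>l<r. lam i * (\<Sum>k<r. (frame l i k)\<^sup>2))"
  proof (rule sum_mono)
    fix l assume l: "l \<in> {..<r}"
    define v where "v j k = (if j = i then frame l i k else 0)" for j k
    have "(\<Sum>k<r. y j k * v j k) = 0" if "j < n" for j
      using frame_tangent[of i l] l i by (cases "j = i") (auto simp: v_def)
    from second_order[OF this] 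
    have "(\<Sum>a<n. \<Sum>b<n. C a b * (\<Sum>k<r. v a k * v b k)) \<le> (\<Sum>a<n. lam a * (\<Sum>k<r. (v a k)\<^sup>2))" .
    moreover have "(\<Sum>a<n. \<Sum>b<n. C a b * (\<Sum>k<r. v a k * v b k)) =
       (\<Sum>a<n. if a = i then (\<Sum>b<n. if b = i then C i i * (\<Sum>k<r. frame l i k * frame l i k) else 0) else 0)"
    proof -
      have "C a b * (\<Sum>k<r. v a k * v b k) =
          (if a = i \<and> b = i then C i i * (\<Sum>k<r. frame l i k * frame l i k) else 0)" for a b
        by (auto simp: v_def)
      then show ?thesis by (intro sum.cong refl) auto
    qed
    moreover have "(\<Sum>a<n. lam a * (\<Sum>k<r. (v a k)\<^sup>2)) =
       (\<Sum>a<n. if a = i then lam i * (\<Sum>k<r. (frame l i k)\<^sup>2) else 0)"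
      by (intro sum.cong refl) (auto simp: v_def)
    ultimately show "C i i * (\<Sum>k<r. frame l i k * frame l i k) \<le> lam i * (\<Sum>k<r. (frame l i k)\<^sup>2)"
      using i by simp
  qed
  also have "\<dots> = lam i * (real r - 1)"
    using sum_frame[OF i i] gram_self[OF i] r by (simp add: power2_eq_square of_nat_diff flip: sum_distrib_left)
  finally show ?thesis using r by (simp add: of_nat_diff)
qed

text \<open>The operator norm bound at the \<open>i\<close>-th coordinate vector controls
  \<open>D i i\<close>, and the signal adds a nonnegative \<open>1 / n\<close> to it.\<close>

lemma multiplier_ge:
  assumes i: "i < n"
  shows "- \<delta> \<le> lam i"
proof -
  have "\<bar>\<Sum>a<n. \<Sum>b<n. D a b * ((if a = i then 1 else 0) * (if b = i then 1 else 0))\<bar>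
      \<le> \<delta> * (\<Sum>a<n. (if a = i then 1 else 0)\<^sup>2)"
    by (rule abs_quadratic_form_le[OF op \<delta>])
  moreover have "(\<Sum>a<n. \<Sum>b<n. D a b * ((if a = i then 1 else 0) * (if b = i then 1 else 0))) =
      (\<Sum>a<n. if a = i then (\<Sum>b<n. if b = i then D i i else 0) else 0)"
    by (intro sum.cong refl) (auto simp: if_distrib[of "\<lambda>x. _ * x"] cong: if_cong)
  moreover have "(\<Sum>a<n. (if a = i then 1 else 0)\<^sup>2) = (\<Sum>a<n. if a = i then 1 else (0::real))"
    by (intro sum.cong) auto
  ultimately have "\<bar>D i i\<bar> \<le> \<delta>" using i by simp
  moreover have "D i i \<le> C i i" using C[OF i i] by simp
  ultimately show ?thesis using multiplier_ge_diagonal[OF i] by linarith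
qed

section \<open>The mean row and a lower bound for its length\<close>

definition ybar where "ybar k = (\<Sum>j<n. y j k) / n"

definition \<rho> where "\<rho> = sqrt (\<Sum>k<r. (ybar k)\<^sup>2)"

lemma rho_nonneg: "0 \<le> \<rho>" and rho_sq: "\<rho>\<^sup>2 = (\<Sum>k<r. (ybar k)\<^sup>2)"
  by (auto simp: \<rho>_def sum_nonneg)

lemma sum_gram: "(\<Sum>i<n. \<Sum>j<n. gram i j) = n\<^sup>2 * \<rho>\<^sup>2"
proof -
  have "(\<Sum>i<n. \<Sum>j<n. gram i j) = (\<Sum>k<r. \<Sum>i<n. \<Sum>j<n. y i k * y j k)"
  proof -
    have "(\<Sum>i<n. \<Sum>j<n. gram i j) = (\<Sum>i<n. \<Sum>k<r. \<Sum>j<n. y i k * y j k)"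
      unfolding gram_def by (intro sum.cong refl sum.swap)
    also have "\<dots> = (\<Sum>k<r. \<Sum>i<n. \<Sum>j<n. y i k * y j k)" by (rule sum.swap)
    finally show ?thesis .
  qed
  also have "\<dots> = (\<Sum>k<r. (n * ybar k)\<^sup>2)"
    using n by (intro sum.cong refl) (simp add: ybar_def power2_eq_square sum_product)
  finally show ?thesis by (simp add: rho_sq sum_distrib_left power_mult_distrib)
qed

text \<open>Pair the first-order condition with the unit vector \<open>y i\<close>.\<close>

lemma sum_multipliers: "(\<Sum>i<n. lam i) = (\<Sum>i<n. \<Sum>j<n. C i j * gram i j)"
proof (intro sum.cong refl)
  fix i assume "i \<in> {..<n}"
  then have i: "i < n" by simp
  have "lam i = lam i * (\<Sum>k<r. (y i k)\<^sup>2)" using unit[OF i] by simp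
  also have "\<dots> = (\<Sum>k<r. y i k * (\<Sum>j<n. C i j * y j k))"
    using i by (simp add: first_order sum_distrib_left power2_eq_square mult_ac)
  also have "\<dots> = (\<Sum>k<r. \<Sum>j<n. C i j * (y i k * y j k))"
    by (simp add: sum_distrib_left mult_ac)
  also have "\<dots> = (\<Sum>j<n. \<Sum>k<r. C i j * (y i k * y j k))" by (rule sum.swap)
  finally show "lam i = (\<Sum>j<n. C i j * gram i j)" by (simp add: gram_def sum_distrib_left)
qed

lemma noise_gram: "\<bar>\<Sum>i<n. \<Sum>j<n. D i j * gram i j\<bar> \<le> \<delta> * n"
proof -
  have "(\<Sum>i<n. \<Sum>j<n. D i j * gram i j) = (\<Sum>i<n. \<Sum>k<r. \<Sum>j<n. D i j * (y i k * y j k))"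
    unfolding gram_def sum_distrib_left by (intro sum.cong refl sum.swap)
  also have "\<dots> = (\<Sum>k<r. \<Sum>i<n. \<Sum>j<n. D i j * (y i k * y j k))" by (rule sum.swap)
  finally have "\<bar>\<Sum>i<n. \<Sum>j<n. D i j * gram i j\<bar> \<le> (\<Sum>k<r. \<bar>\<Sum>i<n. \<Sum>j<n. D i j * (y i k * y j k)\<bar>)"
    by simp
  also have "\<dots> \<le> (\<Sum>k<r. \<delta> * (\<Sum>i<n. (y i k)\<^sup>2))"
    by (intro sum_mono abs_quadratic_form_le[OF op \<delta>])
  also have "\<dots> = \<delta> * (\<Sum>k<r. \<Sum>i<n. (y i k)\<^sup>2)" by (simp add: sum_distrib_left)
  also have "(\<Sum>k<r. \<Sum>i<n. (y i k)\<^sup>2) = (\<Sum>i<n. \<Sum>k<r. (y i k)\<^sup>2)" by (rule sum.swap)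
  finally show ?thesis using unit by simp
qed

lemma gram_sq: "(gram i j)\<^sup>2 = (\<Sum>k<r. \<Sum>l<r. (y i k * y i l) * (y j k * y j l))"
  by (simp add: gram_def power2_eq_square sum_product mult_ac)

text \<open>The entrywise square of a Gram matrix is the Gram matrix of the tensor squares of the
  \<open>y i\<close>, which are again unit vectors. The pairs \<open>p\<close> index the coordinates
  of these tensors, and the operator norm bound applies to each coordinate.\<close>

lemma noise_gram_sq: "\<bar>\<Sum>i<n. \<Sum>j<n. D i j * (gram i j)\<^sup>2\<bar> \<le> \<delta> * n"
proof -
  let ?P = "{..<r} \<times> {..<r}"
  let ?x = "\<lambda>p i. y i (fst p) * y i (snd p)"
  have g: "(gram i j)\<^sup>2 = (\<Sum>p\<in>?P. ?x p i * ?x p j)" for i j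
    unfolding gram_sq by (simp add: sum.cartesian_product case_prod_unfold)
  have "(\<Sum>i<n. \<Sum>j<n. D i j * (gram i j)\<^sup>2) = (\<Sum>i<n. \<Sum>p\<in>?P. \<Sum>j<n. D i j * (?x p i * ?x p j))"
    unfolding g sum_distrib_left by (intro sum.cong refl sum.swap)
  also have "\<dots> = (\<Sum>p\<in>?P. \<Sum>i<n. \<Sum>j<n. D i j * (?x p i * ?x p j))" by (rule sum.swap)
  finally have "\<bar>\<Sum>i<n. \<Sum>j<n. D i j * (gram i j)\<^sup>2\<bar> \<le> (\<Sum>p\<in>?P. \<bar>\<Sum>i<n. \<Sum>j<n. D i j * (?x p i * ?x p j)\<bar>)"
    by simp
  also have "\<dots> \<le> (\<Sum>p\<in>?P. \<delta> * (\<Sum>i<n. (?x p i)\<^sup>2))"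
    by (intro sum_mono abs_quadratic_form_le[OF op \<delta>])
  also have "\<dots> = \<delta> * (\<Sum>p\<in>?P. \<Sum>i<n. (?x p i)\<^sup>2)" by (simp add: sum_distrib_left)
  also have "(\<Sum>p\<in>?P. \<Sum>i<n. (?x p i)\<^sup>2) = (\<Sum>i<n. \<Sum>p\<in>?P. ?x p i * ?x p i)"
    unfolding power2_eq_square by (rule sum.swap)
  also have "\<dots> = (\<Sum>i<n. (gram i i)\<^sup>2)" unfolding g ..
  finally show ?thesis by (simp add: gram_self)
qed

text \<open>The right side is the squared Frobenius norm of the \<open>r\<close> by \<open>r\<close>
  matrix given by the sum of the \<open>y_i y_i^T\<close>, whose trace is \<open>n\<close>. Only its
  diagonal \<open>q\<close> is kept, and Cauchy-Schwarz compares it with the trace.\<close>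

lemma sum_gram_sq_ge: "n\<^sup>2 / r \<le> (\<Sum>i<n. \<Sum>j<n. (gram i j)\<^sup>2)"
proof -
  define q where "q k = (\<Sum>i<n. (y i k)\<^sup>2)" for k
  have q: "(\<Sum>k<r. q k) = n"
    unfolding q_def by (subst sum.swap) (simp add: unit)
  have "real n ^ 2 = (\<Sum>k<r. 1 * q k)\<^sup>2" by (simp add: q)
  also have "\<dots> \<le> (\<Sum>k<r. 1\<^sup>2) * (\<Sum>k<r. (q k)\<^sup>2)" by (rule Cauchy_Schwarz_ineq_sum)
  finally have 1: "n\<^sup>2 / r \<le> (\<Sum>k<r. (q k)\<^sup>2)" using r by (simp add: field_simps)
  have "(\<Sum>k<r. (q k)\<^sup>2) \<le> (\<Sum>k<r. \<Sum>l<r. (\<Sum>i<n. y i k * y i l)\<^sup>2)"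
  proof (intro sum_mono)
    fix k assume "k \<in> {..<r}"
    then have "(\<Sum>i<n. y i k * y i k)\<^sup>2 \<le> (\<Sum>l<r. (\<Sum>i<n. y i k * y i l)\<^sup>2)"
      by (intro member_le_sum[where f = "\<lambda>l. (\<Sum>i<n. y i k * y i l)\<^sup>2"]) auto
    then show "(q k)\<^sup>2 \<le> (\<Sum>l<r. (\<Sum>i<n. y i k * y i l)\<^sup>2)" by (simp add: q_def power2_eq_square)
  qed
  also have "\<dots> = (\<Sum>p\<in>{..<r}\<times>{..<r}. \<Sum>a\<in>{..<n}\<times>{..<n}.
      (y (fst a) (fst p) * y (fst a) (snd p)) * (y (snd a) (fst p) * y (snd a) (snd p)))"
  proof -
    have "(\<Sum>i<n. y i k * y i l)\<^sup>2 = (\<Sum>a\<in>{..<n}\<times>{..<n}.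
        (y (fst a) k * y (fst a) l) * (y (snd a) k * y (snd a) l))" for k l
      by (simp add: power2_eq_square sum_product sum.cartesian_product case_prod_unfold)
    then show ?thesis by (simp only: sum.cartesian_product[of _ "{..<r}" "{..<r}"] case_prod_unfold)
  qed
  also have "\<dots> = (\<Sum>a\<in>{..<n}\<times>{..<n}. \<Sum>p\<in>{..<r}\<times>{..<r}.
      (y (fst a) (fst p) * y (fst a) (snd p)) * (y (snd a) (fst p) * y (snd a) (snd p)))"
    by (rule sum.swap)
  also have "\<dots> = (\<Sum>i<n. \<Sum>j<n. (gram i j)\<^sup>2)"
    by (simp only: gram_sq sum.cartesian_product[of _ "{..<r}" "{..<r}"]
        sum.cartesian_product[of _ "{..<n}" "{..<n}"] case_prod_unfold)
  finally show ?thesis using 1 by simp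
qed

text \<open>Splitting \<open>C\<close> into signal and noise in the averaged condition leaves
  \<open>n (r - 2) + S / n\<close> on the left and \<open>(r - 1) n \<rho>^2\<close> on the right.
  The three noise sums cost at most \<open>2 (r - 1) \<delta> n\<close> together.\<close>

lemma rho_sq_ge: "1 / 2 - 2 * \<delta> \<le> \<rho>\<^sup>2"
proof -
  define G1 where "G1 = (\<Sum>i<n. \<Sum>j<n. D i j * gram i j)"
  define G2 where "G2 = (\<Sum>i<n. \<Sum>j<n. D i j * (gram i j)\<^sup>2)"
  define G0 where "G0 = (\<Sum>i<n. \<Sum>j<n. D i j)"
  define S where "S = (\<Sum>i<n. \<Sum>j<n. (gram i j)\<^sup>2)"
  have r2: "real (r - 1) = real r - 1" using r by simp
  have lam: "(\<Sum>i<n. lam i) = n * \<rho>\<^sup>2 + G1"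
  proof -
    have "(\<Sum>i<n. lam i) = (\<Sum>i<n. \<Sum>j<n. (1 / n) * gram i j + D i j * gram i j)"
      unfolding sum_multipliers by (intro sum.cong refl) (simp add: C distrib_right)
    also have "\<dots> = (1 / n) * (\<Sum>i<n. \<Sum>j<n. gram i j) + G1"
      by (simp only: sum.distrib G1_def sum_distrib_left)
    finally show ?thesis using n by (simp add: sum_gram power2_eq_square)
  qed
  have "(\<Sum>i<n. \<Sum>j<n. C i j * (real r - 2 + (gram i j)\<^sup>2)) =
    (\<Sum>i<n. \<Sum>j<n. (real r - 2) / n + (1 / n) * (gram i j)\<^sup>2 + (real r - 2) * D i j + D i j * (gram i j)\<^sup>2)"
    by (intro sum.cong refl) (simp add: C field_simps)
  also have "\<dots> = n * (real r - 2) + S / n + (real r - 2) * G0 + G2"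
    using n by (simp add: sum.distrib S_def G0_def G2_def sum_distrib_left sum_divide_distrib)
  finally have *: "n * (real r - 2) + S / n + (real r - 2) * G0 + G2 \<le> (real r - 1) * (n * \<rho>\<^sup>2 + G1)"
    using averaged_second_order unfolding lam r2 by simp
  have G0: "\<bar>G0\<bar> \<le> \<delta> * n" using abs_quadratic_form_le[OF op \<delta>, of "\<lambda>_. 1"] by (simp add: G0_def)
  have G1: "\<bar>G1\<bar> \<le> \<delta> * n" and G2: "\<bar>G2\<bar> \<le> \<delta> * n"
    using noise_gram noise_gram_sq by (auto simp: G1_def G2_def)
  have "n\<^sup>2 / r \<le> S" using sum_gram_sq_ge by (simp add: S_def)
  then have "n\<^sup>2 / r / n \<le> S / n" by (intro divide_right_mono) auto
  then have S: "n / r \<le> S / n" using n by (simp add: power2_eq_square)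
  have "(real r - 1) * G1 \<le> (real r - 1) * (\<delta> * n)" using G1 r by (intro mult_left_mono) auto
  moreover have "(real r - 2) * (- (\<delta> * n)) \<le> (real r - 2) * G0" using G0 r by (intro mult_left_mono) auto
  ultimately have "n * (real r - 2) + n / r - (real r - 2) * (\<delta> * n) - \<delta> * n \<le>
      (real r - 1) * (n * \<rho>\<^sup>2) + (real r - 1) * (\<delta> * n)"
    using * S G2 by (simp add: distrib_left)
  then have "n * ((real r - 2) + 1 / r) \<le> n * ((real r - 1) * (\<rho>\<^sup>2 + 2 * \<delta>))"
    by (simp add: algebra_simps)
  then have "(real r - 2) + 1 / r \<le> (real r - 1) * (\<rho>\<^sup>2 + 2 * \<delta>)" using n by simp
  \<comment> \<open>Equality holds at \<open>r = 2\<close>, so the smallest admissible rank is the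
    extremal one.\<close>
  moreover have "(real r - 1) * (1 / 2) \<le> (real r - 2) + 1 / r"
  proof -
    have "(real r - 2) + 1 / r - (real r - 1) * (1 / 2) = (real r - 1) * (real r - 2) / (2 * r)"
      using r by (simp add: field_simps)
    moreover have "0 \<le> (real r - 1) * (real r - 2) / (2 * r)" using r by simp
    ultimately show ?thesis by linarith
  qed
  ultimately have "(real r - 1) * (1 / 2) \<le> (real r - 1) * (\<rho>\<^sup>2 + 2 * \<delta>)" by linarith
  then show ?thesis using r by simp
qed

lemma rho_ge: "1 / 2 \<le> \<rho>"
proof (rule power2_le_imp_le[OF _ rho_nonneg])
  have "(1 / 2)\<^sup>2 = (1 / 4 :: real)" by (simp add: power2_eq_square)
  then show "(1 / 2)\<^sup>2 \<le> \<rho>\<^sup>2" using rho_sq_ge small by linarith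
qed

section \<open>Concentration of the rows at the mean direction\<close>

definition u where "u k = ybar k / \<rho>"

lemma u_unit: "(\<Sum>k<r. (u k)\<^sup>2) = 1"
  using rho_ge by (simp add: u_def power_divide rho_sq[symmetric] flip: sum_divide_distrib)

definition align where "align i = (\<Sum>k<r. y i k * u k)"

lemma abs_align_le: "i < n \<Longrightarrow> \<bar>align i\<bar> \<le> 1"
  using Cauchy_Schwarz_ineq_sum[of "y i" u "{..<r}"] unit[of i] u_unit
  by (simp add: align_def abs_square_le_1)

lemma sum_align: "(\<Sum>i<n. align i) = n * \<rho>"
proof -
  have "(\<Sum>i<n. align i) = (\<Sum>k<r. (\<Sum>i<n. y i k) * u k)"
    unfolding align_def by (subst sum.swap) (simp add: sum_distrib_right)
  also have "\<dots> = (\<Sum>k<r. n * \<rho> * (u k)\<^sup>2)"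
    using n rho_ge by (intro sum.cong refl) (simp add: u_def ybar_def power2_eq_square)
  also have "\<dots> = n * \<rho> * (\<Sum>k<r. (u k)\<^sup>2)" by (simp only: sum_distrib_left)
  finally show ?thesis by (simp add: u_unit)
qed

lemma sum_two_minus_align: "(\<Sum>i<n. 2 - 2 * align i) = n * (2 * (1 - \<rho>))"
proof -
  have "(\<Sum>i<n. 2 - 2 * align i) = 2 * n - 2 * (\<Sum>i<n. align i)"
    by (simp add: sum_subtractf sum_distrib_left)
  then show ?thesis by (simp add: sum_align algebra_simps)
qed

lemma dist_sq:
  assumes "i < n"
  shows "(\<Sum>k<r. (\<alpha> * y i k - a * u k)\<^sup>2) = \<alpha>\<^sup>2 + a\<^sup>2 - 2 * \<alpha> * a * align i"
proof -
  have "(\<Sum>k<r. (\<alpha> * y i k - a * u k)\<^sup>2) =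
     (\<Sum>k<r. \<alpha>\<^sup>2 * (y i k)\<^sup>2 + a\<^sup>2 * (u k)\<^sup>2 - 2 * \<alpha> * a * (y i k * u k))"
    by (intro sum.cong refl) (simp add: power2_eq_square algebra_simps)
  also have "\<dots> = \<alpha>\<^sup>2 * (\<Sum>k<r. (y i k)\<^sup>2) + a\<^sup>2 * (\<Sum>k<r. (u k)\<^sup>2) - 2 * \<alpha> * a * align i"
    by (simp only: sum.distrib sum_subtractf sum_distrib_left align_def)
  finally show ?thesis using assms by (simp add: unit u_unit)
qed

lemma op_rows: "(\<Sum>i<n. \<Sum>k<r. (\<Sum>j<n. D i j * V j k)\<^sup>2) \<le> \<delta>\<^sup>2 * (\<Sum>i<n. \<Sum>k<r. (V i k)\<^sup>2)"
proof -
  have "(\<Sum>i<n. \<Sum>k<r. (\<Sum>j<n. D i j * V j k)\<^sup>2) = (\<Sum>k<r. \<Sum>i<n. (\<Sum>j<n. D i j * V j k)\<^sup>2)" by (rule sum.swap)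
  also have "\<dots> \<le> (\<Sum>k<r. \<delta>\<^sup>2 * (\<Sum>i<n. (V i k)\<^sup>2))" by (intro sum_mono op)
  also have "\<dots> = \<delta>\<^sup>2 * (\<Sum>k<r. \<Sum>i<n. (V i k)\<^sup>2)" by (simp add: sum_distrib_left)
  also have "(\<Sum>k<r. \<Sum>i<n. (V i k)\<^sup>2) = (\<Sum>i<n. \<Sum>k<r. (V i k)\<^sup>2)" by (rule sum.swap)
  finally show ?thesis .
qed

lemma first_order_split:
  assumes "i < n" "k < r"
  shows "lam i * y i k = \<rho> * u k + (\<Sum>j<n. D i j * y j k)"
proof -
  have "lam i * y i k = (\<Sum>j<n. (1 / n) * y j k + D i j * y j k)"
    using assms by (simp add: C distrib_right flip: first_order)
  also have "\<dots> = ybar k + (\<Sum>j<n. D i j * y j k)"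
    by (simp only: sum.distrib ybar_def flip: sum_distrib_left) simp
  finally show ?thesis using rho_ge by (simp add: u_def)
qed

text \<open>A first, crude estimate. The vector \<open>lam i y_i\<close> differs from
  \<open>\<rho> u\<close> by row \<open>i\<close> of \<open>D y\<close>, and
  \<open>near_alignment\<close> with \<open>a = \<rho>\<close> turns this into a bound on
  \<open>|y_i - u|\<close>. The squared distances sum to \<open>2 n (1 - \<rho>)\<close>; the
  constant 32 comes from \<open>\<rho> \<ge> 1 / 2\<close>.\<close>

lemma one_minus_rho_le: "1 - \<rho> \<le> 32 * \<delta>\<^sup>2"
proof -
  have "\<rho>\<^sup>2 * (2 - 2 * align i) \<le> 16 * (\<Sum>k<r. (\<Sum>j<n. D i j * y j k)\<^sup>2)" if i: "i < n" for i
  proof -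
    have "\<rho>\<^sup>2 * (2 - 2 * align i) \<le> 16 * ((lam i)\<^sup>2 + \<rho>\<^sup>2 - 2 * lam i * \<rho> * align i)"
      using rho_ge small by (intro near_alignment[of _ \<delta>] abs_align_le multiplier_ge i) auto
    also have "(lam i)\<^sup>2 + \<rho>\<^sup>2 - 2 * lam i * \<rho> * align i = (\<Sum>k<r. (\<Sum>j<n. D i j * y j k)\<^sup>2)"
      unfolding dist_sq[OF i, symmetric] using i by (intro sum.cong refl) (simp add: first_order_split)
    finally show ?thesis .
  qed
  then have "(\<Sum>i<n. \<rho>\<^sup>2 * (2 - 2 * align i)) \<le> (\<Sum>i<n. 16 * (\<Sum>k<r. (\<Sum>j<n. D i j * y j k)\<^sup>2))"
    by (intro sum_mono) auto
  also have "\<dots> \<le> 16 * (\<delta>\<^sup>2 * (\<Sum>i<n. \<Sum>k<r. (y i k)\<^sup>2))"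
    unfolding sum_distrib_left[symmetric] by (intro mult_left_mono op_rows) auto
  also have "\<dots> = n * (16 * \<delta>\<^sup>2)" by (simp add: unit)
  also have "(\<Sum>i<n. \<rho>\<^sup>2 * (2 - 2 * align i)) = n * (\<rho>\<^sup>2 * (2 * (1 - \<rho>)))"
    unfolding sum_distrib_left[symmetric] sum_two_minus_align by simp
  finally have *: "\<rho>\<^sup>2 * (2 * (1 - \<rho>)) \<le> 16 * \<delta>\<^sup>2" using n by simp
  have "(1/2)\<^sup>2 \<le> \<rho>\<^sup>2" using rho_ge by (intro power_mono) auto
  show ?thesis
  proof (cases "\<rho> \<le> 1")
    case True
    then have "(1/2)\<^sup>2 * (2 * (1 - \<rho>)) \<le> \<rho>\<^sup>2 * (2 * (1 - \<rho>))"
      using \<open>(1/2)\<^sup>2 \<le> \<rho>\<^sup>2\<close> by (intro mult_right_mono) auto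
    then show ?thesis using * by (simp add: power2_eq_square)
  next
    case False
    have "0 \<le> \<delta>\<^sup>2" by simp
    then show ?thesis using False by linarith
  qed
qed

text \<open>The bootstrap. Comparing \<open>lam i y_i\<close> with the row sum
  \<open>\<Lambda> i\<close> times \<open>u\<close>, instead of with \<open>\<rho> u\<close>, leaves
  the error \<open>(\<rho> - 1) u\<close> plus row \<open>i\<close> of \<open>D W\<close>. Both
  parts vanish with \<open>W\<close>, so the total squared deviation \<open>w2\<close> is bounded by
  a small multiple of itself.\<close>

lemma gram_eq_1:
  assumes "i < n" "j < n"
  shows "gram i j = 1"
proof -
  define W where "W i k = y i k - u k" for i k
  define w2 where "w2 = (\<Sum>i<n. \<Sum>k<r. (W i k)\<^sup>2)"
  define \<Lambda> where "\<Lambda> i = (\<Sum>j<n. C i j)" for i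
  have Wi: "(\<Sum>k<r. (W i k)\<^sup>2) = 2 - 2 * align i" if "i < n" for i
    using dist_sq[OF that, of 1 1] by (simp add: W_def)
  have w2: "w2 = n * (2 * (1 - \<rho>))"
    by (simp add: w2_def Wi sum_two_minus_align)
  have \<eta>: "0 < \<eta>" using small \<delta> by linarith
  have pt: "\<eta>\<^sup>2 * (2 - 2 * align i) \<le> 32 * ((1 - \<rho>)\<^sup>2 + (\<Sum>k<r. (\<Sum>j<n. D i j * W j k)\<^sup>2))" if i: "i < n" for i
  proof -
    have \<Lambda>: "\<eta> \<le> \<Lambda> i" using margin[OF i] by (simp add: \<Lambda>_def)
    have L: "\<Lambda> i = 1 + (\<Sum>j<n. D i j)" using i n by (simp add: \<Lambda>_def C sum.distrib)
    have "\<eta>\<^sup>2 * (2 - 2 * align i) \<le> (\<Lambda> i)\<^sup>2 * (2 - 2 * align i)"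
      using abs_align_le[OF i] \<Lambda> \<eta> by (intro mult_right_mono power_mono) auto
    also have "\<dots> \<le> 16 * ((lam i)\<^sup>2 + (\<Lambda> i)\<^sup>2 - 2 * lam i * \<Lambda> i * align i)"
      using \<Lambda> \<eta> small \<delta> by (intro near_alignment[of _ \<delta>] abs_align_le multiplier_ge i) auto
    also have "(lam i)\<^sup>2 + (\<Lambda> i)\<^sup>2 - 2 * lam i * \<Lambda> i * align i =
        (\<Sum>k<r. ((\<rho> - 1) * u k + (\<Sum>j<n. D i j * W j k))\<^sup>2)"
      unfolding dist_sq[OF i, symmetric]
    proof (intro sum.cong refl arg_cong[where f = "\<lambda>x. x\<^sup>2"])
      fix k assume "k \<in> {..<r}"
      show "lam i * y i k - \<Lambda> i * u k = (\<rho> - 1) * u k + (\<Sum>j<n. D i j * W j k)"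
      proof -
        have "(\<Sum>j<n. D i j * W j k) = (\<Sum>j<n. D i j * y j k) - (\<Sum>j<n. D i j) * u k"
          by (simp add: W_def right_diff_distrib sum_subtractf sum_distrib_right)
        then show ?thesis
          using i \<open>k \<in> {..<r}\<close> by (simp add: first_order_split L algebra_simps)
      qed
    qed
    also have "\<dots> \<le> (\<Sum>k<r. 2 * (((\<rho> - 1) * u k)\<^sup>2 + (\<Sum>j<n. D i j * W j k)\<^sup>2))"
    proof (rule sum_mono)
      fix k
      have "(a + b)\<^sup>2 \<le> 2 * (a\<^sup>2 + b\<^sup>2)" for a b :: real
        using zero_le_power2[of "a - b"] by (simp add: power2_eq_square algebra_simps)
      then show "((\<rho> - 1) * u k + (\<Sum>j<n. D i j * W j k))\<^sup>2 \<le>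
         2 * (((\<rho> - 1) * u k)\<^sup>2 + (\<Sum>j<n. D i j * W j k)\<^sup>2)" .
    qed
    also have "\<dots> = 2 * ((1 - \<rho>)\<^sup>2 * (\<Sum>k<r. (u k)\<^sup>2) + (\<Sum>k<r. (\<Sum>j<n. D i j * W j k)\<^sup>2))"
      by (simp add: sum.distrib power_mult_distrib power2_commute flip: sum_distrib_left)
    finally show ?thesis by (simp add: u_unit)
  qed
  have "\<eta>\<^sup>2 * w2 = (\<Sum>i<n. \<eta>\<^sup>2 * (2 - 2 * align i))"
    by (simp add: w2_def Wi sum_distrib_left)
  also have "\<dots> \<le> (\<Sum>i<n. 32 * ((1 - \<rho>)\<^sup>2 + (\<Sum>k<r. (\<Sum>j<n. D i j * W j k)\<^sup>2)))"
    by (intro sum_mono pt) auto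
  also have "\<dots> = 32 * (n * (1 - \<rho>)\<^sup>2 + (\<Sum>i<n. \<Sum>k<r. (\<Sum>j<n. D i j * W j k)\<^sup>2))"
    by (simp add: sum.distrib flip: sum_distrib_left)
  also have "\<dots> \<le> 32 * (n * (1 - \<rho>)\<^sup>2 + \<delta>\<^sup>2 * w2)"
    using op_rows[of W] by (simp add: w2_def)
  \<comment> \<open>As \<open>w2 = 2 n (1 - \<rho>)\<close>, this term is \<open>w2\<close> times a
    small factor too. With \<open>1 - \<rho> \<le> 32 \<delta>^2\<close> the total factor is
    \<open>16 * 32 + 32 = 544\<close>.\<close>
  also have "n * (1 - \<rho>)\<^sup>2 = (1 - \<rho>) / 2 * w2" by (simp add: w2 power2_eq_square)
  also have "32 * ((1 - \<rho>) / 2 * w2 + \<delta>\<^sup>2 * w2) = (16 * (1 - \<rho>) + 32 * \<delta>\<^sup>2) * w2"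
    by (simp add: field_simps)
  also have "\<dots> \<le> (544 * \<delta>\<^sup>2) * w2"
    using one_minus_rho_le by (intro mult_right_mono) (auto simp: w2_def sum_nonneg)
  finally have le: "\<eta>\<^sup>2 * w2 \<le> (544 * \<delta>\<^sup>2) * w2" .
  have "(24 * \<delta>)\<^sup>2 < \<eta>\<^sup>2" using small \<delta> by (intro power_strict_mono) auto
  then have "576 * \<delta>\<^sup>2 < \<eta>\<^sup>2" by (simp add: power_mult_distrib)
  moreover have "0 \<le> \<delta>\<^sup>2" by simp
  ultimately have "544 * \<delta>\<^sup>2 < \<eta>\<^sup>2" by linarith
  then have "w2 \<le> 0" using le by (meson mult_less_cancel_right_pos not_le)
  then have "w2 = 0" by (intro antisym) (simp_all add: w2_def sum_nonneg)
  then have "\<forall>i\<in>{..<n}. (\<Sum>k<r. (W i k)\<^sup>2) = 0"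
    unfolding w2_def by (subst (asm) sum_nonneg_eq_0_iff) (auto intro: sum_nonneg)
  then have "\<forall>i\<in>{..<n}. \<forall>k\<in>{..<r}. (W i k)\<^sup>2 = 0"
    by (simp add: sum_nonneg_eq_0_iff)
  then have "y i k = u k" "y j k = u k" if "k < r" for k using assms that by (auto simp: W_def)
  then show ?thesis using u_unit by (simp add: gram_def power2_eq_square)
qed

end

section \<open>Counting even closed walks\<close>

text \<open>A walk of \<open>m\<close> steps has \<open>m + 1\<close> vertices. Extensionality
  outside \<open>{..m}\<close> makes the set finite and equality of walks meaningful.\<close>

definition walks :: "nat \<Rightarrow> nat \<Rightarrow> nat \<Rightarrow> (nat \<Rightarrow> nat) set" where
  "walks n m x = {w \<in> {..m} \<rightarrow>\<^sub>E {..<n}. w 0 = x}"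

definition step_edge :: "(nat \<Rightarrow> nat) \<Rightarrow> nat \<Rightarrow> nat \<times> nat" where
  "step_edge w t = (min (w t) (w (Suc t)), max (w t) (w (Suc t)))"

definition incident :: "nat \<Rightarrow> nat \<times> nat \<Rightarrow> bool" where
  "incident x e \<longleftrightarrow> fst e = x \<or> snd e = x"

definition traversals :: "(nat \<Rightarrow> nat) \<Rightarrow> nat \<Rightarrow> nat \<times> nat \<Rightarrow> nat" where
  "traversals w t e = card {s. s < t \<and> step_edge w s = e}"

text \<open>An edge used an odd number of times so far counts as open. A step along it closes it;
  every other step opens its edge.\<close>

definition closing :: "(nat \<Rightarrow> nat) \<Rightarrow> nat \<Rightarrow> bool" where
  "closing w t \<longleftrightarrow> odd (traversals w t (step_edge w t))"

definition odd_degree :: "(nat \<Rightarrow> nat) \<Rightarrow> nat \<Rightarrow> nat" where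
  "odd_degree w t = card {e. incident (w t) e \<and> odd (traversals w t e)}"

definition visits :: "(nat \<Rightarrow> nat) \<Rightarrow> nat \<Rightarrow> nat \<Rightarrow> nat" where
  "visits w t y = card {u. u \<le> t \<and> w u = y}"

text \<open>The transition probability, up to slack, of the following process. With probability 1/2 it
  traverses a uniformly chosen edge at the current vertex that was used an odd number of times so
  far; otherwise it moves to \<open>y\<close> with probability proportional to \<open>s\<close> plus the number of visits to \<open>y\<close>.\<close>

definition step_weight :: "real \<Rightarrow> nat \<Rightarrow> nat \<Rightarrow> (nat \<Rightarrow> nat) \<Rightarrow> nat \<Rightarrow> real" where
  "step_weight s n m w t =
     (if closing w t then 1 / (2 * real (odd_degree w t))
      else (s + real (visits w t (w (Suc t)))) / (2 * (real n * s + real m)))"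

section \<open>Total mass of the walk process\<close>

lemma finite_walks [simp]: "finite (walks n m x)"
  unfolding walks_def by (rule finite_subset[of _ "{..m} \<rightarrow>\<^sub>E {..<n}"]) (auto intro: finite_PiE)

lemma sum_walks_Suc:
  fixes f :: "(nat \<Rightarrow> nat) \<Rightarrow> real"
  shows "(\<Sum>w\<in>walks n (Suc m) x. f w) = (\<Sum>w\<in>walks n m x. \<Sum>y<n. f (w(Suc m := y)))"
proof -
  have "(\<Sum>w\<in>walks n m x. \<Sum>y<n. f (w(Suc m := y))) =
        (\<Sum>(w,y)\<in>walks n m x \<times> {..<n}. f (w(Suc m := y)))"
    by (simp add: sum.cartesian_product)
  also have "\<dots> = (\<Sum>w\<in>walks n (Suc m) x. f w)"
  proof (rule sum.reindex_bij_witness[where j = "\<lambda>(w,y). w(Suc m := y)"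
        and i = "\<lambda>w. (restrict w {..m}, w (Suc m))"])
    fix a assume "a \<in> walks n m x \<times> {..<n}"
    then obtain w y where a: "a = (w, y)" "w \<in> walks n m x" "y < n" by auto
    have "restrict (w(Suc m := y)) {..m} = w"
      using a(2) by (auto simp: walks_def restrict_def PiE_def extensional_def fun_eq_iff)
    then show "(restrict ((case a of (w, y) \<Rightarrow> w(Suc m := y))) {..m},
       (case a of (w, y) \<Rightarrow> w(Suc m := y)) (Suc m)) = a" by (simp add: a)
    show "(case a of (w, y) \<Rightarrow> w(Suc m := y)) \<in> walks n (Suc m) x"
      using a by (auto simp: walks_def PiE_def extensional_def Pi_def)
  next
    fix w assume w: "w \<in> walks n (Suc m) x"
    show "(case (restrict w {..m}, w (Suc m)) of (w, y) \<Rightarrow> w(Suc m := y)) = w"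
      using w by (auto simp: walks_def PiE_def extensional_def fun_eq_iff restrict_def)
    show "(restrict w {..m}, w (Suc m)) \<in> walks n m x \<times> {..<n}"
      using w by (auto simp: walks_def PiE_def Pi_def)
  qed auto
  finally show ?thesis by simp
qed

lemma step_weight_cong:
  assumes "\<And>u. u \<le> Suc t \<Longrightarrow> w u = w' u"
  shows "step_weight s n m w t = step_weight s n m w' t"
proof -
  have e: "step_edge w u = step_edge w' u" if "u \<le> t" for u
    using that assms by (simp add: step_edge_def)
  have t: "traversals w t e = traversals w' t e" for e
    unfolding traversals_def using e by (intro arg_cong[where f = card]) auto
  have v: "visits w t y = visits w' t y" for y
    unfolding visits_def using assms by (intro arg_cong[where f = card]) auto
  show ?thesis
    unfolding step_weight_def closing_def odd_degree_def using e[of t] t v assms by simp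
qed

lemma step_weight_nonneg: "0 \<le> s \<Longrightarrow> 0 \<le> step_weight s n m w t"
  by (simp add: step_weight_def)

lemma finite_odd_edges: "finite {e. P e \<and> odd (traversals w t e)}"
proof (rule finite_subset)
  show "{e. P e \<and> odd (traversals w t e)} \<subseteq> step_edge w ` {..<t}"
  proof safe
    fix a b assume "odd (traversals w t (a, b))"
    then have "traversals w t (a, b) \<noteq> 0" by (intro notI) simp
    then have "{s. s < t \<and> step_edge w s = (a, b)} \<noteq> {}" unfolding traversals_def by (intro notI) simp
    then show "(a, b) \<in> step_edge w ` {..<t}" by force
  qed
qed simp

text \<open>The closing targets and the reinforced targets carry mass at most 1/2 each. A vertex
  receives only one of the two weights, so adding both gives an upper bound.\<close>

lemma sum_step_weight_le_1:
  assumes s: "0 \<le> s" and jm: "j < m" and w: "w \<in> walks n j x"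
  shows "(\<Sum>y<n. step_weight s n m (w(Suc j := y)) j) \<le> 1"
proof -
  let ?e = "\<lambda>y. (min (w j) y, max (w j) y)"
  define K where "K = {y. y < n \<and> odd (traversals w j (?e y))}"
  have tr: "traversals (w(Suc j := y)) j e = traversals w j e" for e y
    unfolding traversals_def step_edge_def by (intro arg_cong[where f = card]) auto
  have cl: "closing (w(Suc j := y)) j \<longleftrightarrow> odd (traversals w j (?e y))" for y
    unfolding closing_def tr by (simp add: step_edge_def)
  have od: "odd_degree (w(Suc j := y)) j = odd_degree w j" for y
    unfolding odd_degree_def tr by simp
  have vi: "visits (w(Suc j := y)) j z = visits w j z" for y z
    unfolding visits_def by (intro arg_cong[where f = card]) auto
  have q: "step_weight s n m (w(Suc j := y)) j \<le>
      (if y \<in> K then 1 / (2 * real (odd_degree w j)) else 0) + (s + visits w j y) / (2 * (n * s + m))"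
    if "y < n" for y
    using that s unfolding step_weight_def cl od vi K_def by simp
  have inj: "inj_on ?e K" by (auto simp: inj_on_def min_def max_def split: if_splits)
  \<comment> \<open>Distinct closing targets use distinct open edges at \<open>w j\<close>, so at
    most \<open>odd_degree w j\<close> of them share the uniform weight.\<close>
  have "card K = card (?e ` K)" by (simp add: card_image inj)
  also have "\<dots> \<le> odd_degree w j" unfolding odd_degree_def
  proof (intro card_mono finite_odd_edges subsetI)
    fix e assume "e \<in> ?e ` K"
    then obtain y where "e = ?e y" "odd (traversals w j (?e y))" by (auto simp: K_def)
    moreover have "incident (w j) (?e y)" by (auto simp: incident_def min_def max_def)
    ultimately show "e \<in> {e. incident (w j) e \<and> odd (traversals w j e)}" by simp
  qed
  finally have cK: "card K \<le> odd_degree w j" .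
  have "(\<Sum>y<n. if y \<in> K then 1 / (2 * real (odd_degree w j)) else 0) = card K / (2 * odd_degree w j)"
  proof -
    have "{..<n} \<inter> K = K" by (auto simp: K_def)
    then show ?thesis by (simp add: sum.If_cases Collect_mem_eq)
  qed
  also have "\<dots> \<le> 1 / 2" using cK by (cases "odd_degree w j = 0") (auto simp: field_simps)
  finally have 1: "(\<Sum>y<n. if y \<in> K then 1 / (2 * real (odd_degree w j)) else 0) \<le> 1 / 2" .
  \<comment> \<open>The times 0 to \<open>j\<close> account for \<open>j + 1\<close> visits, which
    is at most \<open>m\<close> because \<open>j < m\<close>.\<close>
  have "(\<Sum>y<n. visits w j y) = card (\<Union>y<n. {u. u \<le> j \<and> w u = y})"
    unfolding visits_def by (subst card_UN_disjoint) (auto simp: finite_subset[of _ "{..j}"])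
  also have "\<dots> \<le> card {..j}" by (intro card_mono) auto
  finally have "(\<Sum>y<n. visits w j y) \<le> m" using jm by simp
  then have v: "(\<Sum>y<n. real (visits w j y)) \<le> m" by (metis of_nat_le_iff of_nat_sum)
  have "(\<Sum>y<n. (s + visits w j y) / (2 * (n * s + m))) = (n * s + (\<Sum>y<n. real (visits w j y))) / (2 * (n * s + m))"
    by (simp add: sum_divide_distrib[symmetric] sum.distrib)
  also have "\<dots> \<le> (n * s + m) / (2 * (n * s + m))"
    using v s by (intro divide_right_mono) auto
  also have "\<dots> = 1 / 2" 
  proof -
    have "n * s + m > 0" using s jm by (intro add_nonneg_pos) auto
    then show ?thesis by simp
  qed
  finally have 2: "(\<Sum>y<n. (s + visits w j y) / (2 * (n * s + m))) \<le> 1 / 2" .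
  have "(\<Sum>y<n. step_weight s n m (w(Suc j := y)) j) \<le>
     (\<Sum>y<n. (if y \<in> K then 1 / (2 * real (odd_degree w j)) else 0) + (s + visits w j y) / (2 * (n * s + m)))"
    using q by (intro sum_mono) auto
  also have "\<dots> \<le> 1" unfolding sum.distrib using 1 2 by linarith
  finally show ?thesis .
qed

text \<open>The last vertex is summed out first. The length \<open>j\<close> runs through the
  induction while the normalisation keeps the final length \<open>m\<close>.\<close>

lemma sum_walks_step_weight_le_1:
  assumes s: "0 \<le> s" and "j \<le> m"
  shows "(\<Sum>w\<in>walks n j x. \<Prod>t<j. step_weight s n m w t) \<le> 1"
  using \<open>j \<le> m\<close>
proof (induction j)
  case 0
  have "walks n 0 x \<subseteq> {\<lambda>i. if i = 0 then x else undefined}"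
  proof
    fix w assume "w \<in> walks n 0 x"
    then have "w i = (if i = 0 then x else undefined)" for i
      by (auto simp: walks_def PiE_def extensional_def)
    then show "w \<in> {\<lambda>i. if i = 0 then x else undefined}" by auto
  qed
  then have "card (walks n 0 x) \<le> 1"
    using card_mono[of "{\<lambda>i. if i = 0 then x else undefined}" "walks n 0 x"] by simp
  then show ?case by simp
next
  case (Suc j)
  have "(\<Sum>w\<in>walks n (Suc j) x. \<Prod>t<Suc j. step_weight s n m w t) =
    (\<Sum>w\<in>walks n j x. \<Sum>y<n. \<Prod>t<Suc j. step_weight s n m (w(Suc j := y)) t)"
    by (rule sum_walks_Suc)
  also have "\<dots> = (\<Sum>w\<in>walks n j x. (\<Prod>t<j. step_weight s n m w t) *
      (\<Sum>y<n. step_weight s n m (w(Suc j := y)) j))"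
  proof (intro sum.cong refl)
    fix w
    have "(\<Prod>t<j. step_weight s n m (w(Suc j := y)) t) = (\<Prod>t<j. step_weight s n m w t)" for y
      by (intro prod.cong refl step_weight_cong) auto
    then show "(\<Sum>y<n. \<Prod>t<Suc j. step_weight s n m (w(Suc j := y)) t) = (\<Prod>t<j. step_weight s n m w t) *
      (\<Sum>y<n. step_weight s n m (w(Suc j := y)) j)"
      by (simp add: sum_distrib_left)
  qed
  also have "\<dots> \<le> (\<Sum>w\<in>walks n j x. \<Prod>t<j. step_weight s n m w t)"
  proof (rule sum_mono)
    fix w assume w: "w \<in> walks n j x"
    have "0 \<le> (\<Prod>t<j. step_weight s n m w t)" by (intro prod_nonneg ballI step_weight_nonneg s)
    moreover have "0 \<le> (\<Sum>y<n. step_weight s n m (w(Suc j := y)) j)"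
      by (intro sum_nonneg step_weight_nonneg s)
    moreover have "(\<Sum>y<n. step_weight s n m (w(Suc j := y)) j) \<le> 1"
      using Suc.prems w by (intro sum_step_weight_le_1 s) auto
    ultimately show "(\<Prod>t<j. step_weight s n m w t) *
        (\<Sum>y<n. step_weight s n m (w(Suc j := y)) j) \<le> (\<Prod>t<j. step_weight s n m w t)"
      by (rule mult_right_le_one_le)
  qed
  also have "\<dots> \<le> 1" using Suc by simp
  finally show ?case .
qed

section \<open>The weight of an even closed walk\<close>

lemma card_even_ranks:
  fixes T :: "nat set"
  assumes "finite T"
  shows "card {t \<in> T. even (card {s \<in> T. s < t})} = (card T + 1) div 2"
  using assms
proof (induction T rule: finite_linorder_max_induct)
  case (insert b A)
  have b: "b \<notin> A" using insert by auto
  have 1: "{s \<in> insert b A. s < t} = {s \<in> A. s < t}" if "t \<in> A" for t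
    using insert that by force
  have 2: "{s \<in> insert b A. s < b} = A" using insert by auto
  define R where "R = (\<lambda>T (t::nat). card {s \<in> T. s < t})"
  have "R (insert b A) t = R A t" if "t \<in> A" for t unfolding R_def 1[OF that] ..
  moreover have "R (insert b A) b = card A" unfolding R_def 2 ..
  ultimately have "{t \<in> insert b A. even (R (insert b A) t)} =
     {t \<in> A. even (R A t)} \<union> (if even (card A) then {b} else {})"
    by auto
  then have "{t \<in> insert b A. even (card {s \<in> insert b A. s < t})} =
     {t \<in> A. even (card {s \<in> A. s < t})} \<union> (if even (card A) then {b} else {})"
    unfolding R_def .
  then have "card {t \<in> insert b A. even (card {s \<in> insert b A. s < t})} =
     (card A + 1) div 2 + (if even (card A) then 1 else 0)"
    using insert b by (simp add: card_Un_disjoint)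
  also have "\<dots> = (card A + 2) div 2" by presburger
  finally show ?case using insert b by simp
qed simp

text \<open>The ranks run from 0 to \<open>card T - 1\<close>, with rank 0 replaced by the factor 1.
  For empty \<open>T\<close> the truncated subtraction gives \<open>fact 0\<close>.\<close>

lemma prod_ranks_eq_fact:
  fixes T :: "nat set"
  assumes "finite T"
  shows "(\<Prod>t\<in>T. max 1 (real (card {s \<in> T. s < t}))) = fact (card T - 1)"
  using assms
proof (induction T rule: finite_linorder_max_induct)
  case (insert b A)
  have b: "b \<notin> A" using insert by auto
  have 1: "{s \<in> insert b A. s < t} = {s \<in> A. s < t}" if "t \<in> A" for t
    using insert that by force
  have 2: "{s \<in> insert b A. s < b} = A" using insert by auto
  have "(\<Prod>t\<in>insert b A. max 1 (real (card {s \<in> insert b A. s < t}))) =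
     max 1 (real (card A)) * (\<Prod>t\<in>A. max 1 (real (card {s \<in> A. s < t})))"
  proof -
    have "(\<Prod>t\<in>A. max 1 (real (card {s \<in> insert b A. s < t}))) = (\<Prod>t\<in>A. max 1 (real (card {s \<in> A. s < t})))"
      by (intro prod.cong refl) (simp only: 1)
    then show ?thesis by (subst prod.insert) (use insert.hyps b in \<open>simp_all only: 2 insert.IH not_False_eq_True\<close>)
  qed
  also have "\<dots> = fact (card (insert b A) - 1)"
    unfolding insert.IH using insert b by (cases "card A") (auto simp: fact_Suc)
  finally show ?case .
qed simp

text \<open>The traversals of one edge alternate between opening and closing, and their number is
  even. Summing over the edges with \<open>P\<close> allows both a global count and a count at a
  single vertex.\<close>

lemma card_opening_eq_closing:
  assumes ev: "\<And>e. even (traversals w m e)"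
  shows "card {t. t < m \<and> \<not> closing w t \<and> P (step_edge w t)} =
         card {t. t < m \<and> closing w t \<and> P (step_edge w t)}"
proof -
  have eq: "card {t. t < m \<and> \<not> closing w t \<and> step_edge w t = e} =
        card {t. t < m \<and> closing w t \<and> step_edge w t = e}" for e
  proof -
    define T where "T = {t. t < m \<and> step_edge w t = e}"
    have fT: "finite T" by (simp add: T_def)
    have cl: "closing w t \<longleftrightarrow> odd (card {s \<in> T. s < t})" if "t \<in> T" for t
    proof -
      have "{s. s < t \<and> step_edge w s = step_edge w t} = {s \<in> T. s < t}"
        using that by (auto simp: T_def)
      then show ?thesis by (simp add: closing_def traversals_def)
    qed
    have cT: "even (card T)" using ev[of e] by (simp add: traversals_def T_def)
    have "{t. t < m \<and> \<not> closing w t \<and> step_edge w t = e} = {t \<in> T. even (card {s \<in> T. s < t})}"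
      using cl by (auto simp: T_def)
    then have o: "card {t. t < m \<and> \<not> closing w t \<and> step_edge w t = e} = card T div 2"
      using card_even_ranks[OF fT] cT by simp
    have "T = {t. t < m \<and> \<not> closing w t \<and> step_edge w t = e} \<union> {t. t < m \<and> closing w t \<and> step_edge w t = e}"
      by (auto simp: T_def)
    then have "card T = card ({t. t < m \<and> \<not> closing w t \<and> step_edge w t = e} \<union>
         {t. t < m \<and> closing w t \<and> step_edge w t = e})" by (rule arg_cong)
    also have "\<dots> = card {t. t < m \<and> \<not> closing w t \<and> step_edge w t = e} +
         card {t. t < m \<and> closing w t \<and> step_edge w t = e}"
      by (rule card_Un_disjoint) auto
    finally have "card T = card {t. t < m \<and> \<not> closing w t \<and> step_edge w t = e} +
         card {t. t < m \<and> closing w t \<and> step_edge w t = e}" .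
    then show ?thesis using o cT by auto
  qed
  have gr: "card {t. t < m \<and> Q t \<and> P (step_edge w t)} =
     (\<Sum>e \<in> {e \<in> step_edge w ` {..<m}. P e}. card {t. t < m \<and> Q t \<and> step_edge w t = e})" for Q
  proof -
    have "card {t. t < m \<and> Q t \<and> P (step_edge w t)} =
      card (\<Union>e \<in> {e \<in> step_edge w ` {..<m}. P e}. {t. t < m \<and> Q t \<and> step_edge w t = e})"
      by (intro arg_cong[where f = card]) auto
    also have "\<dots> = (\<Sum>e \<in> {e \<in> step_edge w ` {..<m}. P e}. card {t. t < m \<and> Q t \<and> step_edge w t = e})"
      by (intro card_UN_disjoint ballI impI) (simp, simp, blast)
    finally show ?thesis .
  qed
  show ?thesis unfolding gr eq ..
qed

lemma power_le_fact_exp: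
  fixes y :: real
  assumes "0 \<le> y"
  shows "y ^ a \<le> fact a * exp y"
proof -
  have "y ^ a / fact a \<le> (\<Sum>i<Suc a. y ^ i / fact i)"
    using assms by (intro member_le_sum) auto
  also have "\<dots> \<le> exp y"
  proof -
    have "(\<Sum>i<Suc a. y ^ i /\<^sub>R fact i) \<le> (\<Sum>i. y ^ i /\<^sub>R fact i)"
      using assms by (intro sum_le_suminf summable_exp_generic) auto
    then show ?thesis by (simp add: exp_def divide_inverse mult.commute)
  qed
  finally show ?thesis by (simp add: field_simps)
qed

lemma card_departures_eq_arrivals:
  assumes "w m = w 0"
  shows "card {t. t < m \<and> w t = y} = card {t. t < m \<and> w (Suc t) = y}"
proof -
  have c: "card {t. t < m \<and> P t} = (\<Sum>t<m. if P t then 1 else 0)" for P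
    by (simp add: sum.If_cases Collect_conj_eq lessThan_def)
  have "(\<Sum>t<m. if w t = y then 1 else 0::nat) + (if w m = y then 1 else 0) =
        (if w 0 = y then 1 else 0) + (\<Sum>t<m. if w (Suc t) = y then 1 else 0)"
    using sum.lessThan_Suc_shift[of "\<lambda>t. if w t = y then 1 else 0::nat" m] by simp
  then show ?thesis unfolding c using assms by simp
qed

text \<open>The left side is the moment bound for a walk, and the right side can be summed over all
  walks. Each of the \<open>k\<close> opening steps costs \<open>2 (n s + 2 k)\<close> through its
  normalisation, each of the \<open>k\<close> closing steps costs 2, and the comparison of
  factorials costs \<open>16 ^ k\<close>; hence 64.\<close>

lemma even_closed_walk_weight:
  fixes s :: real
  assumes s: "0 \<le> s" "s \<le> 1" and w: "w \<in> walks n (2 * k) x" and closed: "w (2 * k) = x"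
    and loopless: "\<And>t. t < 2 * k \<Longrightarrow> w t \<noteq> w (Suc t)"
    and ev: "\<And>e. even (traversals w (2 * k) e)"
  shows "s ^ card (step_edge w ` {..<2 * k}) \<le>
    (64 * (n * s + 2 * k)) ^ k * (\<Prod>t<2*k. step_weight s n (2 * k) w t)"
proof -
  define m where "m = 2 * k"
  have w0: "w 0 = x" and wV: "w t < n" if "t \<le> m" for t
    using w that by (auto simp: walks_def m_def)
  define O' where "O' = {t. t < m \<and> \<not> closing w t}"
  define Cl where "Cl = {t. t < m \<and> closing w t}"
  have fin [simp]: "finite O'" "finite Cl" by (auto simp: O'_def Cl_def)
  have un: "{..<m} = O' \<union> Cl" and disj: "O' \<inter> Cl = {}" by (auto simp: O'_def Cl_def)
  \<comment> \<open>Opening steps arrive at \<open>y\<close> \<open>a y\<close> times and leave it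
    \<open>b y\<close> times; closing steps leave it \<open>c y\<close> times and arrive
    \<open>d y\<close> times.\<close>
  define a where "a y = card {t \<in> O'. w (Suc t) = y}" for y
  define b where "b y = card {t \<in> O'. w t = y}" for y
  define c where "c y = card {t \<in> Cl. w t = y}" for y
  define d where "d y = card {t \<in> Cl. w (Suc t) = y}" for y
  have "card O' = card Cl"
    using card_opening_eq_closing[of w m "\<lambda>_. True"] ev by (simp add: O'_def Cl_def m_def)
  moreover have "card O' + card Cl = m"
    using card_Un_disjoint[OF fin disj] un by (metis card_lessThan)
  ultimately have cO: "card O' = k" and cC: "card Cl = k" by (auto simp: m_def)
  have inc: "incident y (step_edge w t) \<longleftrightarrow> w t = y \<or> w (Suc t) = y" for t y
    by (auto simp: incident_def step_edge_def min_def max_def)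
  have ab: "card {t \<in> O'. incident y (step_edge w t)} = a y + b y" for y
  proof -
    have "{t \<in> O'. incident y (step_edge w t)} = {t \<in> O'. w (Suc t) = y} \<union> {t \<in> O'. w t = y}"
      by (auto simp: inc)
    moreover have "{t \<in> O'. w (Suc t) = y} \<inter> {t \<in> O'. w t = y} = {}"
      using loopless by (auto simp: O'_def m_def)
    ultimately show ?thesis by (simp add: card_Un_disjoint a_def b_def)
  qed
  have cd: "card {t \<in> Cl. incident y (step_edge w t)} = c y + d y" for y
  proof -
    have "{t \<in> Cl. incident y (step_edge w t)} = {t \<in> Cl. w t = y} \<union> {t \<in> Cl. w (Suc t) = y}"
      by (auto simp: inc)
    moreover have "{t \<in> Cl. w t = y} \<inter> {t \<in> Cl. w (Suc t) = y} = {}"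
      using loopless by (force simp: Cl_def m_def)
    ultimately show ?thesis by (simp add: card_Un_disjoint c_def d_def)
  qed
  have "a y + b y = c y + d y" for y
    using card_opening_eq_closing[of w m "incident y"] ev ab[of y] cd[of y]
    by (simp add: O'_def Cl_def m_def)
  moreover have "b y + c y = a y + d y" for y
  proof -
    have "card {t. t < m \<and> w t = y} = b y + c y"
    proof -
      have "{t. t < m \<and> w t = y} = {t \<in> O'. w t = y} \<union> {t \<in> Cl. w t = y}" using un by auto
      moreover have "{t \<in> O'. w t = y} \<inter> {t \<in> Cl. w t = y} = {}" using disj by auto
      ultimately show ?thesis by (simp add: card_Un_disjoint c_def b_def)
    qed
    moreover have "card {t. t < m \<and> w (Suc t) = y} = a y + d y"
    proof -
      have "{t. t < m \<and> w (Suc t) = y} = {t \<in> O'. w (Suc t) = y} \<union> {t \<in> Cl. w (Suc t) = y}" using un by auto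
      moreover have "{t \<in> O'. w (Suc t) = y} \<inter> {t \<in> Cl. w (Suc t) = y} = {}" using disj by auto
      ultimately show ?thesis by (simp add: card_Un_disjoint a_def d_def)
    qed
    moreover have "w m = w 0" using closed w0[of 0] by (simp add: m_def)
    ultimately show ?thesis using card_departures_eq_arrivals[of w m y] by simp
  qed
  \<comment> \<open>Balance of edges at \<open>y\<close> gives \<open>a + b = c + d\<close>, balance
    of departures and arrivals gives \<open>b + c = a + d\<close>; subtracting yields
    \<open>2 a = 2 c\<close>.\<close>
  ultimately have ac: "a y = c y" for y by (metis add.commute add_left_cancel add.left_commute mult_2 nat_mult_eq_cancel1 zero_less_numeral add.assoc)
  have group: "(\<Sum>y<n. card {t \<in> S. g t = y}) = card S"
    if "S \<subseteq> {..<m}" "\<And>t. t \<in> S \<Longrightarrow> g t < n" for S :: "nat set" and g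
  proof -
    have "finite S" using that finite_subset by blast
    then show ?thesis using sum.group[of S "{..<n}" g "\<lambda>_. 1::nat"] that by auto
  qed
  have sa: "(\<Sum>y<n. a y) = k" and sb: "(\<Sum>y<n. b y) = k"
    using group[of O' "\<lambda>t. w (Suc t)"] group[of O' w] wV cO unfolding a_def b_def O'_def by auto

  \<comment> \<open>Since \<open>a y = c y\<close>, the \<open>(a y + b y) ^ c y\<close> choices for the closing steps out of \<open>y\<close> are, up to
    exponential factors, paid for by the \<open>fact (a y)\<close> gained from reinforcing visited vertices.\<close>
  have "(\<Prod>t\<in>Cl. real (odd_degree w t)) \<le> (\<Prod>t\<in>Cl. real (a (w t) + b (w t)))"
  proof (intro prod_mono conjI)
    fix t assume t: "t \<in> Cl"
    \<comment> \<open>The first traversal of an open edge is an opening step at an earlier time. So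
      the open edges at \<open>w t\<close> are at most as many as the opening steps incident to
      it.\<close>
    have "{e. incident (w t) e \<and> odd (traversals w t e)} \<subseteq>
        step_edge w ` {s \<in> O'. incident (w t) (step_edge w s)}"
    proof (intro subsetI, elim CollectE conjE)
      fix e assume e: "incident (w t) e" "odd (traversals w t e)"
      then have ne: "{s. s < t \<and> step_edge w s = e} \<noteq> {}"
        unfolding traversals_def by (intro notI) simp
      define u where "u = (LEAST s. step_edge w s = e)"
      have u: "step_edge w u = e" unfolding u_def using ne by (auto intro: LeastI)
      have ut: "u < t" using ne by (auto simp: u_def intro: le_less_trans[OF Least_le])
      have "{s. s < u \<and> step_edge w s = e} = {}"
        using not_less_Least unfolding u_def by auto
      then have "traversals w u e = 0" unfolding traversals_def by (simp only: card.empty)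
      then have "\<not> closing w u" by (simp add: closing_def u)
      then have "u \<in> O'" using ut t by (simp add: O'_def Cl_def)
      then show "e \<in> step_edge w ` {s \<in> O'. incident (w t) (step_edge w s)}"
        using u e by auto
    qed
    then have "odd_degree w t \<le> card (step_edge w ` {s \<in> O'. incident (w t) (step_edge w s)})"
      unfolding odd_degree_def by (intro card_mono) auto
    also have "\<dots> \<le> a (w t) + b (w t)" unfolding ab[symmetric] by (intro card_image_le) auto
    finally show "real (odd_degree w t) \<le> real (a (w t) + b (w t))" by simp
  qed auto
  also have "\<dots> = (\<Prod>y<n. \<Prod>t\<in>{t \<in> Cl. w t = y}. real (a (w t) + b (w t)))"
    by (rule prod.group[symmetric]) (use wV in \<open>auto simp: Cl_def\<close>)
  also have "\<dots> = (\<Prod>y<n. real (a y + b y) ^ a y)"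
    by (intro prod.cong refl) (simp add: ac c_def)
  also have "\<dots> \<le> (\<Prod>y<n. (exp (real (a y + b y)) * 2 ^ a y) * fact (a y - 1))"
  proof (intro prod_mono conjI)
    fix y
    \<comment> \<open>The first arrival at \<open>y\<close> has rank 0 and yields no factor, so the
      openings supply only \<open>fact (a y - 1)\<close>. The missing factor \<open>a y\<close> is
      at most \<open>2 ^ a y\<close>.\<close>
    have "fact (a y) \<le> 2 ^ a y * (fact (a y - 1) :: real)"
    proof (cases "a y")
      case (Suc l)
      have "real (Suc l) \<le> 2 ^ Suc l" using of_nat_less_two_power[of "Suc l"] by (metis less_imp_le)
      then show ?thesis using mult_right_mono[of "real (Suc l)" "2 ^ Suc l" "fact l"] Suc by simp
    qed simp
    then have "fact (a y) * exp (real (a y + b y)) \<le> (2 ^ a y * fact (a y - 1)) * exp (real (a y + b y))"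
      by (intro mult_right_mono) auto
    also have "\<dots> = (exp (real (a y + b y)) * 2 ^ a y) * fact (a y - 1)" by (simp only: mult_ac)
    finally show "real (a y + b y) ^ a y \<le> (exp (real (a y + b y)) * 2 ^ a y) * fact (a y - 1)"
      using power_le_fact_exp[of "real (a y + b y)" "a y"] by linarith
  qed auto
  also have "\<dots> = exp (\<Sum>y<n. real (a y + b y)) * 2 ^ (\<Sum>y<n. a y) * (\<Prod>y<n. fact (a y - 1))"
    by (simp add: prod.distrib exp_sum power_sum)
  also have "(\<Sum>y<n. real (a y + b y)) = real (2 * k)"
    using sa sb by (simp flip: of_nat_sum add: sum.distrib)
  finally have close: "(\<Prod>t\<in>Cl. real (odd_degree w t)) \<le> exp (real (2 * k)) * 2 ^ k * (\<Prod>y<n. fact (a y - 1))"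
    unfolding sa .

  \<comment> \<open>Distinct edges correspond to first traversals, so only these opening steps have
    to pay a factor \<open>s\<close>.\<close>
  define first where "first t \<longleftrightarrow> traversals w t (step_edge w t) = 0" for t
  have first_O: "{t. t < m \<and> first t} \<subseteq> O'" by (auto simp: first_def O'_def closing_def)
  have "inj_on (step_edge w) {t. t < m \<and> first t}"
  proof (rule linorder_inj_onI)
    fix u v assume "u < v" "v \<in> {t. t < m \<and> first t}"
    then have "{s. s < v \<and> step_edge w s = step_edge w v} = {}" by (auto simp: first_def traversals_def)
    then show "step_edge w u \<noteq> step_edge w v" using \<open>u < v\<close> by auto
  qed auto
  then have "card {t. t < m \<and> first t} = card (step_edge w ` {t. t < m \<and> first t})" by (simp add: card_image)
  also have "\<dots> \<le> card (step_edge w ` {..<m})" by (intro card_mono) auto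
  finally have "s ^ card (step_edge w ` {..<m}) \<le> s ^ card {t. t < m \<and> first t}"
    using s by (intro power_decreasing)
  also have "s ^ card {t. t < m \<and> first t} = (\<Prod>t\<in>O'. if first t then s else 1)"
  proof -
    have "{t \<in> O'. first t} = {t. t < m \<and> first t}" using first_O by (auto simp: O'_def)
    then show ?thesis using prod.inter_filter[of O' "\<lambda>_. s" first] by simp
  qed
  finally have first_le: "s ^ card (step_edge w ` {..<m}) \<le> (\<Prod>t\<in>O'. if first t then s else 1)" .
  have "(\<Prod>y<n. fact (a y - 1)) =
      (\<Prod>y<n. \<Prod>t\<in>{t \<in> O'. w (Suc t) = y}. max 1 (real (card {u \<in> {t \<in> O'. w (Suc t) = y}. u < t})))"
    unfolding a_def by (intro prod.cong refl prod_ranks_eq_fact[symmetric]) simp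
  also have "\<dots> =
      (\<Prod>y<n. \<Prod>t\<in>{t \<in> O'. w (Suc t) = y}. max 1 (real (card {u \<in> O'. w (Suc u) = w (Suc t) \<and> u < t})))"
    by (intro prod.cong refl arg_cong[where f = "\<lambda>A. max 1 (real (card A))"]) auto
  also have "\<dots> = (\<Prod>t\<in>O'. max 1 (real (card {u \<in> O'. w (Suc u) = w (Suc t) \<and> u < t})))"
    by (rule prod.group) (use wV in \<open>auto simp: O'_def\<close>)
  finally have "s ^ card (step_edge w ` {..<m}) * (\<Prod>y<n. fact (a y - 1)) =
      s ^ card (step_edge w ` {..<m}) * (\<Prod>t\<in>O'. max 1 (real (card {u \<in> O'. w (Suc u) = w (Suc t) \<and> u < t})))"
    by (rule arg_cong)
  also have "\<dots> \<le> (\<Prod>t\<in>O'. if first t then s else 1) *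
      (\<Prod>t\<in>O'. max 1 (real (card {u \<in> O'. w (Suc u) = w (Suc t) \<and> u < t})))"
    by (intro mult_right_mono first_le prod_nonneg) auto
  also have "\<dots> = (\<Prod>t\<in>O'. (if first t then s else 1) * max 1 (real (card {u \<in> O'. w (Suc u) = w (Suc t) \<and> u < t})))"
    by (rule prod.distrib[symmetric])
  \<comment> \<open>Earlier opening arrivals at the target are visits to it. On a first traversal,
    \<open>s max (1, R) \<le> s + R\<close> since \<open>s \<le> 1\<close>; otherwise the edge was
    used before, so its endpoint was visited and the visits alone exceed
    \<open>max (1, R)\<close>.\<close>
  also have "\<dots> \<le> (\<Prod>t\<in>O'. s + real (visits w t (w (Suc t))))"
  proof (intro prod_mono conjI)
    fix t assume t: "t \<in> O'"
    let ?R = "{u \<in> O'. w (Suc u) = w (Suc t) \<and> u < t}" and ?V = "{u. u \<le> t \<and> w u = w (Suc t)}"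
    have fV: "finite ?V" by simp
    have "card ?R = card (Suc ` ?R)" by (simp add: card_image)
    also have "\<dots> \<le> card ?V" by (intro card_mono fV) auto
    finally have RV: "card ?R \<le> visits w t (w (Suc t))" by (simp add: visits_def)
    have nf: "1 \<le> visits w t (w (Suc t))" if old: "\<not> first t"
    proof -
      have "{s. s < t \<and> step_edge w s = step_edge w t} \<noteq> {}"
        using old unfolding first_def traversals_def by (intro notI) simp
      then obtain u where "u < t" "step_edge w u = step_edge w t" by auto
      then have "incident (w (Suc t)) (step_edge w u)" by (simp add: inc)
      then have "w u = w (Suc t) \<or> w (Suc u) = w (Suc t)" unfolding inc .
      then have "?V \<noteq> {}" using \<open>u < t\<close> by (auto intro: Suc_leI less_imp_le)
      then show ?thesis using fV by (simp add: visits_def Suc_le_eq card_gt_0_iff del: Collect_empty_eq)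
    qed
    show "(if first t then s else 1) * max 1 (real (card ?R)) \<le> s + real (visits w t (w (Suc t)))"
    proof (cases "first t")
      case True
      have "s * max 1 (real (card ?R)) \<le> s * (1 + real (card ?R))" using s by (intro mult_left_mono) auto
      also have "\<dots> \<le> s + real (card ?R)" using s by (simp add: algebra_simps mult_left_le_one_le)
      finally show ?thesis using True RV by simp
    next
      case False
      then show ?thesis using RV nf s by auto
    qed
    show "0 \<le> (if first t then s else 1) * max 1 (real (card ?R))" using s by simp
  qed
  finally have op: "s ^ card (step_edge w ` {..<m}) * (\<Prod>y<n. fact (a y - 1)) \<le>
      (\<Prod>t\<in>O'. s + real (visits w t (w (Suc t))))" .

  \<comment> \<open>The normalisation can vanish only for the walk without steps, where all powers
    are 1.\<close>
  have ns: "0 < n * s + m \<or> k = 0" using s by (auto simp: m_def add_nonneg_pos)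
  have od: "0 < odd_degree w t" if "t \<in> Cl" for t
  proof -
    have "step_edge w t \<in> {e. incident (w t) e \<and> odd (traversals w t e)}"
      using that by (simp add: Cl_def closing_def inc)
    then show ?thesis unfolding odd_degree_def by (metis card_gt_0_iff empty_iff finite_odd_edges)
  qed
  have "(\<Prod>t<m. step_weight s n m w t) = (\<Prod>t\<in>O'. step_weight s n m w t) * (\<Prod>t\<in>Cl. step_weight s n m w t)"
    unfolding un by (rule prod.union_disjoint) (use disj in auto)
  also have "(\<Prod>t\<in>O'. step_weight s n m w t) =
      (\<Prod>t\<in>O'. (s + real (visits w t (w (Suc t)))) / (2 * (n * s + m)))"
    by (intro prod.cong) (auto simp: O'_def step_weight_def)
  also have "\<dots> = (\<Prod>t\<in>O'. s + real (visits w t (w (Suc t)))) / (2 * (n * s + m)) ^ k"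
    by (simp add: prod_dividef cO)
  also have "(\<Prod>t\<in>Cl. step_weight s n m w t) = (\<Prod>t\<in>Cl. 1 / (2 * real (odd_degree w t)))"
    by (intro prod.cong) (auto simp: Cl_def step_weight_def)
  also have "\<dots> = 1 / (2 ^ k * (\<Prod>t\<in>Cl. real (odd_degree w t)))"
    by (simp add: prod_dividef prod.distrib cC)
  finally have Q: "(\<Prod>t<m. step_weight s n m w t) =
     (\<Prod>t\<in>O'. s + real (visits w t (w (Suc t)))) / (2 * (n * s + m)) ^ k *
     (1 / (2 ^ k * (\<Prod>t\<in>Cl. real (odd_degree w t))))" .
  define E where "E = s ^ card (step_edge w ` {..<m})"
  define F where "F = (\<Prod>y<n. fact (a y - 1) :: real)"
  define V where "V = (\<Prod>t\<in>O'. s + real (visits w t (w (Suc t))))"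
  define D where "D = (\<Prod>t\<in>Cl. real (odd_degree w t))"
  have D0: "0 < D" unfolding D_def using od by (intro prod_pos) auto
  have E0: "0 \<le> E" using s by (simp add: E_def)
  have e64: "exp (real (2 * k)) * 2 ^ k \<le> (16::real) ^ k"
  proof -
    have "exp (2::real) = exp 1 * exp 1" by (simp flip: exp_add)
    also have "\<dots> \<le> 2.8 * 2.8" using e_less_272 by (intro mult_mono) auto
    finally have "exp (2::real) \<le> 8" by simp
    then have "exp (2::real) ^ k \<le> 8 ^ k" by (intro power_mono) auto
    then have "exp (real (2 * k)) \<le> 8 ^ k" by (simp flip: exp_of_nat_mult add: mult.commute)
    then have "exp (real (2 * k)) * 2 ^ k \<le> (8::real) ^ k * 2 ^ k" by (intro mult_right_mono) auto
    then show ?thesis by (simp flip: power_mult_distrib)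
  qed
  have "E * D \<le> E * (exp (real (2 * k)) * 2 ^ k * F)"
    using close E0 unfolding D_def F_def by (intro mult_left_mono)
  also have "\<dots> = (exp (real (2 * k)) * 2 ^ k) * (E * F)" by simp
  also have "\<dots> \<le> 16 ^ k * (E * F)" using e64 E0
    by (intro mult_right_mono mult_nonneg_nonneg) (auto simp: F_def intro!: prod_nonneg)
  also have "\<dots> \<le> 16 ^ k * V" using op by (intro mult_left_mono) (auto simp: E_def F_def V_def)
  finally have ED: "E * D \<le> 16 ^ k * V" .
  have "(64 * (n * s + m)) ^ k * (\<Prod>t<m. step_weight s n m w t) = 16 ^ k * V / D"
  proof -
    define P where "P = (2 * (n * s + m)) ^ k"
    have "(64 * (n * s + m)) ^ k = 16 ^ k * 2 ^ k * P"
      unfolding P_def by (simp flip: power_mult_distrib)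
    moreover have "P \<noteq> 0" unfolding P_def using ns by auto
    ultimately show ?thesis unfolding Q V_def[symmetric] D_def[symmetric] P_def[symmetric] by simp
  qed
  moreover have "E \<le> 16 ^ k * V / D" using ED D0 by (simp add: pos_le_divide_eq)
  ultimately have "E \<le> (64 * (n * s + m)) ^ k * (\<Prod>t<m. step_weight s n m w t)" by simp
  then show ?thesis by (simp add: E_def m_def)
qed

section \<open>Operator norm of a centred random adjacency matrix\<close>

fun mat_pow :: "nat \<Rightarrow> (nat \<Rightarrow> nat \<Rightarrow> real) \<Rightarrow> nat \<Rightarrow> nat \<Rightarrow> nat \<Rightarrow> real" where
  "mat_pow n M 0 i j = (if i = j then 1 else 0)"
| "mat_pow n M (Suc m) i j = (\<Sum>h<n. mat_pow n M m i h * M h j)"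

lemma mat_pow_eq_sum_walks:
  assumes "x < n" "y < n"
  shows "mat_pow n M m x y = (\<Sum>w\<in>walks n m x. if w m = y then \<Prod>t<m. M (w t) (w (Suc t)) else 0)"
  using assms(2)
proof (induction m arbitrary: y)
  case 0
  have "walks n 0 x = {\<lambda>i. if i = 0 then x else undefined}"
  proof (intro equalityI subsetI)
    fix w assume "w \<in> walks n 0 x"
    then have "w i = (if i = 0 then x else undefined)" for i
      by (auto simp: walks_def PiE_def extensional_def)
    then show "w \<in> {\<lambda>i. if i = 0 then x else undefined}" by auto
  qed (use assms in \<open>auto simp: walks_def PiE_def extensional_def\<close>)
  then show ?case by (simp only: mat_pow.simps) simp
next
  case (Suc m)
  have "mat_pow n M (Suc m) x y =
    (\<Sum>h<n. \<Sum>w\<in>walks n m x. (if w m = h then (\<Prod>t<m. M (w t) (w (Suc t))) * M (w m) y else 0))"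
    using Suc.IH by (auto simp: sum_distrib_right intro!: sum.cong)
  also have "\<dots> = (\<Sum>w\<in>walks n m x. \<Sum>h<n. (if w m = h then (\<Prod>t<m. M (w t) (w (Suc t))) * M (w m) y else 0))"
    by (rule sum.swap)
  also have "\<dots> = (\<Sum>w\<in>walks n m x. \<Sum>h<n.
      if (w(Suc m := h)) (Suc m) = y then \<Prod>t<Suc m. M ((w(Suc m := h)) t) ((w(Suc m := h)) (Suc t)) else 0)"
  proof (rule sum.cong[OF refl])
    fix w assume "w \<in> walks n m x"
    then have wm: "w m < n" by (auto simp: walks_def)
    have "(\<Prod>t<m. M ((w(Suc m := h)) t) ((w(Suc m := h)) (Suc t))) = (\<Prod>t<m. M (w t) (w (Suc t)))" for h
      by (intro prod.cong) auto
    then have "(if (w(Suc m := h)) (Suc m) = y then \<Prod>t<Suc m. M ((w(Suc m := h)) t) ((w(Suc m := h)) (Suc t)) else 0)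
       = (if h = y then (\<Prod>t<m. M (w t) (w (Suc t))) * M (w m) y else 0)" for h
      by simp
    then show "(\<Sum>h<n. (if w m = h then (\<Prod>t<m. M (w t) (w (Suc t))) * M (w m) y else 0)) = (\<Sum>h<n.
      if (w(Suc m := h)) (Suc m) = y then \<Prod>t<Suc m. M ((w(Suc m := h)) t) ((w(Suc m := h)) (Suc t)) else 0)"
      using wm Suc.prems by simp
  qed
  also have "\<dots> = (\<Sum>w\<in>walks n (Suc m) x. if w (Suc m) = y then \<Prod>t<Suc m. M (w t) (w (Suc t)) else 0)"
    by (rule sum_walks_Suc[symmetric])
  finally show ?case .
qed

lemma mat_pow_add:
  assumes "j < n"
  shows "mat_pow n M (a + b) i j = (\<Sum>h<n. mat_pow n M a i h * mat_pow n M b h j)"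
  using assms
proof (induction b arbitrary: j)
  case 0
  then show ?case by (simp add: if_distrib[of "\<lambda>x. _ * x"] cong: if_cong)
next
  case (Suc b)
  have "mat_pow n M (a + Suc b) i j = (\<Sum>g<n. (\<Sum>h<n. mat_pow n M a i h * mat_pow n M b h g) * M g j)"
    using Suc.IH by (auto intro!: sum.cong)
  also have "\<dots> = (\<Sum>g<n. \<Sum>h<n. mat_pow n M a i h * (mat_pow n M b h g * M g j))"
    by (simp add: sum_distrib_right mult.assoc)
  also have "\<dots> = (\<Sum>h<n. \<Sum>g<n. mat_pow n M a i h * (mat_pow n M b h g * M g j))"
    by (rule sum.swap)
  finally show ?case by (simp add: sum_distrib_left)
qed

lemma mat_pow_sym:
  assumes sym: "\<And>i j. i < n \<Longrightarrow> j < n \<Longrightarrow> M i j = M j i" and "i < n" "j < n"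
  shows "mat_pow n M k i j = mat_pow n M k j i"
  using assms(2,3)
proof (induction k arbitrary: i j)
  case (Suc k)
  have one: "mat_pow n M 1 j h = M j h" if "h < n" for h
    using \<open>j < n\<close> that by (simp add: if_distrib[of "\<lambda>x. x * _"] cong: if_cong)
  have "mat_pow n M (Suc k) i j = (\<Sum>h<n. M j h * mat_pow n M k h i)"
    using Suc sym by (auto intro!: sum.cong)
  also have "\<dots> = mat_pow n M (1 + k) j i"
    using one by (simp only: mat_pow_add[OF \<open>i < n\<close>]) (auto intro!: sum.cong)
  finally show ?case by simp
qed simp

lemma trace_mat_pow_double:
  assumes sym: "\<And>i j. i < n \<Longrightarrow> j < n \<Longrightarrow> M i j = M j i"
  shows "(\<Sum>i<n. mat_pow n M (2 * k) i i) = (\<Sum>i<n. \<Sum>j<n. (mat_pow n M k i j)\<^sup>2)"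
proof (rule sum.cong[OF refl])
  fix i assume "i \<in> {..<n}"
  then have "mat_pow n M (k + k) i i = (\<Sum>h<n. mat_pow n M k i h * mat_pow n M k i h)"
    using mat_pow_sym[of n M, OF sym] by (subst mat_pow_add) (auto intro!: sum.cong)
  then show "mat_pow n M (2 * k) i i = (\<Sum>j<n. (mat_pow n M k i j)\<^sup>2)"
    by (simp add: mult_2 power2_eq_square)
qed

fun iterate_mat :: "nat \<Rightarrow> (nat \<Rightarrow> nat \<Rightarrow> real) \<Rightarrow> (nat \<Rightarrow> real) \<Rightarrow> nat \<Rightarrow> nat \<Rightarrow> real" where
  "iterate_mat n M x 0 i = x i"
| "iterate_mat n M x (Suc k) i = (\<Sum>j<n. M i j * iterate_mat n M x k j)"

lemma iterate_mat_eq: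
  assumes sym: "\<And>i j. i < n \<Longrightarrow> j < n \<Longrightarrow> M i j = M j i" and "i < n"
  shows "iterate_mat n M x k i = (\<Sum>j<n. mat_pow n M k j i * x j)"
  using assms(2)
proof (induction k arbitrary: i)
  case (Suc k)
  have "iterate_mat n M x (Suc k) i = (\<Sum>h<n. \<Sum>j<n. mat_pow n M k j h * M h i * x j)"
    using Suc sym by (auto simp: sum_distrib_left mult_ac intro!: sum.cong)
  also have "\<dots> = (\<Sum>j<n. \<Sum>h<n. mat_pow n M k j h * M h i * x j)" by (rule sum.swap)
  finally show ?case by (simp add: sum_distrib_right)
qed (simp add: if_distrib[of "\<lambda>x. x * _"] cong: if_cong)

text \<open>Log-convexity makes the ratios \<open>b (j + 1) / b j\<close> increase, hence
  \<open>(b 1 / b 0) ^ k \<le> b k / b 0\<close>. The product form stays valid when terms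
  vanish.\<close>

lemma log_convex_power_le:
  fixes b :: "nat \<Rightarrow> real"
  assumes nn: "\<And>j. 0 \<le> b j" and lc: "\<And>j. (b (Suc j))\<^sup>2 \<le> b j * b (Suc (Suc j))"
  shows "b 1 ^ k * b 0 \<le> b k * b 0 ^ k"
proof -
  have *: "b 1 * b k \<le> b 0 * b (Suc k)" for k
  proof (induction k)
    case (Suc k)
    show ?case
    proof (cases "b (Suc k) = 0")
      case False
      then have "0 < (b (Suc k))\<^sup>2" by simp
      then have "b k \<noteq> 0" using lc[of k] by auto
      then have pos: "0 < b k" using nn[of k] by simp
      have "b k * (b 1 * b (Suc k)) = (b 1 * b k) * b (Suc k)" by simp
      also have "\<dots> \<le> (b 0 * b (Suc k)) * b (Suc k)" using Suc nn by (intro mult_right_mono) auto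
      also have "\<dots> = b 0 * (b (Suc k))\<^sup>2" by (simp add: power2_eq_square)
      also have "\<dots> \<le> b 0 * (b k * b (Suc (Suc k)))" using lc nn by (intro mult_left_mono) auto
      finally have "b k * (b 1 * b (Suc k)) \<le> b k * (b 0 * b (Suc (Suc k)))" by (simp add: mult_ac)
      then show ?thesis using pos by simp
    qed (use nn in simp)
  qed simp
  show ?thesis
  proof (induction k)
    case (Suc k)
    have "b 1 ^ Suc k * b 0 = b 1 * (b 1 ^ k * b 0)" by simp
    also have "\<dots> \<le> b 1 * (b k * b 0 ^ k)" using Suc nn by (intro mult_left_mono) auto
    also have "\<dots> = (b 1 * b k) * b 0 ^ k" by simp
    also have "\<dots> \<le> (b 0 * b (Suc k)) * b 0 ^ k" using * nn by (intro mult_right_mono) auto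
    finally show ?case by (simp add: mult_ac)
  qed simp
qed

text \<open>For symmetric \<open>M\<close> the numbers \<open>b j = |M^j x|^2\<close> are log-convex
  by Cauchy-Schwarz, which bounds \<open>|M x|^(2 k)\<close> by
  \<open>|M^k x|^2 |x|^(2 k - 2)\<close>. The Frobenius norm of \<open>M^k\<close>, whose square is
  the trace of \<open>M^(2 k)\<close>, bounds the first factor. No eigenvalues enter.\<close>

lemma norm_power_le_trace:
  assumes sym: "\<And>i j. i < n \<Longrightarrow> j < n \<Longrightarrow> M i j = M j i" and k: "0 < k"
  shows "(\<Sum>i<n. (\<Sum>j<n. M i j * x j)\<^sup>2) ^ k \<le> (\<Sum>i<n. mat_pow n M (2 * k) i i) * (\<Sum>i<n. (x i)\<^sup>2) ^ k"
proof -
  define b where "b k = (\<Sum>i<n. (iterate_mat n M x k i)\<^sup>2)" for k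
  have nn: "0 \<le> b k" for k by (simp add: b_def sum_nonneg)
  have "(b (Suc j))\<^sup>2 \<le> b j * b (Suc (Suc j))" for j
  proof -
    let ?v = "iterate_mat n M x"
    have "b (Suc j) = (\<Sum>i<n. \<Sum>h<n. M i h * ?v j h * ?v (Suc j) i)"
      by (simp add: b_def power2_eq_square sum_distrib_right)
    also have "\<dots> = (\<Sum>h<n. \<Sum>i<n. M i h * ?v j h * ?v (Suc j) i)" by (rule sum.swap)
    also have "\<dots> = (\<Sum>h<n. \<Sum>i<n. ?v j h * (M h i * ?v (Suc j) i))"
      using sym by (auto simp: mult_ac intro!: sum.cong)
    also have "\<dots> = (\<Sum>h<n. ?v j h * ?v (Suc (Suc j)) h)" by (simp add: sum_distrib_left)
    finally have "b (Suc j) = (\<Sum>h<n. ?v j h * ?v (Suc (Suc j)) h)" .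
    then show ?thesis unfolding b_def[of j] b_def[of "Suc (Suc j)"]
      using Cauchy_Schwarz_ineq_sum[of "?v j" "?v (Suc (Suc j))" "{..<n}"] by (simp only:)
  qed
  from log_convex_power_le[of b, OF nn this] have 1: "b 1 ^ k * b 0 \<le> b k * b 0 ^ k" .
  have "b k \<le> (\<Sum>i<n. (\<Sum>j<n. (mat_pow n M k j i)\<^sup>2) * (\<Sum>j<n. (x j)\<^sup>2))"
    unfolding b_def by (intro sum_mono) (auto simp: iterate_mat_eq[of n M, OF sym] intro: Cauchy_Schwarz_ineq_sum)
  also have "\<dots> = (\<Sum>i<n. \<Sum>j<n. (mat_pow n M k i j)\<^sup>2) * b 0"
    using mat_pow_sym[of n M, OF sym] by (simp add: b_def flip: sum_distrib_right)
  also have "\<dots> = (\<Sum>i<n. mat_pow n M (2 * k) i i) * b 0" by (simp only: trace_mat_pow_double[of n M, OF sym])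
  finally have 2: "b k \<le> (\<Sum>i<n. mat_pow n M (2 * k) i i) * b 0" .
  have "b 1 ^ k \<le> (\<Sum>i<n. mat_pow n M (2 * k) i i) * b 0 ^ k"
  proof (cases "b 0 = 0")
    case True
    then have "\<forall>i<n. x i = 0" by (simp add: b_def sum_nonneg_eq_0_iff)
    then have "b 1 = 0" by (simp add: b_def)
    then show ?thesis using True k by (simp add: power_0_left)
  next
    case False
    then have pos: "0 < b 0" using nn[of 0] by simp
    have "b 1 ^ k * b 0 \<le> ((\<Sum>i<n. mat_pow n M (2 * k) i i) * b 0) * b 0 ^ k"
      using 1 2 nn[of 0] by (meson mult_right_mono order_trans zero_le_power)
    also have "\<dots> = ((\<Sum>i<n. mat_pow n M (2 * k) i i) * b 0 ^ k) * b 0" by (simp only: mult_ac)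
    finally show ?thesis using pos by simp
  qed
  then show ?thesis by (simp add: b_def)
qed

section \<open>Moments of the symmetrised noise\<close>

lemma expectation_prod_Pi_pmf_real:
  fixes f :: "'a \<Rightarrow> 'b \<Rightarrow> real"
  assumes fin: "finite A" and fs: "\<And>x. x \<in> A \<Longrightarrow> finite (set_pmf (p x))"
  shows "measure_pmf.expectation (Pi_pmf A dflt p) (\<lambda>y. \<Prod>x\<in>A. f x (y x)) =
         (\<Prod>x\<in>A. measure_pmf.expectation (p x) (f x))"
proof -
  have comp: "measure_pmf.expectation (Pi_pmf A dflt p) (\<lambda>y. f x (y x)) = measure_pmf.expectation (p x) (f x)"
    if "x \<in> A" for x
  proof -
    have "measure_pmf.expectation (p x) (f x) =
      measure_pmf.expectation (map_pmf (\<lambda>y. y x) (Pi_pmf A dflt p)) (f x)"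
      using that fin by (simp add: Pi_pmf_component)
    then show ?thesis by simp
  qed
  have int: "integrable (measure_pmf (Pi_pmf A dflt p)) (\<lambda>y. f x (y x))" if "x \<in> A" for x
  proof -
    have "integrable (measure_pmf (map_pmf (\<lambda>y. y x) (Pi_pmf A dflt p))) (f x)"
      using that fin fs by (intro integrable_measure_pmf_finite) (simp add: Pi_pmf_component)
    then show ?thesis by (simp add: integrable_map_pmf_eq)
  qed
  have "prob_space.indep_vars (measure_pmf (Pi_pmf A dflt p)) (\<lambda>_. borel) (\<lambda>x y. f x (y x)) A"
    by (rule prob_space.indep_vars_compose2[OF measure_pmf.prob_space_axioms indep_vars_Pi_pmf[OF fin]]) auto
  then show ?thesis
    using int comp fin by (subst prob_space.indep_vars_lebesgue_integral[OF measure_pmf.prob_space_axioms]) auto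
qed

definition edge_set :: "nat \<Rightarrow> (nat \<times> nat) set" where
  "edge_set n = {(i, j). i < j \<and> j < n}"

lemma finite_edge_set [simp]: "finite (edge_set n)"
  by (rule finite_subset[of _ "{..<n} \<times> {..<n}"]) (auto simp: edge_set_def)

definition random_graph :: "nat \<Rightarrow> (nat \<times> nat \<Rightarrow> real) \<Rightarrow> (nat \<times> nat \<Rightarrow> bool) pmf" where
  "random_graph n \<pi> = Pi_pmf (edge_set n) False (\<lambda>e. bernoulli_pmf (\<pi> e))"

text \<open>Symmetrisation: for an independent copy \<open>E'\<close> of \<open>E\<close>, the
  entries have a symmetric law, so their odd moments vanish.\<close>

definition noise_diff :: "(nat \<times> nat \<Rightarrow> bool) \<Rightarrow> (nat \<times> nat \<Rightarrow> bool) \<Rightarrow> nat \<Rightarrow> nat \<Rightarrow> real" where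
  "noise_diff E E' i j =
     (if i = j then 0 else of_bool (E (min i j, max i j)) - of_bool (E' (min i j, max i j)))"

definition centred_adjacency :: "(nat \<times> nat \<Rightarrow> real) \<Rightarrow> (nat \<times> nat \<Rightarrow> bool) \<Rightarrow> nat \<Rightarrow> nat \<Rightarrow> real" where
  "centred_adjacency \<pi> E i j = (if i = j then 0 else of_bool (E (min i j, max i j)) - \<pi> (min i j, max i j))"

lemma finite_set_random_graph: "finite (set_pmf (random_graph n \<pi>))"
proof -
  have "finite (PiE_dflt (edge_set n) False (set_pmf \<circ> (\<lambda>e. bernoulli_pmf (\<pi> e))))"
    by (intro finite_PiE_dflt) auto
  then show ?thesis
    unfolding random_graph_def using set_Pi_pmf_subset'[OF finite_edge_set] by (rule finite_subset[rotated])
qed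

lemma integrable_random_graph [simp]:
  fixes f :: "_ \<Rightarrow> real" shows "integrable (measure_pmf (random_graph n \<pi>)) f"
  by (intro integrable_measure_pmf_finite finite_set_random_graph)

text \<open>An edge traversed \<open>c\<close> times contributes the \<open>c\<close>-th moment of a
  difference of two independent Bernoulli variables. This is 0 for odd \<open>c\<close>, at most
  \<open>s\<close> for even positive \<open>c\<close>, and 1 for \<open>c = 0\<close>. Only even
  walks survive, each with one factor \<open>s\<close> per distinct edge.\<close>

lemma expectation_walk_le:
  fixes s :: real
  assumes \<pi>: "\<And>e. e \<in> edge_set n \<Longrightarrow> 0 \<le> \<pi> e \<and> \<pi> e \<le> 1 \<and> 2 * \<pi> e * (1 - \<pi> e) \<le> s"
    and s: "0 \<le> s" "s \<le> 1" and w: "w \<in> walks n (2 * k) x" and closed: "w (2 * k) = x"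
  shows "measure_pmf.expectation (random_graph n \<pi>) (\<lambda>E. measure_pmf.expectation (random_graph n \<pi>)
      (\<lambda>E'. \<Prod>t<2 * k. noise_diff E E' (w t) (w (Suc t)))) \<le>
    (64 * (n * s + 2 * real k)) ^ k * (\<Prod>t<2*k. step_weight s n (2 * k) w t)"
    (is "?L \<le> ?R")
proof -
  have R: "0 \<le> ?R" using s by (intro mult_nonneg_nonneg prod_nonneg ballI step_weight_nonneg) auto
  show ?thesis
  proof (cases "\<exists>t<2 * k. w t = w (Suc t)")
    case True
    then have "(\<Prod>t<2 * k. noise_diff E E' (w t) (w (Suc t))) = 0" for E E'
      by (intro prod_zero) (auto simp: noise_diff_def)
    then have "?L = 0" by (simp only: Bochner_Integration.integral_zero)
    then show ?thesis using R by (simp only:)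
  next
    case False
    then have loopless: "\<And>t. t < 2 * k \<Longrightarrow> w t \<noteq> w (Suc t)" by auto
    define c where "c e = traversals w (2 * k) e" for e
    define h where "h e = measure_pmf.expectation (bernoulli_pmf (\<pi> e)) (\<lambda>b.
        measure_pmf.expectation (bernoulli_pmf (\<pi> e)) (\<lambda>b'. (of_bool b - of_bool b' :: real) ^ c e))" for e
    have U: "step_edge w t \<in> edge_set n" if "t < 2 * k" for t
    proof -
      have "w t < n" "w (Suc t) < n" using w that by (auto simp: walks_def)
      then show ?thesis using loopless[OF that] by (auto simp: step_edge_def edge_set_def min_def max_def)
    qed
    have prod: "(\<Prod>t<2 * k. noise_diff E E' (w t) (w (Suc t))) =
        (\<Prod>e\<in>edge_set n. (of_bool (E e) - of_bool (E' e)) ^ c e)" for E E'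
    proof -
      have "(\<Prod>t<2 * k. noise_diff E E' (w t) (w (Suc t))) =
          (\<Prod>t<2 * k. of_bool (E (step_edge w t)) - of_bool (E' (step_edge w t)))"
        using loopless by (intro prod.cong refl) (auto simp: noise_diff_def step_edge_def)
      also have "\<dots> = (\<Prod>e\<in>edge_set n. \<Prod>t\<in>{t \<in> {..<2 * k}. step_edge w t = e}.
          of_bool (E (step_edge w t)) - of_bool (E' (step_edge w t)))"
        by (rule prod.group[symmetric]) (use U in auto)
      also have "\<dots> = (\<Prod>e\<in>edge_set n. \<Prod>t\<in>{t \<in> {..<2 * k}. step_edge w t = e}.
          of_bool (E e) - of_bool (E' e))"
        by (intro prod.cong refl) auto
      also have "\<dots> = (\<Prod>e\<in>edge_set n. (of_bool (E e) - of_bool (E' e)) ^ c e)"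
        by (simp add: c_def traversals_def)
      finally show ?thesis .
    qed
    \<comment> \<open>Independence is used twice: over \<open>E'\<close> with \<open>E\<close>
      fixed, then over \<open>E\<close>.\<close>
    have L: "?L = (\<Prod>e\<in>edge_set n. h e)"
      unfolding prod random_graph_def h_def
      by (subst expectation_prod_Pi_pmf_real[where f = "\<lambda>e b'. (of_bool (E e) - of_bool b') ^ c e" for E], simp, simp)
         (rule expectation_prod_Pi_pmf_real[where f = "\<lambda>e b. measure_pmf.expectation (bernoulli_pmf (\<pi> e)) (\<lambda>b'. (of_bool b - of_bool b' :: real) ^ c e)"], auto)
    \<comment> \<open>The four joint outcomes of the two bits. Equal bits contribute
      \<open>0 ^ c e\<close>, which is 1 when \<open>c e = 0\<close>.\<close>
    have h: "h e = \<pi> e * (\<pi> e * 0 ^ c e + (1 - \<pi> e)) + (1 - \<pi> e) * (\<pi> e * (- 1) ^ c e + (1 - \<pi> e) * 0 ^ c e)"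
      if "e \<in> edge_set n" for e
      unfolding h_def using \<pi>[OF that] by (simp add: algebra_simps)
    show ?thesis
    proof (cases "\<forall>e. even (c e)")
      case True
      have "(\<Prod>e\<in>edge_set n. h e) \<le> (\<Prod>e\<in>edge_set n. if c e \<noteq> 0 then s else 1)"
      proof (intro prod_mono)
        fix e assume e: "e \<in> edge_set n"
        show "0 \<le> h e \<and> h e \<le> (if c e \<noteq> 0 then s else 1)"
        proof (cases "c e = 0")
          case c0: False
          then have pw: "(- 1 :: real) ^ c e = 1" "(0 :: real) ^ c e = 0" using True[rule_format, of e] by auto
          have "h e = 2 * \<pi> e * (1 - \<pi> e)" unfolding h[OF e] pw by (simp add: algebra_simps)
          then show ?thesis using \<pi>[OF e] c0 by simp
        next
          case c0: True
          then have pw: "(- 1 :: real) ^ c e = 1" "(0 :: real) ^ c e = 1" by auto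
          have "h e = 1" unfolding h[OF e] pw by (simp add: algebra_simps)
          then show ?thesis using c0 by simp
        qed
      qed
      also have "\<dots> = s ^ card {e \<in> edge_set n. c e \<noteq> 0}"
        using prod.inter_filter[of "edge_set n" "\<lambda>_. s" "\<lambda>e. c e \<noteq> 0"] by simp
      also have "{e \<in> edge_set n. c e \<noteq> 0} = step_edge w ` {..<2 * k}"
      proof -
        have "c e \<noteq> 0 \<longleftrightarrow> e \<in> step_edge w ` {..<2 * k}" for e
          unfolding c_def traversals_def card_eq_0_iff by (auto simp only: image_iff finite_Collect_less_nat
              finite_Collect_conjI lessThan_iff mem_Collect_eq set_eq_iff empty_iff bex_simps simp_thms)
        then show ?thesis using U by auto
      qed
      also have "s ^ card (step_edge w ` {..<2 * k}) \<le> ?R"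
        by (rule even_closed_walk_weight[OF s w closed loopless]) (use True in \<open>auto simp: c_def\<close>)
      finally show ?thesis unfolding L .
    next
      case False
      then obtain e where e: "odd (c e)" by auto
      then have "{s. s < 2 * k \<and> step_edge w s = e} \<noteq> {}"
        unfolding c_def traversals_def by (intro notI) simp
      then have eU: "e \<in> edge_set n" using U by auto
      have "c e \<noteq> 0" using e by (intro notI) simp
      then have pw: "(- 1 :: real) ^ c e = - 1" "(0 :: real) ^ c e = 0" using e by auto
      have "h e = 0" unfolding h[OF eU] pw by (simp add: algebra_simps)
      then have "(\<Prod>e\<in>edge_set n. h e) = 0" using eU by (intro prod_zero) auto
      then show ?thesis unfolding L using R by (simp only:)
    qed
  qed
qed

text \<open>The trace is a sum over closed walks. Once each is bounded by its nonnegative weight,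
  the sum may run over all walks from \<open>x\<close>, whose total mass is at most 1; the
  \<open>n\<close> starting points give the factor \<open>n\<close>.\<close>

lemma expectation_trace_le:
  fixes s :: real
  assumes \<pi>: "\<And>e. e \<in> edge_set n \<Longrightarrow> 0 \<le> \<pi> e \<and> \<pi> e \<le> 1 \<and> 2 * \<pi> e * (1 - \<pi> e) \<le> s"
    and s: "0 \<le> s" "s \<le> 1"
  shows "measure_pmf.expectation (random_graph n \<pi>) (\<lambda>E. measure_pmf.expectation (random_graph n \<pi>)
      (\<lambda>E'. \<Sum>x<n. mat_pow n (noise_diff E E') (2 * k) x x)) \<le> n * (64 * (n * s + 2 * real k)) ^ k"
proof -
  let ?P = "random_graph n \<pi>"
  let ?F = "\<lambda>x w. measure_pmf.expectation ?P (\<lambda>E. measure_pmf.expectation ?P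
      (\<lambda>E'. \<Prod>t<2 * k. noise_diff E E' (w t) (w (Suc t))))"
  let ?W = "\<lambda>x. {w \<in> walks n (2 * k) x. w (2 * k) = x}"
  have "(\<Sum>x<n. mat_pow n (noise_diff E E') (2 * k) x x) =
      (\<Sum>x<n. \<Sum>w\<in>?W x. \<Prod>t<2 * k. noise_diff E E' (w t) (w (Suc t)))" for E E'
    by (intro sum.cong refl) (simp add: mat_pow_eq_sum_walks sum.inter_filter)
  then have "measure_pmf.expectation ?P (\<lambda>E. measure_pmf.expectation ?P
      (\<lambda>E'. \<Sum>x<n. mat_pow n (noise_diff E E') (2 * k) x x)) = (\<Sum>x<n. \<Sum>w\<in>?W x. ?F x w)"
    by simp
  also have "\<dots> \<le> (\<Sum>x<n. \<Sum>w\<in>?W x. (64 * (n * s + 2 * real k)) ^ k * (\<Prod>t<2*k. step_weight s n (2 * k) w t))"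
    by (intro sum_mono) (rule expectation_walk_le[OF \<pi> s], auto)
  also have "\<dots> \<le> (\<Sum>x<n. \<Sum>w\<in>walks n (2 * k) x. (64 * (n * s + 2 * real k)) ^ k * (\<Prod>t<2*k. step_weight s n (2 * k) w t))"
    using s by (intro sum_mono sum_mono2 mult_nonneg_nonneg prod_nonneg ballI step_weight_nonneg) auto
  also have "\<dots> = (\<Sum>x<n. (64 * (n * s + 2 * real k)) ^ k * (\<Sum>w\<in>walks n (2 * k) x. \<Prod>t<2*k. step_weight s n (2 * k) w t))"
    by (simp add: sum_distrib_left)
  also have "\<dots> \<le> (\<Sum>x<n. (64 * (n * s + 2 * real k)) ^ k * 1)"
    using s by (intro sum_mono mult_left_mono sum_walks_step_weight_le_1) auto
  finally show ?thesis by simp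
qed

section \<open>From expected traces to the operator norm\<close>

lemma expectation_noise_diff:
  assumes \<pi>: "\<And>e. e \<in> edge_set n \<Longrightarrow> 0 \<le> \<pi> e \<and> \<pi> e \<le> 1" and ij: "i < n" "j < n"
  shows "measure_pmf.expectation (random_graph n \<pi>) (\<lambda>E'. noise_diff E E' i j) = centred_adjacency \<pi> E i j"
proof (cases "i = j")
  case False
  let ?e = "(min i j, max i j)"
  have e: "?e \<in> edge_set n" using False ij by (auto simp: edge_set_def min_def max_def)
  have "measure_pmf.expectation (random_graph n \<pi>) (\<lambda>E'. of_bool (E' ?e)) =
      measure_pmf.expectation (map_pmf (\<lambda>E'. E' ?e) (random_graph n \<pi>)) (of_bool :: bool \<Rightarrow> real)" by simp
  also have "map_pmf (\<lambda>E'. E' ?e) (random_graph n \<pi>) = bernoulli_pmf (\<pi> ?e)"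
    unfolding random_graph_def using e by (subst Pi_pmf_component) auto
  also have "measure_pmf.expectation \<dots> (of_bool :: bool \<Rightarrow> real) = \<pi> ?e" using \<pi>[OF e] by simp
  finally show ?thesis using False by (simp add: noise_diff_def centred_adjacency_def)
qed (simp add: noise_diff_def centred_adjacency_def)

text \<open>Jensen's inequality for the Euclidean norm: pair the mean vector with itself, move one
  copy inside the expectation and apply Cauchy-Schwarz.\<close>

lemma norm_expectation_le:
  fixes f :: "_ \<Rightarrow> nat \<Rightarrow> real"
  shows "L2_set (\<lambda>i. measure_pmf.expectation (random_graph n \<pi>) (\<lambda>E. f E i)) A \<le>
         measure_pmf.expectation (random_graph n \<pi>) (\<lambda>E. L2_set (f E) A)"
proof -
  let ?P = "random_graph n \<pi>"
  define m where "m i = measure_pmf.expectation ?P (\<lambda>E. f E i)" for i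
  have "L2_set m A * L2_set m A = (\<Sum>i\<in>A. m i * m i)"
    by (simp add: L2_set_def sum_nonneg flip: power2_eq_square)
  also have "\<dots> = measure_pmf.expectation ?P (\<lambda>E. \<Sum>i\<in>A. m i * f E i)"
    by (simp add: m_def)
  also have "\<dots> \<le> measure_pmf.expectation ?P (\<lambda>E. L2_set m A * L2_set (f E) A)"
  proof (intro integral_mono integrable_random_graph)
    fix E
    have "(\<Sum>i\<in>A. m i * f E i) \<le> (\<Sum>i\<in>A. \<bar>m i\<bar> * \<bar>f E i\<bar>)"
      by (intro sum_mono) (simp add: abs_le_D1 flip: abs_mult)
    also have "\<dots> \<le> L2_set m A * L2_set (f E) A" by (rule L2_set_mult_ineq)
    finally show "(\<Sum>i\<in>A. m i * f E i) \<le> L2_set m A * L2_set (f E) A" .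
  qed
  also have "\<dots> = L2_set m A * measure_pmf.expectation ?P (\<lambda>E. L2_set (f E) A)" by simp
  finally have *: "L2_set m A * L2_set m A \<le> L2_set m A * measure_pmf.expectation ?P (\<lambda>E. L2_set (f E) A)" .
  have "L2_set m A \<le> measure_pmf.expectation ?P (\<lambda>E. L2_set (f E) A)"
  proof (cases "L2_set m A = 0")
    case True
    then show ?thesis by (simp add: Bochner_Integration.integral_nonneg)
  next
    case False
    then have "0 < L2_set m A" using L2_set_nonneg[of m A] by linarith
    then show ?thesis using * by simp
  qed
  then show ?thesis by (simp add: m_def[abs_def])
qed

text \<open>The centred matrix is the mean of \<open>noise_diff E E'\<close> over \<open>E'\<close>,
  so by Jensen its norm is at most the mean norm. The trace method bounds the latter, and Markov's
  inequality concludes.\<close>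

lemma prob_operator_norm:
  fixes s :: real
  assumes \<pi>: "\<And>e. e \<in> edge_set n \<Longrightarrow> 0 \<le> \<pi> e \<and> \<pi> e \<le> 1 \<and> 2 * \<pi> e * (1 - \<pi> e) \<le> s"
    and s: "0 \<le> s" "s \<le> 1" and k: "0 < k" and \<tau>: "0 < \<tau>" "n * (64 * (n * s + 2 * real k)) ^ k \<le> \<tau> ^ (2 * k)"
    and t: "0 < t"
  shows "measure_pmf.prob (random_graph n \<pi>)
    {E. \<not> (\<forall>x. (\<Sum>i<n. (\<Sum>j<n. centred_adjacency \<pi> E i j * x j)\<^sup>2) \<le> t\<^sup>2 * (\<Sum>i<n. (x i)\<^sup>2))} \<le> 2 * \<tau> / t"
proof -
  let ?P = "random_graph n \<pi>"
  define T where "T E E' = (\<Sum>x<n. mat_pow n (noise_diff E E') (2 * k) x x)" for E E'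
  \<comment> \<open>A norm \<open>q \<tau>\<close> satisfies \<open>q \<le> 1 + q ^ (2 * k)\<close>,
    which makes the trace bound linear without taking roots. Since \<open>g\<close> does not involve
    the test vector, a single use of Markov's inequality covers all vectors.\<close>
  define g where "g E = measure_pmf.expectation ?P (\<lambda>E'. \<tau> * (1 + T E E' / \<tau> ^ (2 * k)))" for E
  have sym: "noise_diff E E' i j = noise_diff E E' j i" for E E' i j
    by (auto simp: noise_diff_def min_def max_def)
  have T0: "0 \<le> T E E'" for E E'
    unfolding T_def using trace_mat_pow_double[of n "noise_diff E E'" k] sym by (simp add: sum_nonneg)
  have g0: "0 \<le> g E" for E
    unfolding g_def using T0 \<tau> by (intro Bochner_Integration.integral_nonneg) auto
  have gE: "measure_pmf.expectation ?P g \<le> 2 * \<tau>"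
  proof -
    have "measure_pmf.expectation ?P (\<lambda>E. measure_pmf.expectation ?P (T E)) \<le> n * (64 * (n * s + 2 * real k)) ^ k"
      unfolding T_def by (rule expectation_trace_le[OF \<pi> s])
    also have "\<dots> \<le> \<tau> ^ (2 * k)" by (rule \<tau>)
    finally have 1: "measure_pmf.expectation ?P (\<lambda>E. measure_pmf.expectation ?P (T E)) / \<tau> ^ (2 * k) \<le> 1"
      using \<tau> by simp
    have "measure_pmf.expectation ?P g =
       \<tau> * (1 + measure_pmf.expectation ?P (\<lambda>E. measure_pmf.expectation ?P (T E)) / \<tau> ^ (2 * k))"
      unfolding g_def by simp
    also have "\<dots> \<le> \<tau> * 2" using 1 \<tau> by (intro mult_left_mono) auto
    finally show ?thesis by simp
  qed
  have bound: "L2_set (\<lambda>i. \<Sum>j<n. centred_adjacency \<pi> E i j * x j) {..<n} \<le> g E * L2_set x {..<n}" for E x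
  proof -
    have one: "L2_set (\<lambda>i. \<Sum>j<n. noise_diff E E' i j * x j) {..<n} \<le>
        \<tau> * (1 + T E E' / \<tau> ^ (2 * k)) * L2_set x {..<n}" for E'
    proof -
      define a where "a = L2_set (\<lambda>i. \<Sum>j<n. noise_diff E E' i j * x j) {..<n}"
      define b where "b = L2_set x {..<n}"
      have a: "a\<^sup>2 = (\<Sum>i<n. (\<Sum>j<n. noise_diff E E' i j * x j)\<^sup>2)" and b: "b\<^sup>2 = (\<Sum>i<n. (x i)\<^sup>2)"
        by (auto simp: a_def b_def L2_set_def sum_nonneg)
      have ab0: "0 \<le> a" "0 \<le> b" by (auto simp: a_def b_def)
      have ab: "a ^ (2 * k) \<le> T E E' * b ^ (2 * k)"
        using norm_power_le_trace[of n "noise_diff E E'" k x] k sym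
        unfolding power_mult a b T_def by simp
      show ?thesis
      proof (cases "a \<le> \<tau> * b")
        case True
        have "0 \<le> \<tau> * (T E E' / \<tau> ^ (2 * k)) * b" using T0 \<tau> ab0 by simp
        then show ?thesis using True unfolding a_def[symmetric] b_def[symmetric] by (simp add: algebra_simps)
      next
        case False
        have b0: "0 < b"
        proof (rule ccontr)
          assume "\<not> 0 < b"
          then have "b = 0" using ab0 by simp
          then have "a ^ (2 * k) \<le> 0" using ab k by (simp add: power_0_left)
          then have "a = 0" using ab0 k by (metis power_eq_0_iff zero_le_power order_antisym)
          then show False using False \<open>b = 0\<close> by simp
        qed
        define q where "q = a / (\<tau> * b)"
        have q1: "1 \<le> q" using False b0 \<tau> by (simp add: q_def)
        have "q \<le> q ^ (2 * k)" using q1 k by (intro self_le_power) auto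
        also have "\<dots> = a ^ (2 * k) / (\<tau> ^ (2 * k) * b ^ (2 * k))" by (simp add: q_def power_divide power_mult_distrib)
        also have "\<dots> \<le> T E E' * b ^ (2 * k) / (\<tau> ^ (2 * k) * b ^ (2 * k))"
          using ab b0 \<tau> by (intro divide_right_mono) auto
        also have "\<dots> = T E E' / \<tau> ^ (2 * k)" using b0 by simp
        finally have "q * (\<tau> * b) \<le> (1 + T E E' / \<tau> ^ (2 * k)) * (\<tau> * b)"
          using b0 \<tau> by (intro mult_right_mono) auto
        moreover have "q * (\<tau> * b) = a" using b0 \<tau> by (simp add: q_def)
        ultimately show ?thesis unfolding a_def[symmetric] b_def[symmetric] by (simp add: mult_ac)
      qed
    qed
    have "L2_set (\<lambda>i. \<Sum>j<n. centred_adjacency \<pi> E i j * x j) {..<n} =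
       L2_set (\<lambda>i. measure_pmf.expectation ?P (\<lambda>E'. \<Sum>j<n. noise_diff E E' i j * x j)) {..<n}"
      using \<pi> by (intro L2_set_cong refl) (auto simp: expectation_noise_diff intro!: sum.cong)
    also have "\<dots> \<le> measure_pmf.expectation ?P (\<lambda>E'. L2_set (\<lambda>i. \<Sum>j<n. noise_diff E E' i j * x j) {..<n})"
      by (rule norm_expectation_le)
    also have "\<dots> \<le> measure_pmf.expectation ?P (\<lambda>E'. \<tau> * (1 + T E E' / \<tau> ^ (2 * k)) * L2_set x {..<n})"
      by (intro integral_mono integrable_random_graph one)
    also have "\<dots> = g E * L2_set x {..<n}" unfolding g_def by (rule integral_mult_left_zero)
    finally show ?thesis .
  qed
  have "{E. \<not> (\<forall>x. (\<Sum>i<n. (\<Sum>j<n. centred_adjacency \<pi> E i j * x j)\<^sup>2) \<le> t\<^sup>2 * (\<Sum>i<n. (x i)\<^sup>2))} \<subseteq> {E. t \<le> g E}"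
  proof (rule subsetI, rule ccontr)
    fix E assume "E \<in> {E. \<not> (\<forall>x. (\<Sum>i<n. (\<Sum>j<n. centred_adjacency \<pi> E i j * x j)\<^sup>2) \<le> t\<^sup>2 * (\<Sum>i<n. (x i)\<^sup>2))}"
    then obtain x where x: "\<not> (\<Sum>i<n. (\<Sum>j<n. centred_adjacency \<pi> E i j * x j)\<^sup>2) \<le> t\<^sup>2 * (\<Sum>i<n. (x i)\<^sup>2)" by auto
    assume "E \<notin> {E. t \<le> g E}"
    then have "g E * L2_set x {..<n} \<le> t * L2_set x {..<n}" by (intro mult_right_mono) auto
    then have "(L2_set (\<lambda>i. \<Sum>j<n. centred_adjacency \<pi> E i j * x j) {..<n})\<^sup>2 \<le> (t * L2_set x {..<n})\<^sup>2"
      using bound[of E x] by (intro power_mono) auto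
    then show False using x by (simp add: L2_set_def sum_nonneg power_mult_distrib)
  qed
  then have "measure_pmf.prob ?P {E. \<not> (\<forall>x. (\<Sum>i<n. (\<Sum>j<n. centred_adjacency \<pi> E i j * x j)\<^sup>2) \<le> t\<^sup>2 * (\<Sum>i<n. (x i)\<^sup>2))}
      \<le> measure_pmf.prob ?P {E. t \<le> g E}"
    by (intro measure_pmf.finite_measure_mono) auto
  also have "\<dots> \<le> measure_pmf.expectation ?P g / t"
    using integral_Markov_inequality_measure[of "measure_pmf ?P" g "{}" t] g0 t by simp
  also have "\<dots> \<le> 2 * \<tau> / t" using gE t by (intro divide_right_mono) auto
  finally show ?thesis .
qed

section \<open>Degree gaps in the stochastic block model\<close>

definition sbm_prob :: "(nat \<Rightarrow> real) \<Rightarrow> real \<Rightarrow> real \<Rightarrow> nat \<times> nat \<Rightarrow> real" where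
  "sbm_prob z p q e = (if z (fst e) = z (snd e) then p else q)"

text \<open>The number of neighbours of \<open>i\<close> in its own community minus the number in
  the other one; this is the row sum of the sign-conjugated adjacency matrix.\<close>

definition degree_gap :: "nat \<Rightarrow> (nat \<Rightarrow> real) \<Rightarrow> (nat \<times> nat \<Rightarrow> bool) \<Rightarrow> nat \<Rightarrow> real" where
  "degree_gap n z E i = (\<Sum>j\<in>{..<n} - {i}. z i * z j * of_bool (E (min i j, max i j)))"

text \<open>Independence leaves one factor \<open>1 + R j \<le> exp (R j)\<close> for each
  \<open>j \<noteq> i\<close>. By balance the \<open>R j\<close>, with \<open>j = i\<close>
  included, sum to \<open>n / 2 * (P + Q)\<close>. Removing the absent term
  \<open>R i = P \<ge> - 1\<close> costs at most the factor \<open>exp 1\<close>.\<close>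

lemma expectation_exp_degree_gap_le:
  assumes z: "\<And>i. i < n \<Longrightarrow> z i \<in> {-1, 1}" and bal: "(\<Sum>i<n. z i) = 0"
    and pq: "0 \<le> q" "q \<le> p" "p \<le> 1" and i: "i < n"
  shows "measure_pmf.expectation (random_graph n (sbm_prob z p q)) (\<lambda>E. exp (- t * degree_gap n z E i)) \<le>
    exp (1 + n / 2 * (p * (exp (- t) - 1) + q * (exp t - 1)))"
proof -
  let ?e = "\<lambda>j. (min i j, max i j)"
  \<comment> \<open>Edges away from \<open>i\<close> receive the factor 1, so the product can run
    over all independent edges.\<close>
  define f where "f e b = (if fst e = i \<or> snd e = i then exp (- t * z (fst e) * z (snd e) * of_bool b) else 1)"
    for e :: "nat \<times> nat" and b :: bool
  define h where "h e = measure_pmf.expectation (bernoulli_pmf (sbm_prob z p q e)) (f e)" for e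
  define P where "P = p * (exp (- t) - 1)"
  define Q where "Q = q * (exp t - 1)"
  \<comment> \<open>The choice between \<open>P\<close> and \<open>Q\<close> is written affinely in
    \<open>z j\<close>, so that the sum over \<open>j\<close> only sees the sum of the
    signs.\<close>
  define R where "R j = (1 + z i * z j) / 2 * P + (1 - z i * z j) / 2 * Q" for j
  have inc: "{e \<in> edge_set n. fst e = i \<or> snd e = i} = ?e ` ({..<n} - {i})" (is "?I = _")
  proof (intro equalityI subsetI)
    fix e assume "e \<in> ?I"
    then obtain a b where e: "e = (a, b)" "a < b" "b < n" "a = i \<or> b = i" by (auto simp: edge_set_def)
    then show "e \<in> ?e ` ({..<n} - {i})"
      by (intro image_eqI[of _ _ "if a = i then b else a"]) auto
  next
    fix e assume "e \<in> ?e ` ({..<n} - {i})"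
    then obtain j where "j < n" "j \<noteq> i" "e = ?e j" by auto
    then show "e \<in> ?I" using i by (cases "i \<le> j") (auto simp: edge_set_def)
  qed
  have inj: "inj_on ?e ({..<n} - {i})" by (auto simp: inj_on_def min_def max_def split: if_splits)
  have reindex: "(\<Prod>e\<in>edge_set n. g e) = (\<Prod>j\<in>{..<n} - {i}. g (?e j))"
    if "\<And>e. \<not> (fst e = i \<or> snd e = i) \<Longrightarrow> g e = 1" for g :: "nat \<times> nat \<Rightarrow> real"
  proof -
    have "(\<Prod>e\<in>edge_set n. g e) = (\<Prod>e\<in>?I. g e)"
      by (rule prod.mono_neutral_right) (use that in auto)
    also have "\<dots> = (\<Prod>j\<in>{..<n} - {i}. g (?e j))" unfolding inc by (simp add: prod.reindex[OF inj])
    finally show ?thesis .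
  qed
  have "exp (- t * degree_gap n z E i) = (\<Prod>e\<in>edge_set n. f e (E e))" for E
  proof -
    have "exp (- t * degree_gap n z E i) = (\<Prod>j\<in>{..<n} - {i}. exp (- t * (z i * z j * of_bool (E (?e j)))))"
      unfolding degree_gap_def sum_distrib_left by (rule exp_sum) simp
    also have "\<dots> = (\<Prod>j\<in>{..<n} - {i}. f (?e j) (E (?e j)))"
      by (intro prod.cong refl) (auto simp: f_def min_def max_def)
    also have "\<dots> = (\<Prod>e\<in>edge_set n. f e (E e))" by (subst reindex) (auto simp: f_def)
    finally show ?thesis .
  qed
  then have "measure_pmf.expectation (random_graph n (sbm_prob z p q)) (\<lambda>E. exp (- t * degree_gap n z E i)) =
      (\<Prod>e\<in>edge_set n. h e)"
    unfolding random_graph_def h_def by (simp add: expectation_prod_Pi_pmf_real)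
  also have "\<dots> = (\<Prod>j\<in>{..<n} - {i}. h (?e j))"
    by (rule reindex) (simp add: h_def f_def[abs_def])
  also have "\<dots> \<le> (\<Prod>j\<in>{..<n} - {i}. exp (R j))"
  proof (intro prod_mono)
    fix j assume j: "j \<in> {..<n} - {i}"
    have zz: "z i \<in> {-1, 1}" "z j \<in> {-1, 1}" using z[of i] z[of j] i j by auto
    have pi: "sbm_prob z p q (?e j) = (if z i = z j then p else q)" by (auto simp: sbm_prob_def min_def max_def)
    then have pi01: "0 \<le> sbm_prob z p q (?e j)" "sbm_prob z p q (?e j) \<le> 1" using pq by auto
    have "f (?e j) b = exp (- t * (z i * z j) * of_bool b)" for b
      by (auto simp: f_def min_def max_def mult_ac)
    then have h: "h (?e j) = 1 + sbm_prob z p q (?e j) * (exp (- t * (z i * z j)) - 1)"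
      unfolding h_def using pi01 by (simp add: algebra_simps)
    also have "\<dots> = 1 + R j" unfolding pi using zz by (auto simp: R_def P_def Q_def)
    finally have "h (?e j) = 1 + R j" .
    moreover have "0 \<le> h (?e j)" unfolding h_def f_def by (intro Bochner_Integration.integral_nonneg) auto
    ultimately show "0 \<le> h (?e j) \<and> h (?e j) \<le> exp (R j)" using exp_ge_add_one_self[of "R j"] by simp
  qed
  also have "\<dots> = exp (\<Sum>j\<in>{..<n} - {i}. R j)" by (simp add: exp_sum)
  also have "(\<Sum>j\<in>{..<n} - {i}. R j) = (\<Sum>j<n. R j) - R i" using i by (subst sum_diff1) auto
  also have "(\<Sum>j<n. R j) = n / 2 * (P + Q)"
  proof -
    have "(\<Sum>j<n. R j) = (\<Sum>j<n. (P + Q) / 2 + z j * (z i * (P - Q) / 2))"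
      by (intro sum.cong refl) (simp add: R_def field_simps)
    also have "\<dots> = n * ((P + Q) / 2) + (\<Sum>j<n. z j) * (z i * (P - Q) / 2)"
      by (simp only: sum.distrib sum_distrib_right) simp
    finally show ?thesis by (simp add: bal)
  qed
  also have "exp (n / 2 * (P + Q) - R i) \<le> exp (1 + n / 2 * (P + Q))"
  proof -
    have "R i = P" using z[OF i] by (auto simp: R_def)
    moreover have "- 1 \<le> P"
    proof -
      have "0 \<le> p * exp (- t)" using pq by simp
      moreover have "P = p * exp (- t) - p" by (simp add: P_def algebra_simps)
      ultimately show ?thesis using pq by linarith
    qed
    ultimately show ?thesis by simp
  qed
  finally show ?thesis by (simp add: P_def Q_def)
qed

text \<open>This is \<open>t \<le> sinh t\<close>: the derivative of the difference is the square of
  \<open>exp (x / 2) - exp (- x / 2)\<close>.\<close>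

lemma two_mult_le_exp_diff:
  fixes t :: real
  assumes "0 \<le> t"
  shows "2 * t \<le> exp t - exp (- t)"
proof -
  have "(\<lambda>t. exp t - exp (- t) - 2 * t) 0 \<le> (\<lambda>t. exp t - exp (- t) - 2 * t) t"
  proof (rule DERIV_nonneg_imp_nondecreasing[OF assms])
    fix x :: real
    have "0 \<le> (exp (x / 2) - exp (- x / 2))\<^sup>2" by simp
    also have "\<dots> = exp x + exp (- x) - 2"
      by (simp add: power2_diff flip: exp_add) (simp add: power2_eq_square flip: exp_add)
    finally have "0 \<le> exp x + exp (- x) - 2" .
    moreover have "((\<lambda>t. exp t - exp (- t) - 2 * t) has_real_derivative exp x + exp (- x) - 2) (at x)"
      by (auto intro!: derivative_eq_intros)
    ultimately show "\<exists>y. ((\<lambda>t. exp t - exp (- t) - 2 * t) has_real_derivative y) (at x) \<and> 0 \<le> y" by blast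
  qed
  then show ?thesis by simp
qed

text \<open>A Chernoff bound in which the margin is absorbed into the two probabilities, giving
  \<open>p'\<close> and \<open>q'\<close>, before the exponent is optimised.\<close>

lemma prob_degree_gap_le:
  assumes z: "\<And>i. i < n \<Longrightarrow> z i \<in> {-1, 1}" and bal: "(\<Sum>i<n. z i) = 0"
    and pq: "0 \<le> q" "q \<le> p" "p \<le> 1" "0 < p" and \<theta>: "0 < \<theta>" "\<theta> \<le> 1 / 2" and i: "i < n"
  shows "measure_pmf.prob (random_graph n (sbm_prob z p q)) {E. degree_gap n z E i \<le> \<theta> * (n * (p - q))} \<le>
    exp (1 - n / 2 * (sqrt ((1 - \<theta>) * p + \<theta> * q) - sqrt ((1 - \<theta>) * q + \<theta> * p))\<^sup>2)"
proof -
  let ?P = "random_graph n (sbm_prob z p q)"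
  define p' where "p' = (1 - \<theta>) * p + \<theta> * q"
  define q' where "q' = (1 - \<theta>) * q + \<theta> * p"
  \<comment> \<open>A positive margin keeps \<open>q'\<close> positive even for
    \<open>q = 0\<close>, so the optimal \<open>t\<close> is finite.\<close>
  have "0 < \<theta> * p" "0 \<le> (1 - \<theta>) * q" using \<theta> pq by auto
  then have q'0: "0 < q'" by (simp add: q'_def)
  have "p' - q' = (1 - 2 * \<theta>) * (p - q)" by (simp add: p'_def q'_def algebra_simps)
  moreover have "0 \<le> (1 - 2 * \<theta>) * (p - q)" using \<theta> pq by simp
  ultimately have q'p': "q' \<le> p'" by linarith
  then have p'0: "0 < p'" using q'0 by linarith
  define a where "a = sqrt p'"
  define b where "b = sqrt q'"
  have ab: "0 < a" "0 < b" "b \<le> a" and a2: "a * a = p'" and b2: "b * b = q'"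
    using q'0 p'0 q'p' by (auto simp: a_def b_def)
  \<comment> \<open>This \<open>t\<close> minimises \<open>p' exp (- t) + q' exp t\<close>; the
    exponent becomes \<open>2 a b - a^2 - b^2\<close>.\<close>
  define t where "t = ln (a / b)"
  have t0: "0 \<le> t" using ab by (simp add: t_def)
  have et: "exp t = a / b" and emt: "exp (- t) = b / a" using ab by (auto simp: t_def exp_minus)
  have "measure_pmf.prob ?P {E. degree_gap n z E i \<le> \<theta> * (n * (p - q))} \<le>
      measure_pmf.prob ?P {E. exp (- t * (\<theta> * (n * (p - q)))) \<le> exp (- t * degree_gap n z E i)}"
    using t0 by (intro measure_pmf.finite_measure_mono) (auto intro: mult_left_mono)
  also have "\<dots> \<le> measure_pmf.expectation ?P (\<lambda>E. exp (- t * degree_gap n z E i)) / exp (- t * (\<theta> * (n * (p - q))))"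
    using integral_Markov_inequality_measure[of "measure_pmf ?P" "\<lambda>E. exp (- t * degree_gap n z E i)" "{}"
        "exp (- t * (\<theta> * (n * (p - q))))"] by simp
  also have "\<dots> \<le> exp (1 + n / 2 * (p * (exp (- t) - 1) + q * (exp t - 1))) / exp (- t * (\<theta> * (n * (p - q))))"
    by (intro divide_right_mono expectation_exp_degree_gap_le z bal pq i) auto
  also have "\<dots> = exp (1 + n / 2 * (p * (exp (- t) - 1) + q * (exp t - 1) + \<theta> * (p - q) * (2 * t)))"
    by (simp add: algebra_simps flip: exp_diff)
  also have "\<dots> \<le> exp (1 + n / 2 * (p * (exp (- t) - 1) + q * (exp t - 1) + \<theta> * (p - q) * (exp t - exp (- t))))"
    using two_mult_le_exp_diff[OF t0] \<theta> pq by (simp add: mult_left_mono)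
  also have "p * (exp (- t) - 1) + q * (exp t - 1) + \<theta> * (p - q) * (exp t - exp (- t)) =
     p' * (exp (- t) - 1) + q' * (exp t - 1)"
    by (simp add: p'_def q'_def algebra_simps)
  also have "\<dots> = - (a - b)\<^sup>2"
    unfolding et emt a2[symmetric] b2[symmetric] using ab by (simp add: power2_eq_square field_simps)
  finally show ?thesis by (simp add: a_def b_def p'_def q'_def)
qed

text \<open>With \<open>T\<close> the difference and \<open>S\<close> the sum of the two roots at
  parameter \<open>x\<close>, \<open>T S = (1 - 2 x) (p - q)\<close>, while
  \<open>S^2 = p + q + 2 sqrt (p q + x (1 - x) (p - q)^2)\<close> increases in \<open>x\<close>.
  Hence \<open>T / (1 - 2 x)\<close> decreases.\<close>

lemma sqrt_gap_mono:
  fixes p q \<theta> \<epsilon> :: real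
  assumes pq: "0 \<le> q" "q \<le> p" "0 < p" and \<theta>: "0 \<le> \<theta>" "\<theta> \<le> \<epsilon>" "\<epsilon> < 1 / 2"
  shows "(1 - 2 * \<theta>) * (sqrt ((1 - \<epsilon>) * p + \<epsilon> * q) - sqrt ((1 - \<epsilon>) * q + \<epsilon> * p)) \<le>
         (1 - 2 * \<epsilon>) * (sqrt ((1 - \<theta>) * p + \<theta> * q) - sqrt ((1 - \<theta>) * q + \<theta> * p))"
    and "0 \<le> sqrt ((1 - \<epsilon>) * p + \<epsilon> * q) - sqrt ((1 - \<epsilon>) * q + \<epsilon> * p)"
proof -
  define P where "P x = (1 - x) * p + x * q" for x
  define Q where "Q x = (1 - x) * q + x * p" for x
  have PQ: "P x - Q x = (1 - 2 * x) * (p - q)" "P x * Q x = p * q + x * (1 - x) * (p - q)\<^sup>2"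
      "P x + Q x = p + q" for x
    by (simp_all add: P_def Q_def power2_eq_square algebra_simps)
  have pos: "0 < P x" "0 \<le> Q x" "Q x \<le> P x" if "0 \<le> x" "x < 1 / 2" for x
  proof -
    have "0 < (1 - x) * p" "0 \<le> x * q" "0 \<le> (1 - x) * q" "0 \<le> x * p" using that pq by auto
    then show "0 < P x" "0 \<le> Q x" by (auto simp: P_def Q_def)
    have "0 \<le> (1 - 2 * x) * (p - q)" using that pq by simp
    then show "Q x \<le> P x" using PQ(1)[of x] by linarith
  qed
  define S where "S x = sqrt (P x) + sqrt (Q x)" for x
  define T where "T x = sqrt (P x) - sqrt (Q x)" for x
  have TS: "T x * S x = (1 - 2 * x) * (p - q)" if "0 \<le> x" "x < 1 / 2" for x
    using pos[OF that] unfolding T_def S_def PQ(1)[symmetric] by (simp add: algebra_simps)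
  have T0: "0 \<le> T \<epsilon>" using pos[of \<epsilon>] \<theta> by (simp add: T_def)
  have S2: "(S x)\<^sup>2 = p + q + 2 * sqrt (P x * Q x)" if "0 \<le> x" "x < 1 / 2" for x
    using pos[OF that] PQ(3)[of x] by (simp add: S_def power2_sum real_sqrt_mult)
  have Spos: "0 < S \<theta>" "0 < S \<epsilon>" using pos[of \<theta>] pos[of \<epsilon>] \<theta> by (auto simp: S_def intro: add_pos_nonneg)
  have "\<theta> * (1 - \<theta>) \<le> \<epsilon> * (1 - \<epsilon>)"
  proof -
    have "0 \<le> (\<epsilon> - \<theta>) * (1 - \<theta> - \<epsilon>)" using \<theta> by simp
    then show ?thesis by (simp add: algebra_simps)
  qed
  then have "P \<theta> * Q \<theta> \<le> P \<epsilon> * Q \<epsilon>" unfolding PQ by (intro add_left_mono mult_right_mono) auto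
  then have "(S \<theta>)\<^sup>2 \<le> (S \<epsilon>)\<^sup>2" using \<theta> by (simp add: S2)
  then have S: "S \<theta> \<le> S \<epsilon>" by (rule power2_le_imp_le) (use Spos in simp)
  have "((1 - 2 * \<theta>) * T \<epsilon>) * S \<theta> \<le> ((1 - 2 * \<theta>) * T \<epsilon>) * S \<epsilon>"
    using S T0 \<theta> by (intro mult_left_mono mult_nonneg_nonneg) auto
  also have "\<dots> = (1 - 2 * \<theta>) * ((1 - 2 * \<epsilon>) * (p - q))" using TS[of \<epsilon>] \<theta> by (simp add: mult.assoc)
  also have "\<dots> = (1 - 2 * \<epsilon>) * (T \<theta> * S \<theta>)" using TS[of \<theta>] \<theta> by simp
  finally have "((1 - 2 * \<theta>) * T \<epsilon>) * S \<theta> \<le> ((1 - 2 * \<epsilon>) * T \<theta>) * S \<theta>" by (simp only: mult.assoc)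
  then have "(1 - 2 * \<theta>) * T \<epsilon> \<le> (1 - 2 * \<epsilon>) * T \<theta>" using Spos by simp
  then show "(1 - 2 * \<theta>) * (sqrt ((1 - \<epsilon>) * p + \<epsilon> * q) - sqrt ((1 - \<epsilon>) * q + \<epsilon> * p)) \<le>
         (1 - 2 * \<epsilon>) * (sqrt ((1 - \<theta>) * p + \<theta> * q) - sqrt ((1 - \<theta>) * q + \<theta> * p))"
    by (simp add: T_def P_def Q_def)
  show "0 \<le> sqrt ((1 - \<epsilon>) * p + \<epsilon> * q) - sqrt ((1 - \<epsilon>) * q + \<epsilon> * p)"
    using T0 by (simp add: T_def P_def Q_def)
qed

section \<open>Exact recovery\<close>

lemma sum_sq_le_iff:
  assumes "0 \<le> t"
  shows "(\<Sum>i<n. (f i)\<^sup>2) \<le> t\<^sup>2 * (\<Sum>i<n. (x i)\<^sup>2) \<longleftrightarrow> L2_set f {..<n} \<le> t * L2_set x {..<n}"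
proof -
  have "(L2_set f {..<n})\<^sup>2 = (\<Sum>i<n. (f i)\<^sup>2)" "(t * L2_set x {..<n})\<^sup>2 = t\<^sup>2 * (\<Sum>i<n. (x i)\<^sup>2)"
    by (auto simp: L2_set_def sum_nonneg power_mult_distrib)
  then show ?thesis
    using assms by (metis L2_set_nonneg mult_nonneg_nonneg power2_le_imp_le power_mono)
qed

text \<open>Multiplying row \<open>i\<close> by \<open>z i\<close> is an isometry preserving the
  tangent condition, and dividing by \<open>\<beta> > 0\<close> preserves the inequalities. So a
  critical point becomes an instance of \<open>noisy_rank_one\<close>, where all rows agree; undoing
  the signs gives the claim.\<close>

lemma critical_point_recovery:
  fixes C :: "real mat" and z :: "nat \<Rightarrow> real"
  assumes n: "0 < n" and C: "C \<in> carrier_mat n n" and sym: "C\<^sup>T = C" and r: "2 \<le> r"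
    and z: "\<And>i. i < n \<Longrightarrow> z i \<in> {-1, 1}" and \<beta>: "0 < \<beta>"
    and op: "\<And>x. (\<Sum>i<n. (\<Sum>j<n. (z i * z j * C $$ (i, j) / \<beta> - 1 / n) * x j)\<^sup>2) \<le> \<delta>\<^sup>2 * (\<Sum>i<n. (x i)\<^sup>2)"
    and margin: "\<And>i. i < n \<Longrightarrow> \<eta> \<le> (\<Sum>j<n. z i * z j * C $$ (i, j) / \<beta>)"
    and small: "0 \<le> \<delta>" "\<delta> \<le> 1 / 8" "24 * \<delta> < \<eta>"
    and crit: "second_order_critical n r (objective C) Y" and ij: "i < n" "j < n"
  shows "(Y * Y\<^sup>T) $$ (i, j) = z i * z j"
proof -
  have Y: "Y \<in> carrier_mat n r" and diag: "diag_vec (Y * Y\<^sup>T) = ones_vec n"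
    and S0: "S_mat C Y * Y = 0\<^sub>m n r"
    and SO: "\<And>V. V \<in> tangent_space Y \<Longrightarrow> 0 \<le> mat_inner (S_mat C Y) (V * V\<^sup>T)"
    using crit unfolding second_order_critical_objective_iff[OF C sym] by (auto simp: sphere_product_def)
  have zz: "z i * z i = 1" if "i < n" for i using z[OF that] by auto
  have YYT: "(Y * Y\<^sup>T) $$ (i, j) = (\<Sum>k<r. Y $$ (i, k) * Y $$ (j, k))" if "i < n" "j < n" for i j
    using index_mult_sum[of Y n r "Y\<^sup>T" n i j] Y that by simp
  have CY: "(C * V) $$ (i, k) = (\<Sum>j<n. C $$ (i, j) * V $$ (j, k))"
    if "V \<in> carrier_mat n r" "i < n" "k < r" for V i k
    using index_mult_sum[of C n n V r i k] C that by simp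
  define D where "D i j = z i * z j * C $$ (i, j) / \<beta> - 1 / n" for i j
  define C' where "C' i j = z i * z j * C $$ (i, j) / \<beta>" for i j
  define y where "y i k = z i * Y $$ (i, k)" for i k
  define L where "L i = (C * Y * Y\<^sup>T) $$ (i, i)" for i
  define lam where "lam i = L i / \<beta>" for i
  interpret noisy_rank_one n r D C' y lam \<delta> \<eta>
  proof
    show "0 < n" "2 \<le> r" "0 \<le> \<delta>" "\<delta> \<le> 1 / 8" "24 * \<delta> < \<eta>" by fact+
    show "C' i j = 1 / n + D i j" for i j by (simp add: C'_def D_def)
    show "(\<Sum>i<n. (\<Sum>j<n. D i j * x j)\<^sup>2) \<le> \<delta>\<^sup>2 * (\<Sum>i<n. (x i)\<^sup>2)" for x
      unfolding D_def by (rule op)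
    show "\<eta> \<le> (\<Sum>j<n. C' i j)" if "i < n" for i unfolding C'_def by (rule margin[OF that])
    show "(\<Sum>k<r. (y i k)\<^sup>2) = 1" if i: "i < n" for i
    proof -
      have "(Y * Y\<^sup>T) $$ (i, i) = diag_vec (Y * Y\<^sup>T) $ i" using i Y by (simp add: diag_vec_def)
      also have "\<dots> = 1" using i by (simp add: diag ones_vec_def)
      finally have "(\<Sum>k<r. Y $$ (i, k) * Y $$ (i, k)) = 1" using YYT[OF i i] by simp
      moreover have "(y i k)\<^sup>2 = Y $$ (i, k) * Y $$ (i, k)" for k
        using zz[OF i] by (simp add: y_def power2_eq_square algebra_simps)
      ultimately show ?thesis by simp
    qed
    show "(\<Sum>j<n. C' i j * y j k) = lam i * y i k" if i: "i < n" and k: "k < r" for i k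
    proof -
      have "(S_mat C Y * Y) $$ (i, k) = 0" using S0 i k by simp
      then have "(C * Y) $$ (i, k) = L i * Y $$ (i, k)"
        unfolding S_mat_mult_index[OF C Y Y i k] L_def by linarith
      then have e: "(\<Sum>j<n. C $$ (i, j) * Y $$ (j, k)) = L i * Y $$ (i, k)" by (simp only: CY[OF Y i k])
      have "(\<Sum>j<n. C' i j * y j k) = (\<Sum>j<n. (z i / \<beta>) * (C $$ (i, j) * Y $$ (j, k)))"
        using zz by (intro sum.cong refl) (simp add: C'_def y_def mult_ac)
      also have "\<dots> = (z i / \<beta>) * (L i * Y $$ (i, k))" by (simp only: e flip: sum_distrib_left)
      finally show ?thesis by (simp add: y_def lam_def)
    qed
    show "(\<Sum>i<n. \<Sum>j<n. C' i j * (\<Sum>k<r. v i k * v j k)) \<le> (\<Sum>i<n. lam i * (\<Sum>k<r. (v i k)\<^sup>2))"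
      if tan: "\<And>i. i < n \<Longrightarrow> (\<Sum>k<r. y i k * v i k) = 0" for v
    proof -
      \<comment> \<open>Flipping the signs back turns a variation at \<open>y\<close> into one at
        \<open>Y\<close>.\<close>
      define V where "V = mat n r (\<lambda>(i, k). z i * v i k)"
      have V: "V \<in> carrier_mat n r" and Vi: "\<And>i k. i < n \<Longrightarrow> k < r \<Longrightarrow> V $$ (i, k) = z i * v i k"
        by (auto simp: V_def)
      have "(Y * V\<^sup>T) $$ (i, i) = 0" if i: "i < n" for i
      proof -
        have "(Y * V\<^sup>T) $$ (i, i) = (\<Sum>k<r. Y $$ (i, k) * V $$ (i, k))"
          using index_mult_sum[of Y n r "V\<^sup>T" n i i] Y V i by simp
        also have "\<dots> = (\<Sum>k<r. y i k * v i k)" using i by (simp add: Vi y_def mult_ac)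
        finally show ?thesis using tan[OF i] by simp
      qed
      then have "V \<in> tangent_space Y"
        using Y V by (auto simp: tangent_space_def diag_vec_def simp del: index_mult_mat(1) intro!: eq_vecI)
      then have "0 \<le> mat_inner (S_mat C Y) (V * V\<^sup>T)" by (rule SO)
      also have "\<dots> = mat_inner (S_mat C Y * V) V"
        by (rule mat_inner_gram[OF _ V V]) (use C Y in \<open>auto simp: S_mat_def ddiag_def\<close>)
      also have "\<dots> = (\<Sum>k<r. \<Sum>i<n. (S_mat C Y * V) $$ (i, k) * V $$ (i, k))"
        using C Y V by (subst mat_inner_sum[of _ n r]) (auto simp: S_mat_def ddiag_def)
      also have "\<dots> = (\<Sum>k<r. \<Sum>i<n. (L i * (v i k)\<^sup>2 - (\<Sum>j<n. z i * z j * C $$ (i, j) * (v i k * v j k))))"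
      proof (intro sum.cong refl)
        fix k i assume ki: "k \<in> {..<r}" "i \<in> {..<n}"
        then have "(S_mat C Y * V) $$ (i, k) = L i * V $$ (i, k) - (\<Sum>j<n. C $$ (i, j) * V $$ (j, k))"
          using S_mat_mult_index[OF C Y V, of i k] CY[OF V, of i k] by (simp only: L_def lessThan_iff)
        then have "(S_mat C Y * V) $$ (i, k) * V $$ (i, k) =
           L i * (V $$ (i, k) * V $$ (i, k)) - (\<Sum>j<n. C $$ (i, j) * V $$ (j, k) * V $$ (i, k))"
          by (simp only: left_diff_distrib sum_distrib_right mult.assoc)
        moreover have "V $$ (i, k) * V $$ (i, k) = (v i k)\<^sup>2"
          using ki zz[of i] by (simp add: Vi power2_eq_square algebra_simps)
        moreover have "(\<Sum>j<n. C $$ (i, j) * V $$ (j, k) * V $$ (i, k)) =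
            (\<Sum>j<n. z i * z j * C $$ (i, j) * (v i k * v j k))"
          using ki by (intro sum.cong refl) (simp add: Vi mult_ac)
        ultimately show "(S_mat C Y * V) $$ (i, k) * V $$ (i, k) =
           L i * (v i k)\<^sup>2 - (\<Sum>j<n. z i * z j * C $$ (i, j) * (v i k * v j k))" by (simp only:)
      qed
      also have "\<dots> = (\<Sum>i<n. \<Sum>k<r. L i * (v i k)\<^sup>2) -
          (\<Sum>i<n. \<Sum>k<r. \<Sum>j<n. z i * z j * C $$ (i, j) * (v i k * v j k))"
        by (subst sum.swap) (simp only: sum_subtractf)
      also have "(\<Sum>i<n. \<Sum>k<r. \<Sum>j<n. z i * z j * C $$ (i, j) * (v i k * v j k)) =
         (\<Sum>i<n. \<Sum>j<n. \<Sum>k<r. z i * z j * C $$ (i, j) * (v i k * v j k))"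
        by (intro sum.cong refl sum.swap)
      finally have "0 \<le> (\<Sum>i<n. L i * (\<Sum>k<r. (v i k)\<^sup>2)) -
         (\<Sum>i<n. \<Sum>j<n. z i * z j * C $$ (i, j) * (\<Sum>k<r. v i k * v j k))"
        by (simp only: sum_distrib_left)
      then have "(\<Sum>i<n. \<Sum>j<n. z i * z j * C $$ (i, j) * (\<Sum>k<r. v i k * v j k)) / \<beta> \<le>
          (\<Sum>i<n. L i * (\<Sum>k<r. (v i k)\<^sup>2)) / \<beta>"
        using \<beta> by (intro divide_right_mono) auto
      then show ?thesis by (simp add: C'_def lam_def sum_divide_distrib)
    qed
  qed
  have "(\<Sum>k<r. y i k * y j k) = 1" using gram_eq_1[OF ij] by (simp add: gram_def)
  moreover have "(\<Sum>k<r. y i k * y j k) = z i * z j * (Y * Y\<^sup>T) $$ (i, j)"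
    unfolding YYT[OF ij] by (simp add: y_def sum_distrib_left mult_ac)
  ultimately have "z i * z j * (z i * z j * (Y * Y\<^sup>T) $$ (i, j)) = z i * z j" by simp
  then show ?thesis using z[OF ij(1)] z[OF ij(2)] by (auto simp del: index_mult_mat(1))
qed

text \<open>The mean matrix is \<open>(p + q) / 2\<close> times the all-ones matrix plus
  \<open>(p - q) / 2\<close> times \<open>z z^T\<close>, except that this gives \<open>p\<close> on
  the diagonal, where a simple graph has 0.\<close>

lemma adjacency_eq:
  assumes z: "\<And>i. i < n \<Longrightarrow> z i \<in> {-1, 1 :: real}" and ij: "i < n" "j < n"
  shows "adjacency_mat n E $$ (i, j) = centred_adjacency (sbm_prob z p q) E i j +
    (p + q) / 2 + (p - q) / 2 * (z i * z j) - (if i = j then p else 0)"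
proof -
  have "sbm_prob z p q (min i j, max i j) = (p + q) / 2 + (p - q) / 2 * (z i * z j)"
    using z[OF ij(1)] z[OF ij(2)] by (auto simp: sbm_prob_def min_def max_def field_simps)
  then show ?thesis using z[OF ij(1)] ij
    by (auto simp: adjacency_mat_def centred_adjacency_def field_simps)
qed

text \<open>For the empirical mean, balance removes the \<open>z z^T\<close> part. What remains is
  the missing diagonal, contributing \<open>p\<close>, and the noise tested against the all-ones
  vector, contributing at most \<open>t\<close>.\<close>

lemma centring_error_le:
  fixes z :: "nat \<Rightarrow> real"
  assumes n: "0 < n" and z: "\<And>i. i < n \<Longrightarrow> z i \<in> {-1, 1}" and bal: "(\<Sum>i<n. z i) = 0"
    and p: "0 \<le> p" and t: "0 \<le> t"
    and op: "\<And>x. (\<Sum>i<n. (\<Sum>j<n. centred_adjacency (sbm_prob z p q) E i j * x j)\<^sup>2) \<le> t\<^sup>2 * (\<Sum>i<n. (x i)\<^sup>2)"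
    and c: "c = (p + q) / 2 \<or>
        c = 1 / (real n)\<^sup>2 * mat_inner (adjacency_mat n E) (outer (ones_vec n) (ones_vec n))"
  shows "n * \<bar>(p + q) / 2 - c\<bar> \<le> p + t"
  using c
proof
  assume c: "c = 1 / (real n)\<^sup>2 * mat_inner (adjacency_mat n E) (outer (ones_vec n) (ones_vec n))"
  define W where "W = (\<Sum>i<n. \<Sum>j<n. centred_adjacency (sbm_prob z p q) E i j * (1 * 1))"
  have W: "\<bar>W\<bar> \<le> t * n"
    using abs_quadratic_form_le[OF op t, of "\<lambda>_. 1"] by (simp add: W_def)
  have "mat_inner (adjacency_mat n E) (outer (ones_vec n) (ones_vec n)) =
      (\<Sum>j<n. \<Sum>i<n. adjacency_mat n E $$ (i, j))"
    by (subst mat_inner_sum[of _ n n]) (auto simp: adjacency_mat_def outer_def ones_vec_def intro!: sum.cong)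
  also have "\<dots> = (\<Sum>i<n. \<Sum>j<n. adjacency_mat n E $$ (i, j))" by (rule sum.swap)
  also have "\<dots> = (\<Sum>i<n. \<Sum>j<n. centred_adjacency (sbm_prob z p q) E i j * (1 * 1) +
      (p + q) / 2 + (p - q) / 2 * (z i * z j) - (if i = j then p else 0))"
  proof (intro sum.cong refl)
    fix i j assume "i \<in> {..<n}" "j \<in> {..<n}"
    then show "adjacency_mat n E $$ (i, j) = centred_adjacency (sbm_prob z p q) E i j * (1 * 1) +
        (p + q) / 2 + (p - q) / 2 * (z i * z j) - (if i = j then p else 0)"
      using adjacency_eq[of n z i j E p q, OF z] by simp
  qed
  also have "\<dots> = W + real n * real n * ((p + q) / 2) + (p - q) / 2 * (\<Sum>i<n. \<Sum>j<n. z i * z j) - n * p"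
    by (simp add: sum.distrib sum_subtractf W_def sum_distrib_left)
  also have "(\<Sum>i<n. \<Sum>j<n. z i * z j) = (\<Sum>i<n. z i) * (\<Sum>j<n. z j)" by (simp only: sum_product)
  finally have "c = 1 / (real n)\<^sup>2 * (W + real n * real n * ((p + q) / 2) - n * p)" using bal c by simp
  then have "n * ((p + q) / 2 - c) = p - W / n"
    using n by (simp add: field_simps power2_eq_square)
  then have "n * \<bar>(p + q) / 2 - c\<bar> = \<bar>p - W / n\<bar>" using n by (metis abs_mult abs_of_nat)
  also have "\<dots> \<le> p + \<bar>W\<bar> / n" using p abs_triangle_ineq4[of p "W / n"] by simp
  also have "\<bar>W\<bar> / n \<le> t" using W n by (simp add: field_simps)
  finally show ?thesis by simp
next
  assume "c = (p + q) / 2"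
  then have "(p + q) / 2 - c = 0" by simp
  then show ?thesis using p t by simp
qed

text \<open>Dividing by \<open>\<beta> = n (p - q) / 2\<close> turns the conjugated signal into
  entries \<open>1 / n\<close>. The rest is the conjugated noise, the centring error and the missing
  diagonal, of norms at most \<open>t\<close>, \<open>p + t\<close> and \<open>p\<close>; their sum
  over \<open>\<beta>\<close> is \<open>4 (t + p) / N\<close>, which explains the factor 4.\<close>

lemma recovery_on_good_graph:
  fixes z :: "nat \<Rightarrow> real"
  assumes n: "0 < n" and z: "\<And>i. i < n \<Longrightarrow> z i \<in> {-1, 1}" and bal: "(\<Sum>i<n. z i) = 0"
    and pq: "0 \<le> q" "q < p" and d: "0 \<le> d1" "0 \<le> d2" "4 * (d1 + d2) \<le> 1 / 8" "24 * (4 * (d1 + d2)) < \<epsilon>"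
    and p_small: "p \<le> d2 * (n * (p - q))"
    and op: "\<And>x. (\<Sum>i<n. (\<Sum>j<n. centred_adjacency (sbm_prob z p q) E i j * x j)\<^sup>2)
        \<le> (d1 * (n * (p - q)))\<^sup>2 * (\<Sum>i<n. (x i)\<^sup>2)"
    and gap: "\<And>i. i < n \<Longrightarrow> \<epsilon> / 2 * (n * (p - q)) \<le> degree_gap n z E i"
    and c: "c = (p + q) / 2 \<or>
        c = 1 / (real n)\<^sup>2 * mat_inner (adjacency_mat n E) (outer (ones_vec n) (ones_vec n))"
    and r: "2 \<le> r"
    and crit: "second_order_critical n r
        (objective (adjacency_mat n E - c \<cdot>\<^sub>m outer (ones_vec n) (ones_vec n))) Y"
    and ij: "i < n" "j < n"
  shows "(Y * Y\<^sup>T) $$ (i, j) = z i * z j"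
proof -
  define N where "N = n * (p - q)"
  define \<beta> where "\<beta> = N / 2"
  define t where "t = d1 * N"
  define \<gamma> where "\<gamma> = (p + q) / 2 - c"
  define \<Delta> where "\<Delta> = centred_adjacency (sbm_prob z p q) E"
  define C where "C = adjacency_mat n E - c \<cdot>\<^sub>m outer (ones_vec n) (ones_vec n)"
  have N0: "0 < N" using n pq by (simp add: N_def)
  have \<beta>0: "0 < \<beta>" using N0 by (simp add: \<beta>_def)
  have t0: "0 \<le> t" using N0 d by (simp add: t_def)
  have p0: "0 \<le> p" using pq by simp
  have \<gamma>: "n * \<bar>\<gamma>\<bar> \<le> p + t"
    unfolding \<gamma>_def using op by (intro centring_error_le[OF n z bal p0 t0 _ c]) (simp_all add: t_def N_def)
  have Ccar: "C \<in> carrier_mat n n" unfolding C_def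
    by (intro minus_carrier_mat smult_carrier_mat) (simp add: outer_def ones_vec_def)
  have Cij: "C $$ (i, j) = adjacency_mat n E $$ (i, j) - c" if "i < n" "j < n" for i j
    using that by (simp add: C_def adjacency_mat_def outer_def ones_vec_def)
  have sym: "C\<^sup>T = C"
  proof (rule eq_matI)
    fix i j assume "i < dim_row C" "j < dim_col C"
    then have ij: "i < n" "j < n" using Ccar by auto
    have "adjacency_mat n E $$ (i, j) = adjacency_mat n E $$ (j, i)"
      using ij by (auto simp: adjacency_mat_def min.commute max.commute)
    then show "C\<^sup>T $$ (i, j) = C $$ (i, j)" using ij Ccar by (simp add: Cij)
  qed (use Ccar in auto)
  have zz: "z i * z i = 1" if "i < n" for i using z[OF that] by auto
  define \<delta> where "\<delta> = 4 * (d1 + d2)"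
  have D: "z i * z j * C $$ (i, j) / \<beta> - 1 / n =
      (1 / \<beta>) * (z i * \<Delta> i j * z j + \<gamma> * (z i * z j) + (if i = j then - p else 0))"
    if ij: "i < n" "j < n" for i j
  proof -
    have "\<beta> = n * ((p - q) / 2)" "(p - q) / 2 \<noteq> 0" using pq by (auto simp: \<beta>_def N_def)
    then have b: "(1 / \<beta>) * ((p - q) / 2) = 1 / n" by simp
    have zz2: "(z i * z j) * (z i * z j) = 1" using z[OF ij(1)] z[OF ij(2)] by auto
    have dg: "z i * z j * (if i = j then p else 0) = (if i = j then p else 0)" using zz[OF ij(2)] by simp
    have "z i * z j * C $$ (i, j) = z i * \<Delta> i j * z j + \<gamma> * (z i * z j) +
        (p - q) / 2 * ((z i * z j) * (z i * z j)) - z i * z j * (if i = j then p else 0)"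
    proof -
      define h where "h = (if i = j then p else 0)"
      have "adjacency_mat n E $$ (i, j) = \<Delta> i j + (p + q) / 2 + (p - q) / 2 * (z i * z j) - h"
        unfolding \<Delta>_def h_def by (rule adjacency_eq[of n z i j E p q, OF z ij])
      then have e: "C $$ (i, j) = \<Delta> i j + \<gamma> + (p - q) / 2 * (z i * z j) - h"
        by (simp add: Cij[OF ij] \<gamma>_def)
      show ?thesis unfolding h_def[symmetric] e by (simp add: algebra_simps)
    qed
    also have "\<dots> = (z i * \<Delta> i j * z j + \<gamma> * (z i * z j) + (if i = j then - p else 0)) + (p - q) / 2"
      unfolding zz2 dg by simp
    finally show ?thesis unfolding b[symmetric] by (simp add: algebra_simps add_divide_distrib)
  qed
  have Dx: "(\<Sum>j<n. (z i * z j * C $$ (i, j) / \<beta> - 1 / n) * x j) =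
      (1 / \<beta>) * (z i * (\<Sum>j<n. \<Delta> i j * (z j * x j)) + \<gamma> * (\<Sum>j<n. z j * x j) * z i + (- p) * x i)"
    if i: "i < n" for i x
  proof -
    have "(\<Sum>j<n. (z i * z j * C $$ (i, j) / \<beta> - 1 / n) * x j) =
       (\<Sum>j<n. (1 / \<beta>) * (z i * (\<Delta> i j * (z j * x j)) + (\<gamma> * z i) * (z j * x j) + (if j = i then - p * x i else 0)))"
    proof (intro sum.cong refl)
      fix j assume "j \<in> {..<n}"
      then show "(z i * z j * C $$ (i, j) / \<beta> - 1 / n) * x j =
        (1 / \<beta>) * (z i * (\<Delta> i j * (z j * x j)) + (\<gamma> * z i) * (z j * x j) + (if j = i then - p * x i else 0))"
        by (cases "j = i") (simp_all only: D[OF i] lessThan_iff, simp_all add: algebra_simps)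
    qed
    also have "\<dots> = (1 / \<beta>) * (z i * (\<Sum>j<n. \<Delta> i j * (z j * x j)) + (\<gamma> * z i) * (\<Sum>j<n. z j * x j)
        + (\<Sum>j<n. if j = i then - p * x i else 0))"
      by (simp only: sum.distrib flip: sum_distrib_left)
    finally show ?thesis using i by (simp add: mult_ac)
  qed
  have opC: "(\<Sum>i<n. (\<Sum>j<n. (z i * z j * C $$ (i, j) / \<beta> - 1 / n) * x j)\<^sup>2) \<le> \<delta>\<^sup>2 * (\<Sum>i<n. (x i)\<^sup>2)" for x
  proof -
    let ?X = "L2_set x {..<n}"
    have sc: "L2_set (\<lambda>i. a * f i) {..<n} = \<bar>a\<bar> * L2_set f {..<n}" for a f
      by (simp add: L2_set_def power_mult_distrib real_sqrt_mult flip: sum_distrib_left)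
    have zL: "L2_set (\<lambda>i. z i * f i) {..<n} = L2_set f {..<n}" for f
      unfolding L2_set_def using zz by (intro arg_cong[where f = sqrt] sum.cong refl)
        (simp add: power_mult_distrib power2_eq_square)
    have 1: "L2_set (\<lambda>i. z i * (\<Sum>j<n. \<Delta> i j * (z j * x j))) {..<n} \<le> t * ?X"
    proof -
      have "L2_set (\<lambda>i. \<Sum>j<n. \<Delta> i j * (z j * x j)) {..<n} \<le> t * L2_set (\<lambda>j. z j * x j) {..<n}"
        using op[of "\<lambda>j. z j * x j"] by (subst sum_sq_le_iff[OF t0, symmetric]) (simp add: t_def N_def \<Delta>_def)
      then show ?thesis by (simp only: zL)
    qed
    \<comment> \<open>The rank-one matrix \<open>z z^T\<close> has norm \<open>n\<close>, which
      matches the bound on \<open>n * \<bar>\<gamma>\<bar>\<close>.\<close>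
    have 2: "L2_set (\<lambda>i. \<gamma> * (\<Sum>j<n. z j * x j) * z i) {..<n} \<le> (p + t) * ?X"
    proof -
      have Lz: "L2_set z {..<n} = sqrt n" using zL[of "\<lambda>_. 1"] by (simp add: L2_set_def)
      have "\<bar>\<Sum>j<n. z j * x j\<bar> \<le> (\<Sum>j<n. \<bar>z j\<bar> * \<bar>x j\<bar>)"
        by (rule order_trans[OF sum_abs]) (simp add: abs_mult)
      also have "\<dots> \<le> sqrt n * ?X" using L2_set_mult_ineq[of z x "{..<n}"] by (simp add: Lz)
      finally have "\<bar>\<gamma>\<bar> * \<bar>\<Sum>j<n. z j * x j\<bar> * sqrt n \<le> \<bar>\<gamma>\<bar> * (sqrt n * ?X) * sqrt n"
        by (intro mult_right_mono mult_left_mono) auto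
      also have "\<dots> = (n * \<bar>\<gamma>\<bar>) * ?X" by (simp add: mult_ac)
      also have "\<dots> \<le> (p + t) * ?X" using \<gamma> by (intro mult_right_mono) auto
      finally show ?thesis by (simp add: sc Lz abs_mult)
    qed
    have 3: "L2_set (\<lambda>i. (- p) * x i) {..<n} = p * ?X" using p0 by (simp only: sc) simp
    have "L2_set (\<lambda>i. \<Sum>j<n. (z i * z j * C $$ (i, j) / \<beta> - 1 / n) * x j) {..<n} =
      (1 / \<beta>) * L2_set (\<lambda>i. z i * (\<Sum>j<n. \<Delta> i j * (z j * x j)) + \<gamma> * (\<Sum>j<n. z j * x j) * z i + (- p) * x i) {..<n}"
    proof -
      have "L2_set (\<lambda>i. \<Sum>j<n. (z i * z j * C $$ (i, j) / \<beta> - 1 / n) * x j) {..<n} =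
        L2_set (\<lambda>i. (1 / \<beta>) * (z i * (\<Sum>j<n. \<Delta> i j * (z j * x j)) + \<gamma> * (\<Sum>j<n. z j * x j) * z i + (- p) * x i)) {..<n}"
        by (intro L2_set_cong refl Dx) simp
      then show ?thesis using \<beta>0 by (simp only: sc) simp
    qed
    also have "\<dots> \<le> (1 / \<beta>) * ((t * ?X + (p + t) * ?X) + p * ?X)"
    proof (intro mult_left_mono)
      have "L2_set (\<lambda>i. z i * (\<Sum>j<n. \<Delta> i j * (z j * x j)) + \<gamma> * (\<Sum>j<n. z j * x j) * z i + (- p) * x i) {..<n}
        \<le> (L2_set (\<lambda>i. z i * (\<Sum>j<n. \<Delta> i j * (z j * x j))) {..<n} +
            L2_set (\<lambda>i. \<gamma> * (\<Sum>j<n. z j * x j) * z i) {..<n}) + L2_set (\<lambda>i. (- p) * x i) {..<n}"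
        by (intro order_trans[OF L2_set_triangle_ineq] add_right_mono L2_set_triangle_ineq)
      then show "L2_set (\<lambda>i. z i * (\<Sum>j<n. \<Delta> i j * (z j * x j)) + \<gamma> * (\<Sum>j<n. z j * x j) * z i + (- p) * x i) {..<n}
        \<le> (t * ?X + (p + t) * ?X) + p * ?X" using 1 2 unfolding 3 by linarith
    qed (use \<beta>0 in simp)
    also have "\<dots> = (4 * (t + p) / N) * ?X" using N0 by (simp add: \<beta>_def field_simps)
    also have "\<dots> \<le> \<delta> * ?X"
    proof (intro mult_right_mono)
      have "4 * (t + p) \<le> \<delta> * N" using p_small unfolding \<delta>_def t_def N_def[symmetric] by (simp add: algebra_simps)
      then show "4 * (t + p) / N \<le> \<delta>" using N0 by (simp add: divide_le_eq)
    qed simp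
    finally show ?thesis using d by (subst sum_sq_le_iff) (auto simp: \<delta>_def)
  qed
  have margin: "\<epsilon> \<le> (\<Sum>j<n. z i * z j * C $$ (i, j) / \<beta>)" if i: "i < n" for i
  proof -
    \<comment> \<open>After conjugation the constant \<open>c\<close> multiplies the sum of the
      signs, which is 0, so the row sums do not depend on the centring.\<close>
    have "(\<Sum>j<n. z i * z j * C $$ (i, j) / \<beta>) = (\<Sum>j<n. z i * z j * adjacency_mat n E $$ (i, j) / \<beta> - z j * (z i * c / \<beta>))"
      using i by (intro sum.cong refl) (simp add: Cij right_diff_distrib diff_divide_distrib mult_ac)
    also have "\<dots> = (\<Sum>j<n. z i * z j * adjacency_mat n E $$ (i, j)) / \<beta> - (\<Sum>j<n. z j) * (z i * c / \<beta>)"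
      by (simp only: sum_subtractf sum_divide_distrib sum_distrib_right)
    also have "(\<Sum>j<n. z i * z j * adjacency_mat n E $$ (i, j)) = degree_gap n z E i"
    proof -
      have "(\<Sum>j<n. z i * z j * adjacency_mat n E $$ (i, j)) = (\<Sum>j\<in>{..<n} - {i}. z i * z j * adjacency_mat n E $$ (i, j))"
        using i by (intro sum.mono_neutral_right) (auto simp: adjacency_mat_def)
      also have "\<dots> = degree_gap n z E i"
        unfolding degree_gap_def using i by (intro sum.cong refl) (auto simp: adjacency_mat_def)
      finally show ?thesis .
    qed
    finally have "(\<Sum>j<n. z i * z j * C $$ (i, j) / \<beta>) = degree_gap n z E i / \<beta>" using bal by simp
    moreover have "\<epsilon> * \<beta> \<le> degree_gap n z E i" using gap[OF i] by (simp add: \<beta>_def N_def)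
    ultimately show ?thesis using \<beta>0 by (simp add: le_divide_eq)
  qed
  show ?thesis
    by (rule critical_point_recovery[OF n Ccar sym r z \<beta>0 opC margin _ _ _ crit[folded C_def] ij])
      (use d in \<open>auto simp: \<delta>_def\<close>)
qed

text \<open>The first claim says that the signal \<open>n (p - q)\<close> exceeds
  \<open>sqrt (n p)\<close>, the order of the noise norm, by a factor \<open>sqrt (2 ln n)\<close>.
  The second adds the failure probability of the norm bound to a union bound over the degree gaps,
  where the margin parameter is only half of that in the threshold.\<close>

lemma prob_bad_graph_le:
  fixes z :: "nat \<Rightarrow> real"
  assumes n: "3 \<le> n" and z: "\<And>i. i < n \<Longrightarrow> z i \<in> {-1, 1}" and bal: "(\<Sum>i<n. z i) = 0"
    and pq: "0 \<le> q" "q \<le> p" "p \<le> 1" "0 < p" and \<epsilon>: "0 < \<epsilon>" "\<epsilon> < 1 / 2" and d: "0 < d"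
    and thr: "2 * ln n \<le> n * (sqrt ((1 - \<epsilon>) * p + \<epsilon> * q) - sqrt ((1 - \<epsilon>) * q + \<epsilon> * p))\<^sup>2"
  shows "2 * n * p * ln n \<le> (n * (p - q))\<^sup>2"
    and "measure_pmf.prob (random_graph n (sbm_prob z p q))
      {E. \<not> ((\<forall>x. (\<Sum>i<n. (\<Sum>j<n. centred_adjacency (sbm_prob z p q) E i j * x j)\<^sup>2)
              \<le> (d * (n * (p - q)))\<^sup>2 * (\<Sum>i<n. (x i)\<^sup>2)) \<and>
            (\<forall>i<n. \<epsilon> / 2 * (n * (p - q)) \<le> degree_gap n z E i))} \<le>
      40 / (d * sqrt (ln n)) + n * exp (1 - ((1 - \<epsilon>) / (1 - 2 * \<epsilon>))\<^sup>2 * ln n)"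
proof -
  let ?P = "random_graph n (sbm_prob z p q)"
  define N where "N = n * (p - q)"
  define T where "T x = sqrt ((1 - x) * p + x * q) - sqrt ((1 - x) * q + x * p)" for x
  have ln1: "1 < ln n"
  proof -
    have "exp 1 < (3::real)" using e_less_272 by simp
    also have "\<dots> \<le> n" using n by simp
    finally show ?thesis using n by (subst exp_less_cancel_iff[symmetric]) simp
  qed
  have T\<epsilon>0: "0 \<le> T \<epsilon>" unfolding T_def using sqrt_gap_mono(2)[of q p 0 \<epsilon>] pq \<epsilon> by simp
  \<comment> \<open>Without any margin the gap of the roots is larger, so the threshold carries over
    to \<open>T 0\<close>.\<close>
  have "1 * T \<epsilon> \<le> (1 - 2 * \<epsilon>) * T 0" unfolding T_def using sqrt_gap_mono(1)[of q p 0 \<epsilon>] pq \<epsilon> by simp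
  also have "\<dots> \<le> 1 * T 0" using pq \<epsilon> by (intro mult_right_mono) (auto simp: T_def)
  finally have T0: "T \<epsilon> \<le> T 0" by simp
  have thr': "2 * ln n \<le> n * (T \<epsilon>)\<^sup>2" using thr by (simp add: T_def)
  also have "\<dots> \<le> n * (T 0)\<^sup>2" using T0 T\<epsilon>0 by (intro mult_left_mono power_mono) auto
  finally have thr0: "2 * ln n \<le> n * (T 0)\<^sup>2" .
  \<comment> \<open>This makes \<open>n p\<close> at least of order \<open>ln n\<close>, so that it
    absorbs the term \<open>2 k\<close> of the trace bound.\<close>
  have "T 0 \<le> sqrt p" using pq by (simp add: T_def)
  then have "(T 0)\<^sup>2 \<le> (sqrt p)\<^sup>2" using T0 T\<epsilon>0 by (intro power_mono) auto
  then have "n * (T 0)\<^sup>2 \<le> n * p" using pq by (intro mult_left_mono) auto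
  then have np: "2 * ln n \<le> n * p" using thr0 by linarith
  \<comment> \<open>The difference of squares; keeping only \<open>sqrt p\<close> gives
    \<open>N^2 \<ge> (n p) (n (T 0)^2)\<close>.\<close>
  have "p - q = T 0 * (sqrt p + sqrt q)" using pq by (simp add: T_def algebra_simps)
  moreover have "T 0 * sqrt p \<le> T 0 * (sqrt p + sqrt q)" using T0 T\<epsilon>0 pq by (intro mult_left_mono) auto
  ultimately have "(T 0 * sqrt p)\<^sup>2 \<le> (p - q)\<^sup>2" using T0 T\<epsilon>0 pq by (intro power_mono) auto
  then have "n * n * ((T 0)\<^sup>2 * p) \<le> n * n * (p - q)\<^sup>2" using pq by (intro mult_left_mono) (auto simp: power_mult_distrib)
  also have "\<dots> = N\<^sup>2" by (simp add: N_def power2_eq_square mult_ac)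
  finally have "(n * p) * (n * (T 0)\<^sup>2) \<le> N\<^sup>2" by (simp add: mult_ac)
  moreover have "(n * p) * (2 * ln n) \<le> (n * p) * (n * (T 0)\<^sup>2)" using thr0 pq by (intro mult_left_mono) auto
  ultimately have N2: "2 * n * p * ln n \<le> N\<^sup>2" by (simp add: mult_ac)
  then show "2 * n * p * ln n \<le> (n * (p - q))\<^sup>2" by (simp add: N_def)
  have "0 < 2 * n * p * ln n" using ln1 n pq by simp
  then have "0 < N\<^sup>2" using N2 by linarith
  then have N0: "0 < N" using pq n by (simp add: N_def)

  \<comment> \<open>A power of order \<open>ln n\<close> reduces the cost of the \<open>n\<close>
    starting points to \<open>3 ^ k\<close>.\<close>
  define k where "k = nat \<lceil>ln (real n)\<rceil>"
  have k: "ln n \<le> k" "k \<le> 2 * ln n" "0 < k" using ln1 unfolding k_def by linarith+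
  \<comment> \<open>Both bounds are needed: \<open>2 * p\<close> for the size of the noise, and 1
    for the hypothesis \<open>s \<le> 1\<close> of the walk count.\<close>
  define s where "s = min 1 (2 * p)"
  have s: "0 \<le> s" "s \<le> 1" "s \<le> 2 * p" using pq by (auto simp: s_def)
  \<comment> \<open>Here \<open>768 = 3 * 64 * 4\<close>: 3 from the starting points, 64 from the
    walk count, and 4 from \<open>n s + 2 k \<le> 4 n p\<close>.\<close>
  define \<tau> where "\<tau> = sqrt (768 * (n * p))"
  have \<tau>0: "0 < \<tau>" using n pq by (simp add: \<tau>_def)
  have \<tau>2: "\<tau>\<^sup>2 = 768 * (n * p)" using pq by (simp add: \<tau>_def)
  have "n * (64 * (n * s + 2 * real k)) ^ k \<le> 3 ^ k * (256 * (n * p)) ^ k"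
  proof -
    have "real n = exp (ln n)" using n by simp
    also have "\<dots> \<le> exp (real k)" using k by simp
    also have "\<dots> = exp 1 ^ k" by (simp flip: exp_of_nat_mult)
    also have "\<dots> \<le> 3 ^ k" using e_less_272 by (intro power_mono) auto
    finally have "real n \<le> 3 ^ k" .
    moreover have "n * s \<le> n * (2 * p)" using s by (intro mult_left_mono) auto
    then have "n * s + 2 * real k \<le> 4 * (n * p)" using k np by linarith
    then have "64 * (n * s + 2 * real k) \<le> 64 * (4 * (n * p))" by (intro mult_left_mono) auto
    then have "64 * (n * s + 2 * real k) \<le> 256 * (n * p)" by simp
    then have "(64 * (n * s + 2 * real k)) ^ k \<le> (256 * (n * p)) ^ k" using s by (intro power_mono) auto
    ultimately show ?thesis using s by (intro mult_mono) auto
  qed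
  also have "\<dots> = (3 * (256 * (n * p))) ^ k" by (rule power_mult_distrib[symmetric])
  also have "3 * (256 * (n * p)) = \<tau>\<^sup>2" by (simp add: \<tau>2)
  also have "(\<tau>\<^sup>2) ^ k = \<tau> ^ (2 * k)" by (rule power_mult[symmetric])
  finally have \<tau>k: "n * (64 * (n * s + 2 * real k)) ^ k \<le> \<tau> ^ (2 * k)" .
  have \<pi>: "0 \<le> sbm_prob z p q e \<and> sbm_prob z p q e \<le> 1 \<and> 2 * sbm_prob z p q e * (1 - sbm_prob z p q e) \<le> s" for e
  proof -
    have "2 * x * (1 - x) \<le> s" if "0 \<le> x" "x \<le> p" for x
    proof -
      have "0 \<le> (1 - 2 * x)\<^sup>2" by simp
      then have "4 * (x * (1 - x)) \<le> 1" by (simp add: power2_eq_square algebra_simps)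
      moreover have "x * (1 - x) \<le> x * 1" using that pq by (intro mult_left_mono) auto
      ultimately show ?thesis using that by (simp add: s_def)
    qed
    then show ?thesis using pq by (simp add: sbm_prob_def)
  qed
  let ?A = "{E. \<not> (\<forall>x. (\<Sum>i<n. (\<Sum>j<n. centred_adjacency (sbm_prob z p q) E i j * x j)\<^sup>2)
              \<le> (d * N)\<^sup>2 * (\<Sum>i<n. (x i)\<^sup>2))}"
  let ?B = "\<lambda>i. {E. degree_gap n z E i \<le> \<epsilon> / 2 * N}"
  have "measure_pmf.prob ?P ?A \<le> 2 * \<tau> / (d * N)"
    using d N0 by (intro prob_operator_norm[where s = s and k = k] \<pi> s k \<tau>0 \<tau>k) auto
  also have "\<dots> \<le> 2 * (20 * N / sqrt (ln n)) / (d * N)"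
  proof (intro divide_right_mono mult_left_mono)
    \<comment> \<open>Half of 768 is 384, which is below \<open>20^2\<close>.\<close>
    have "\<tau>\<^sup>2 * ln n \<le> (20 * N)\<^sup>2" 
    proof -
      have "\<tau>\<^sup>2 * ln n = 384 * (2 * n * p * ln n)" by (simp add: \<tau>2)
      also have "\<dots> \<le> 384 * N\<^sup>2" using N2 by (intro mult_left_mono) auto
      also have "\<dots> \<le> (20 * N)\<^sup>2" by (simp add: power_mult_distrib)
      finally show ?thesis .
    qed
    then have "(\<tau> * sqrt (ln n))\<^sup>2 \<le> (20 * N)\<^sup>2" using ln1 by (simp add: power_mult_distrib)
    then have "\<tau> * sqrt (ln n) \<le> 20 * N" by (rule power2_le_imp_le) (use N0 in simp)
    then show "\<tau> \<le> 20 * N / sqrt (ln n)" using ln1 by (simp add: le_divide_eq)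
  qed (use d N0 in auto)
  also have "\<dots> = 40 / (d * sqrt (ln n))" using N0 by (simp add: mult_ac)
  finally have A: "measure_pmf.prob ?P ?A \<le> 40 / (d * sqrt (ln n))" .

  \<comment> \<open>The gain from using the margin \<open>\<epsilon> / 2\<close> below the threshold
    parameter: by \<open>sqrt_gap_mono\<close> the squared gap grows at least by this
    factor.\<close>
  define \<kappa> where "\<kappa> = ((1 - \<epsilon>) / (1 - 2 * \<epsilon>))\<^sup>2"
  have B: "measure_pmf.prob ?P (?B i) \<le> exp (1 - \<kappa> * ln n)" if i: "i < n" for i
  proof -
    have "measure_pmf.prob ?P (?B i) \<le> exp (1 - n / 2 * (T (\<epsilon> / 2))\<^sup>2)"
      unfolding N_def T_def using \<epsilon> by (intro prob_degree_gap_le z bal pq i) auto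
    also have "\<dots> \<le> exp (1 - \<kappa> * ln n)"
    proof -
      have "(1 - \<epsilon>) * T \<epsilon> \<le> (1 - 2 * \<epsilon>) * T (\<epsilon> / 2)"
        unfolding T_def using sqrt_gap_mono(1)[of q p "\<epsilon> / 2" \<epsilon>] pq \<epsilon> by simp
      then have "(1 - \<epsilon>) / (1 - 2 * \<epsilon>) * T \<epsilon> \<le> T (\<epsilon> / 2)" using \<epsilon> by (simp add: field_simps)
      then have "((1 - \<epsilon>) / (1 - 2 * \<epsilon>) * T \<epsilon>)\<^sup>2 \<le> (T (\<epsilon> / 2))\<^sup>2"
        using T\<epsilon>0 \<epsilon> by (intro power_mono) auto
      then have *: "\<kappa> * (T \<epsilon>)\<^sup>2 \<le> (T (\<epsilon> / 2))\<^sup>2" by (simp only: \<kappa>_def power_mult_distrib)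
      have "\<kappa> * (2 * ln n) \<le> \<kappa> * (n * (T \<epsilon>)\<^sup>2)" using thr' by (intro mult_left_mono) (auto simp: \<kappa>_def)
      also have "\<dots> = n * (\<kappa> * (T \<epsilon>)\<^sup>2)" by simp
      also have "\<dots> \<le> n * (T (\<epsilon> / 2))\<^sup>2" using * by (intro mult_left_mono) auto
      finally show ?thesis by simp
    qed
    finally show ?thesis .
  qed
  have "measure_pmf.prob ?P {E. \<not> ((\<forall>x. (\<Sum>i<n. (\<Sum>j<n. centred_adjacency (sbm_prob z p q) E i j * x j)\<^sup>2)
              \<le> (d * N)\<^sup>2 * (\<Sum>i<n. (x i)\<^sup>2)) \<and> (\<forall>i<n. \<epsilon> / 2 * N \<le> degree_gap n z E i))} \<le>
      measure_pmf.prob ?P (?A \<union> (\<Union>i\<in>{..<n}. ?B i))"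
    by (intro measure_pmf.finite_measure_mono) auto
  also have "\<dots> \<le> measure_pmf.prob ?P ?A + measure_pmf.prob ?P (\<Union>i\<in>{..<n}. ?B i)"
    by (intro measure_Un_le) auto
  also have "measure_pmf.prob ?P (\<Union>i\<in>{..<n}. ?B i) \<le> (\<Sum>i<n. measure_pmf.prob ?P (?B i))"
    by (intro measure_pmf.finite_measure_subadditive_finite) auto
  also have "\<dots> \<le> (\<Sum>i<n. exp (1 - \<kappa> * ln n))" using B by (intro sum_mono) auto
  finally show "measure_pmf.prob ?P
      {E. \<not> ((\<forall>x. (\<Sum>i<n. (\<Sum>j<n. centred_adjacency (sbm_prob z p q) E i j * x j)\<^sup>2)
              \<le> (d * (n * (p - q)))\<^sup>2 * (\<Sum>i<n. (x i)\<^sup>2)) \<and>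
            (\<forall>i<n. \<epsilon> / 2 * (n * (p - q)) \<le> degree_gap n z E i))} \<le>
      40 / (d * sqrt (ln n)) + n * exp (1 - ((1 - \<epsilon>) / (1 - 2 * \<epsilon>))\<^sup>2 * ln n)"
    using A unfolding N_def[symmetric] \<kappa>_def[symmetric] by simp
qed

text \<open>Since \<open>\<kappa> > 1\<close>, the union bound is a constant times
  \<open>n powr (1 - \<kappa>)\<close>.\<close>

lemma bad_graph_bound_tendsto_0:
  assumes "0 < \<epsilon>" "\<epsilon> < 1 / 2"
  shows "(\<lambda>n. 40 / (d * sqrt (ln (real n))) +
      n * exp (1 - ((1 - \<epsilon>) / (1 - 2 * \<epsilon>))\<^sup>2 * ln n)) \<longlonglongrightarrow> 0"
proof -
  define \<kappa> where "\<kappa> = ((1 - \<epsilon>) / (1 - 2 * \<epsilon>))\<^sup>2"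
  have "1 < (1 - \<epsilon>) / (1 - 2 * \<epsilon>)" using assms by (simp add: field_simps)
  then have "1 < \<kappa>" unfolding \<kappa>_def by (simp add: one_less_power)
  then have "(\<lambda>n. exp 1 * real n powr (1 - \<kappa>)) \<longlonglongrightarrow> exp 1 * 0"
    by (intro tendsto_mult_left tendsto_neg_powr filterlim_real_sequentially) simp
  moreover have "\<forall>\<^sub>F n in sequentially. exp 1 * real n powr (1 - \<kappa>) = n * exp (1 - \<kappa> * ln n)"
    using eventually_gt_at_top[of 0]
  proof eventually_elim
    case (elim n)
    have "exp 1 * real n powr (1 - \<kappa>) = exp (ln n + (1 - \<kappa> * ln n))"
      using elim by (simp add: powr_def algebra_simps flip: exp_add)
    also have "\<dots> = n * exp (1 - \<kappa> * ln n)" using elim by (simp only: exp_add) simp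
    finally show ?case .
  qed
  ultimately have 1: "(\<lambda>n. n * exp (1 - \<kappa> * ln n)) \<longlonglongrightarrow> 0"
    by (simp add: filterlim_cong)
  have "filterlim (\<lambda>n. sqrt (ln (real n))) at_top sequentially"
    by (intro filterlim_compose[OF sqrt_at_top] filterlim_compose[OF ln_at_top] filterlim_real_sequentially)
  then have "(\<lambda>n. (40 / d) / sqrt (ln (real n))) \<longlonglongrightarrow> 0"
    by (rule tendsto_divide_0[OF tendsto_const filterlim_at_top_imp_at_infinity])
  from tendsto_add[OF this 1] show ?thesis by (simp add: \<kappa>_def)
qed

section \<open>Passage to the limit along even \<open>n\<close>\<close>

theorem theorem3p3:
  fixes z :: "nat \<Rightarrow> real vec"
    and p q :: "nat \<Rightarrow> real"
    and \<epsilon> :: real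
    and c :: "nat \<Rightarrow> real mat \<Rightarrow> real"
  assumes z_dim: "\<And>n. even n \<Longrightarrow> z n \<in> carrier_vec n"
    and z_sign: "\<And>n i. even n \<Longrightarrow> i < n \<Longrightarrow> z n $ i \<in> {-1, 1}"
    and z_balanced: "\<And>n. even n \<Longrightarrow> scalar_prod (z n) (ones_vec n) = 0"
    and pq: "\<And>n. even n \<Longrightarrow> 1 \<ge> p n \<and> p n \<ge> q n \<and> q n \<ge> 0"
    and eps: "0 < \<epsilon>" "\<epsilon> < 1 / 2"
    and threshold: "\<forall>\<^sub>F n in sequentially. even n \<longrightarrow>
      real n / ln (real n) *
        (sqrt ((1 - \<epsilon>) * p n + \<epsilon> * q n) - sqrt ((1 - \<epsilon>) * q n + \<epsilon> * p n))\<^sup>2 \<ge> 2"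
    and c: "c = (\<lambda>n A. (p n + q n) / 2) \<or>
            c = (\<lambda>n A. 1 / (real n)\<^sup>2 * mat_inner A (outer (ones_vec n) (ones_vec n)))"
  shows "((\<lambda>n. measure_pmf.prob (sbm_adjacency n (z n) (p n) (q n))
            {A. \<forall>r\<ge>2. \<forall>Y.
              second_order_critical n r
                (objective (A - c n A \<cdot>\<^sub>m outer (ones_vec n) (ones_vec n))) Y
              \<longrightarrow> Y * Y\<^sup>T = outer (z n) (z n)})
          \<longlongrightarrow> 1) (inf sequentially (principal {n. even n}))"
proof -
  \<comment> \<open>With \<open>d1 = d2 = d\<close> the requirements of
    \<open>recovery_on_good_graph\<close> read \<open>8 d \<le> 1 / 8\<close> and
    \<open>192 d < \<epsilon>\<close>.\<close>
  define d where "d = \<epsilon> / 200"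
  have d: "0 < d" using eps by (simp add: d_def)
  define e where "e n = 40 / (d * sqrt (ln (real n))) + n * exp (1 - ((1 - \<epsilon>) / (1 - 2 * \<epsilon>))\<^sup>2 * ln n)" for n :: nat
  have e0: "e \<longlonglongrightarrow> 0" unfolding e_def[abs_def] by (rule bad_graph_bound_tendsto_0[OF eps])
  let ?G = "\<lambda>n. {A. \<forall>r\<ge>2. \<forall>Y. second_order_critical n r
                (objective (A - c n A \<cdot>\<^sub>m outer (ones_vec n) (ones_vec n))) Y
              \<longrightarrow> Y * Y\<^sup>T = outer (z n) (z n)}"
  let ?p = "\<lambda>n. measure_pmf.prob (sbm_adjacency n (z n) (p n) (q n)) (?G n)"
  \<comment> \<open>This size of \<open>n\<close> serves to bound the diagonal term
    \<open>p n\<close> by \<open>d * N\<close>, starting from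
    \<open>2 n p^2 \<le> N^2\<close>.\<close>
  have "\<forall>\<^sub>F n in sequentially. 1 / (2 * d\<^sup>2) \<le> real n"
    using filterlim_real_sequentially by (simp add: filterlim_at_top)
  then have "\<forall>\<^sub>F n in sequentially. even n \<longrightarrow> 1 - e n \<le> ?p n"
    using threshold eventually_ge_at_top[of 3]
  proof eventually_elim
    case (elim n)
    show "even n \<longrightarrow> 1 - e n \<le> ?p n"
    proof
      assume n: "even n"
      note n3 = \<open>3 \<le> n\<close>
      define w where "w i = z n $ i" for i
      have w: "w i \<in> {-1, 1}" if "i < n" for i using z_sign[OF n that] by (simp add: w_def)
      have bal: "(\<Sum>i<n. w i) = 0"
        using z_balanced[OF n] by (simp add: scalar_prod_def ones_vec_def w_def atLeast0LessThan)
      have ln0: "1 < ln n"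
      proof -
        have "exp 1 < (3::real)" using e_less_272 by simp
        also have "\<dots> \<le> n" using n3 by simp
        finally show ?thesis using n3 by (subst exp_less_cancel_iff[symmetric]) simp
      qed
      have thr: "2 * ln n \<le> n * (sqrt ((1 - \<epsilon>) * p n + \<epsilon> * q n) - sqrt ((1 - \<epsilon>) * q n + \<epsilon> * p n))\<^sup>2"
        using elim n ln0 by (simp add: field_simps)
      have p0: "0 < p n"
      proof (rule ccontr)
        assume "\<not> 0 < p n"
        then have "p n = 0" "q n = 0" using pq[OF n] by auto
        then show False using thr ln0 by simp
      qed
      have pqn: "0 \<le> q n" "q n \<le> p n" "p n \<le> 1" using pq[OF n] by auto
      let ?P = "random_graph n (sbm_prob w (p n) (q n))"
      define N where "N = n * (p n - q n)"
      note bound = prob_bad_graph_le[OF n3 w bal pqn p0 eps d thr]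
      have N2: "2 * n * p n * ln n \<le> N\<^sup>2" using bound(1) by (simp add: N_def)
      have "0 < 2 * n * p n * ln n" using ln0 n3 p0 by simp
      \<comment> \<open>The strict inequality between \<open>q n\<close> and \<open>p n\<close> is a
        consequence of the threshold.\<close>
      then have "N \<noteq> 0" using N2 by auto
      then have qp: "q n < p n" using pqn by (auto simp: N_def)
      then have N0: "0 < N" using n3 by (simp add: N_def)
      have p_small: "p n \<le> d * N"
      proof (rule power2_le_imp_le)
        have "p n * p n \<le> p n * ln n" using pqn p0 ln0 by (intro mult_left_mono) linarith+
        then have "(2 * n) * (p n)\<^sup>2 \<le> (2 * n) * (p n * ln n)"
          unfolding power2_eq_square by (rule mult_left_mono) simp
        also have "\<dots> \<le> N\<^sup>2" using N2 by simp
        finally have "d\<^sup>2 * ((2 * n) * (p n)\<^sup>2) \<le> d\<^sup>2 * N\<^sup>2" by (intro mult_left_mono) auto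
        moreover have "1 \<le> d\<^sup>2 * (2 * n)" using elim(1) d by (simp add: field_simps)
        then have "1 * (p n)\<^sup>2 \<le> (d\<^sup>2 * (2 * n)) * (p n)\<^sup>2" by (intro mult_right_mono) auto
        ultimately show "(p n)\<^sup>2 \<le> (d * N)\<^sup>2" by (simp add: power_mult_distrib mult_ac)
      qed (use d N0 in simp)
      define good where "good = {E. (\<forall>x. (\<Sum>i<n. (\<Sum>j<n. centred_adjacency (sbm_prob w (p n) (q n)) E i j * x j)\<^sup>2)
              \<le> (d * (n * (p n - q n)))\<^sup>2 * (\<Sum>i<n. (x i)\<^sup>2)) \<and>
            (\<forall>i<n. \<epsilon> / 2 * (n * (p n - q n)) \<le> degree_gap n w E i)}"
      have "1 - e n \<le> 1 - measure_pmf.prob ?P (- good)"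
        using bound(2) by (simp add: e_def good_def Collect_neg_eq[symmetric])
      also have "\<dots> = measure_pmf.prob ?P good"
        using measure_pmf.prob_compl[of "good" ?P] by (simp add: Compl_eq_Diff_UNIV)
      also have "\<dots> \<le> measure_pmf.prob ?P (adjacency_mat n -` ?G n)"
      proof (intro measure_pmf.finite_measure_mono subsetI)
        fix E assume E: "E \<in> good"
        let ?A = "adjacency_mat n E"
        have "Y * Y\<^sup>T = outer (z n) (z n)" if r: "2 \<le> r"
          and crit: "second_order_critical n r (objective (?A - c n ?A \<cdot>\<^sub>m outer (ones_vec n) (ones_vec n))) Y" for r Y
        proof (rule eq_matI)
          have dimz: "dim_vec (z n) = n" using z_dim[OF n] by simp
          have Y: "Y \<in> carrier_mat n r" using crit by (simp add: second_order_critical_def sphere_product_def)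
          show "dim_row (Y * Y\<^sup>T) = dim_row (outer (z n) (z n))" "dim_col (Y * Y\<^sup>T) = dim_col (outer (z n) (z n))"
            using Y dimz by (auto simp: outer_def)
          fix i j assume "i < dim_row (outer (z n) (z n))" "j < dim_col (outer (z n) (z n))"
          then have ij: "i < n" "j < n" using dimz by (auto simp: outer_def)
          have "(Y * Y\<^sup>T) $$ (i, j) = w i * w j"
          proof (rule recovery_on_good_graph[of n w "q n" "p n" d d \<epsilon> E "c n ?A" r Y])
            show "c n ?A = (p n + q n) / 2 \<or> c n ?A = 1 / (real n)\<^sup>2 * mat_inner ?A (outer (ones_vec n) (ones_vec n))"
              using c by auto
            show "p n \<le> d * (real n * (p n - q n))" using p_small by (simp add: N_def)
            show "(\<Sum>i<n. (\<Sum>j<n. centred_adjacency (sbm_prob w (p n) (q n)) E i j * x j)\<^sup>2)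
              \<le> (d * (n * (p n - q n)))\<^sup>2 * (\<Sum>i<n. (x i)\<^sup>2)" for x
              using E by (simp add: good_def)
            show "\<epsilon> / 2 * (n * (p n - q n)) \<le> degree_gap n w E i" if "i < n" for i
              using E that by (simp add: good_def)
          qed (use n3 w bal pqn qp d eps r crit ij in \<open>auto simp: d_def\<close>)
          then show "(Y * Y\<^sup>T) $$ (i, j) = outer (z n) (z n) $$ (i, j)"
            using ij dimz by (simp add: outer_def w_def del: index_mult_mat(1))
        qed
        then show "E \<in> adjacency_mat n -` ?G n" by auto
      qed auto
      also have "\<dots> = ?p n"
      proof -
        have "sbm_edges n (z n) (p n) (q n) = ?P"
          by (simp add: sbm_edges_def random_graph_def edge_set_def sbm_prob_def w_def case_prod_unfold)
        then show ?thesis by (simp add: sbm_adjacency_def)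
      qed
      finally show "1 - e n \<le> ?p n" .
    qed
  qed
  then have lower: "\<forall>\<^sub>F n in inf sequentially (principal {n. even n}). 1 - e n \<le> ?p n"
    by (simp add: eventually_inf_principal)
  have "(\<lambda>n. 1 - e n) \<longlonglongrightarrow> 1 - 0" by (intro tendsto_diff tendsto_const e0)
  then have lim: "((\<lambda>n. 1 - e n) \<longlongrightarrow> 1) (inf sequentially (principal {n. even n}))"
    by (intro tendsto_mono[OF inf_le1]) simp
  show ?thesis
    by (rule tendsto_sandwich[OF lower _ lim tendsto_const]) (simp add: always_eventually)
qed

end
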